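(* Let $\alpha\in(0,2)$, and let $\Phi_\alpha$ be the self-similar profile defined in the context. Let $u_0\in BUC(\mathbb{R})$ satisfy $$\lim_{x\to-\infty}u_0(x)=0\quad\text{and}\quad\lim_{x\to+\infty}u_0(x)=1.$$ Let $u=u(x,t)$ be the unique viscosity solution of $$u_t=-|u_x|\,\Lambda^\alpha u \ \text{ on } \mathbb{R}\times(0,+\infty),\qquad u(x,0)=u_0(x)\ \text{ for } x\in\mathbb{R},$$ and for each $\lambda>1$ let $u^\lambda(x,t)=u(\lambda x,\lambda^{\alpha+1}t)$. Then, for any compact set $K\subset(\mathbb{R}\times[0,+\infty))\setminus\{(0,0)\}$, $$u^\lambda(x,t)\to\Phi_\alpha\!\left(\frac{x}{t^{1/(\alpha+1)}}\right)\quad\text{in } L^\infty(K)\quad\text{as }\lambda\to+\infty.$$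
   Context: $BUC(\mathbb{R})$ is the space of bounded uniformly continuous functions on $\mathbb{R}$. At $t=0$, $x\ne0$, the expression $\Phi_\alpha(x/t^{1/(\alpha+1)})$ is understood as its limit as $t\to0^+$, i.e. $0$ for $x<0$ and $1$ for $x>0$. Operator. For $\alpha\in(0,2)$, $\Lambda^\alpha$ is given on Schwartz functions by $\widehat{(\Lambda^\alpha w)}(\xi)=|\xi|^\alpha\widehat w(\xi)$, and on bounded sufficiently smooth functions by the Lévy–Khintchine formula $$-\Lambda^\alpha w(x)=C(\alpha)\int_{\mathbb{R}}\left\{w(x+z)-w(x)-z\,w'(x)\mathbf 1_{\{|z|\le 1\}}\right\}\frac{dz}{|z|^{1+\alpha}},$$ with the constant $C(\alpha)>0$ for which the two definitions agree. Profile. Let $K(\alpha)=\Gamma(1/2)\left[2^\alpha\Gamma(1+\alpha/2)\Gamma((1+\alpha)/2)\right]^{-1}$, $v(x)=K(\alpha)(1-|x|^2)^{\alpha/2}$ for $|x|<1$ and $v(x)=0$ for $|x|\ge1$, $U(x)=\int_0^x v(y)\,dy$, $M=\int_0^1 v(y)\,dy$, and $y_\alpha=\left(\frac{\alpha+1}{2M}\right)^{1/(\alpha+1)}$. The self-similar profile is $\Phi_\alpha(y)=\frac{1}{2M}\left\{U(y/y_\alpha)+M\right\}$. It is nondecreasing, of regularity $C^{1+\alpha/2}$ on $\mathbb{R}$, analytic on $(-y_\alpha,y_\alpha)$, equal to $0$ on $(-\infty,-y_\alpha)$ and to $1$ on $(y_\alpha,+\infty)$, and $(\Lambda^\alpha\Phi_\alpha)(y)=y/(\alpha+1)$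 for $y\in(-y_\alpha,y_\alpha)$. Envelopes. For a locally bounded function $u$, $u^*(x,t)=\limsup_{y\to x,\,s\to t}u(y,s)$ and $u_*(x,t)=\liminf_{y\to x,\,s\to t}u(y,s)$ are its upper and lower semicontinuous envelopes (over $(y,s)\in\mathbb{R}\times[0,+\infty)$, including $(x,t)$ itself); similarly for functions of $x$ only. Viscosity solutions. A bounded upper (resp. lower) semicontinuous function $u:\mathbb{R}\times[0,+\infty)\to\mathbb{R}$ is a viscosity subsolution (resp. supersolution) of $u_t=-|u_x|\Lambda^\alpha u$ on $\mathbb{R}\times(0,+\infty)$ if for every $(x_0,t_0)$ with $t_0>0$, every $\tau\in(0,t_0)$ and every test function $\phi\in C^2(\mathbb{R}\times(0,+\infty))\cap L^\infty(\mathbb{R}\times(0,+\infty))$ such that $u-\phi$ attains a maximum (resp. minimum) over $\mathbb{R}\times(t_0-\tau,t_0+\tau)$ at $(x_0,t_0)$, one has $$\partial_t\phi(x_0,t_0)+|\phi_x(x_0,t_0)|\,(\Lambda^\alpha\phi(\cdot,t_0))(x_0)\le 0\quad(\text{resp. }\ge0),$$ with $\Lambda^\alpha\phi$ given by the Lévy–Khintchine formula. It is a subsolution (resp. supersolution) of the initial value problem with datum $u_0$ on $\mathbb{R}\times[0,+\infty)$ if moreover $u(\cdot,0)\le u_0^*$ (resp. $u(\cdot,0)\ge(u_0)_*$). A function $u$ is a viscosity solution of the equation (resp. of the initial value problem) if $u^*$ is a viscosity subsolution and $u_*$ is a viscosity supersolution. For every $u_0\in BUC(\mathbb{R})$ the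 initial value problem has a unique bounded continuous viscosity solution. *)

theory Defs
  imports "HOL-Analysis.Analysis"
begin

section \<open>The fractional Laplacian\<close>

definition levy_integral :: "real \<Rightarrow> (real \<Rightarrow> real) \<Rightarrow> real \<Rightarrow> real" where
  "levy_integral \<alpha> w x =
    (LINT z|lborel. (w (x + z) - w x - z * deriv w x * indicator {-1..1} z) / \<bar>z\<bar> powr (1 + \<alpha>))"

definition schwartz :: "(real \<Rightarrow> real) \<Rightarrow> bool" where
  "schwartz w \<longleftrightarrow>
    (\<forall>n x. (deriv ^^ n) w differentiable (at x)) \<and>
    (\<forall>m n. bounded (range (\<lambda>x. x ^ m * (deriv ^^ n) w x)))"

text \<open>The factor is exp(-i x xi); with this convention (no 2 pi in the exponent) the symbol
  of minus the second derivative is the square of xi.\<close>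

definition fourier :: "(real \<Rightarrow> real) \<Rightarrow> real \<Rightarrow> complex" where
  "fourier w \<xi> = (LINT x|lborel. cis (- (x * \<xi>)) * complex_of_real (w x))"

text \<open>The normalising constant is the one for which the Levy-Khintchine operator has Fourier
  symbol given by the alpha-th power of the absolute value of xi.\<close>

definition levy_const :: "real \<Rightarrow> real" where
  "levy_const \<alpha> = (THE C. C > 0 \<and>
     (\<forall>w. schwartz w \<longrightarrow>
       (\<forall>\<xi>. fourier (\<lambda>x. - (C * levy_integral \<alpha> w x)) \<xi> =
             complex_of_real (\<bar>\<xi>\<bar> powr \<alpha>) * fourier w \<xi>)))"

definition frac_lap :: "real \<Rightarrow> (real \<Rightarrow> real) \<Rightarrow> real \<Rightarrow> real" where
  "frac_lap \<alpha> w x = - (levy_const \<alpha> * levy_integral \<alpha> w x)"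


section \<open>The self-similar profile\<close>

definition K_const :: "real \<Rightarrow> real" where
  "K_const \<alpha> = Gamma (1/2) / (2 powr \<alpha> * Gamma (1 + \<alpha>/2) * Gamma ((1 + \<alpha>)/2))"

definition profile_v :: "real \<Rightarrow> real \<Rightarrow> real" where
  "profile_v \<alpha> x = (if \<bar>x\<bar> < 1 then K_const \<alpha> * (1 - \<bar>x\<bar>\<^sup>2) powr (\<alpha>/2) else 0)"

text \<open>The interval integral is oriented, so this is negative for negative arguments.\<close>

definition profile_U :: "real \<Rightarrow> real \<Rightarrow> real" where
  "profile_U \<alpha> x = (LBINT y=ereal 0..ereal x. profile_v \<alpha> y)"

definition profile_M :: "real \<Rightarrow> real" where
  "profile_M \<alpha> = (LBINT y=ereal 0..ereal 1. profile_v \<alpha> y)"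

definition profile_y :: "real \<Rightarrow> real" where
  "profile_y \<alpha> = ((\<alpha> + 1) / (2 * profile_M \<alpha>)) powr (1 / (\<alpha> + 1))"

definition profile_Phi :: "real \<Rightarrow> real \<Rightarrow> real" where
  "profile_Phi \<alpha> y =
     1 / (2 * profile_M \<alpha>) * (profile_U \<alpha> (y / profile_y \<alpha>) + profile_M \<alpha>)"

text \<open>For t = 0 and nonzero x the value is the limit as t decreases to 0 (the quotient would
  be read as x / 0 = 0 in HOL). The value at the origin is irrelevant.\<close>

definition self_similar :: "real \<Rightarrow> real \<times> real \<Rightarrow> real" where
  "self_similar \<alpha> = (\<lambda>(x, t).
     if t = 0 then (if x < 0 then 0 else 1)
     else profile_Phi \<alpha> (x / t powr (1 / (\<alpha> + 1))))"


section \<open>Semicontinuity and envelopes\<close>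

definition usc_on :: "'a::topological_space set \<Rightarrow> ('a \<Rightarrow> real) \<Rightarrow> bool" where
  "usc_on S u \<longleftrightarrow> (\<forall>p\<in>S. \<forall>c>u p. eventually (\<lambda>q. u q < c) (at p within S))"

definition lsc_on :: "'a::topological_space set \<Rightarrow> ('a \<Rightarrow> real) \<Rightarrow> bool" where
  "lsc_on S u \<longleftrightarrow> (\<forall>p\<in>S. \<forall>c<u p. eventually (\<lambda>q. c < u q) (at p within S))"

definition locally_bounded_on :: "'a::topological_space set \<Rightarrow> ('a \<Rightarrow> real) \<Rightarrow> bool" where
  "locally_bounded_on S u \<longleftrightarrow>
     (\<forall>p\<in>S. \<exists>V. open V \<and> p \<in> V \<and> bounded (u ` (V \<inter> S)))"

text \<open>The limits run over all points of the set near p, including p itself. They are taken in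
  the extended reals and are finite when the function is locally bounded.\<close>

definition upper_env :: "'a::topological_space set \<Rightarrow> ('a \<Rightarrow> real) \<Rightarrow> 'a \<Rightarrow> real" where
  "upper_env S u p = real_of_ereal (Limsup (inf (nhds p) (principal S)) (\<lambda>q. ereal (u q)))"

definition lower_env :: "'a::topological_space set \<Rightarrow> ('a \<Rightarrow> real) \<Rightarrow> 'a \<Rightarrow> real" where
  "lower_env S u p = real_of_ereal (Liminf (inf (nhds p) (principal S)) (\<lambda>q. ereal (u q)))"


section \<open>Viscosity solutions\<close>

text \<open>Points of the space-time domain are pairs (x, t); functions on the closed half-plane are
  total functions whose values at negative times are never used.\<close>

abbreviation closed_half :: "(real \<times> real) set" where
  "closed_half \<equiv> UNIV \<times> {0..}"

abbreviation open_half :: "(real \<times> real) set" where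
  "open_half \<equiv> UNIV \<times> {0<..}"

text \<open>Twice continuously Frechet differentiable; S is meant to be open.\<close>

definition C2_on :: "'a::real_normed_vector set \<Rightarrow> ('a \<Rightarrow> real) \<Rightarrow> bool" where
  "C2_on S f \<longleftrightarrow>
     (\<exists>(f' :: 'a \<Rightarrow> 'a \<Rightarrow>\<^sub>L real) (f'' :: 'a \<Rightarrow> 'a \<Rightarrow>\<^sub>L 'a \<Rightarrow>\<^sub>L real).
        (\<forall>p\<in>S. (f has_derivative blinfun_apply (f' p)) (at p)) \<and>
        (\<forall>p\<in>S. (f' has_derivative blinfun_apply (f'' p)) (at p)) \<and>
        continuous_on S f'')"

text \<open>The left-hand side of the equation, evaluated at a test function.\<close>

definition visc_lhs :: "real \<Rightarrow> (real \<times> real \<Rightarrow> real) \<Rightarrow> real \<Rightarrow> real \<Rightarrow> real" where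
  "visc_lhs \<alpha> \<phi> x0 t0 =
     deriv (\<lambda>t. \<phi> (x0, t)) t0
     + \<bar>deriv (\<lambda>x. \<phi> (x, t0)) x0\<bar> * frac_lap \<alpha> (\<lambda>x. \<phi> (x, t0)) x0"

definition viscosity_subsolution :: "real \<Rightarrow> (real \<times> real \<Rightarrow> real) \<Rightarrow> bool" where
  "viscosity_subsolution \<alpha> u \<longleftrightarrow>
     bounded (u ` closed_half) \<and> usc_on closed_half u \<and>
     (\<forall>x0 t0 \<tau> \<phi>. 0 < t0 \<longrightarrow> 0 < \<tau> \<longrightarrow> \<tau> < t0 \<longrightarrow>
        C2_on open_half \<phi> \<longrightarrow> bounded (\<phi> ` open_half) \<longrightarrow>
        (\<forall>x. \<forall>t\<in>{t0 - \<tau><..<t0 + \<tau>}. u (x, t) - \<phi> (x, t) \<le> u (x0, t0) - \<phi> (x0, t0)) \<longrightarrow>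
        visc_lhs \<alpha> \<phi> x0 t0 \<le> 0)"

definition viscosity_supersolution :: "real \<Rightarrow> (real \<times> real \<Rightarrow> real) \<Rightarrow> bool" where
  "viscosity_supersolution \<alpha> u \<longleftrightarrow>
     bounded (u ` closed_half) \<and> lsc_on closed_half u \<and>
     (\<forall>x0 t0 \<tau> \<phi>. 0 < t0 \<longrightarrow> 0 < \<tau> \<longrightarrow> \<tau> < t0 \<longrightarrow>
        C2_on open_half \<phi> \<longrightarrow> bounded (\<phi> ` open_half) \<longrightarrow>
        (\<forall>x. \<forall>t\<in>{t0 - \<tau><..<t0 + \<tau>}. u (x, t) - \<phi> (x, t) \<ge> u (x0, t0) - \<phi> (x0, t0)) \<longrightarrow>
        visc_lhs \<alpha> \<phi> x0 t0 \<ge> 0)"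

definition ivp_subsolution :: "real \<Rightarrow> (real \<Rightarrow> real) \<Rightarrow> (real \<times> real \<Rightarrow> real) \<Rightarrow> bool" where
  "ivp_subsolution \<alpha> u0 u \<longleftrightarrow>
     viscosity_subsolution \<alpha> u \<and> (\<forall>x. u (x, 0) \<le> upper_env UNIV u0 x)"

definition ivp_supersolution :: "real \<Rightarrow> (real \<Rightarrow> real) \<Rightarrow> (real \<times> real \<Rightarrow> real) \<Rightarrow> bool" where
  "ivp_supersolution \<alpha> u0 u \<longleftrightarrow>
     viscosity_supersolution \<alpha> u \<and> (\<forall>x. u (x, 0) \<ge> lower_env UNIV u0 x)"

definition ivp_solution :: "real \<Rightarrow> (real \<Rightarrow> real) \<Rightarrow> (real \<times> real \<Rightarrow> real) \<Rightarrow> bool" where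
  "ivp_solution \<alpha> u0 u \<longleftrightarrow>
     locally_bounded_on closed_half u \<and>
     ivp_subsolution \<alpha> u0 (upper_env closed_half u) \<and>
     ivp_supersolution \<alpha> u0 (lower_env closed_half u)"

definition BUC :: "(real \<Rightarrow> real) set" where
  "BUC = {f. bounded (range f) \<and> uniformly_continuous_on UNIV f}"

definition rescale :: "real \<Rightarrow> real \<Rightarrow> (real \<times> real \<Rightarrow> real) \<Rightarrow> real \<times> real \<Rightarrow> real" where
  "rescale \<alpha> l u = (\<lambda>(x, t). u (l * x, l powr (\<alpha> + 1) * t))"

end

theory Submission
  imports Defs "HOL-Probability.Characteristic_Functions"
begin

text \<open>It suffices to bound \<open>u\<close> from above, since \<open>1 - u (- x, t)\<close> satisfies the same hypotheses and the
  profile has the corresponding symmetry. The upper bound comes from comparing \<open>u\<close> with explicit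
  smooth supersolutions, first on a fixed time interval and then for all later times.
  Since \<open>u0\<close> may exceed 1, a bump-shaped barrier with a kink at its top, whose height decays like a
  power of time, first brings \<open>u\<close> below \<open>1 + 2 * e\<close> at some time \<open>T\<close>, while travelling
  waves control \<open>u\<close> near \<open>-\<infinity>\<close> and \<open>\<infinity>\<close> up to that time. From then on \<open>u\<close> stays below a slightly
  smoothed and translated copy of the self-similar solution, up to an additive error of order \<open>e\<close>.
  Translations in space are invisible after rescaling.

  The smoothed copy is a supersolution because the fractional Laplacian of the profile is linear on the
  support of its slope; with the correct constant this follows from an explicit substitution in the
  singular integral, and the constant itself from the Fourier symbol of the operator.\<close>

section \<open>The singular integral in symmetric form\<close>

text \<open>The obstacle is regularity: a barrier must be a C^2 test function, while the profile is
  only C^(1 + \<alpha>/2). Averaging over translations repairs this because it commutes with the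
  operator. The equation is invariant under translations, under adding constants and under (x, t) ->
  (l x, l^(\<alpha> + 1) t). Hence an error c in the data costs c at all later times, while a shift
  A shrinks to A / l under rescaling. The equation degenerates where the slope vanishes, so the
  smoothed profile only has to satisfy an inequality on the support of its slope. The same
  degeneracy makes an overshoot above 1 stubborn, and it has to be removed before a barrier of total
  height 1 can be put above u. As for the constants, \<open>levy_const\<close> is characterised by a
  Fourier symbol and \<open>K_const\<close> by Gamma values. Both computations end in the same
  integral \<open>J_int\<close>, which cancels, and what remains is
  \<open>K_const \<alpha> * Gamma (1 + \<alpha>) = 1\<close>, an instance of Legendre's duplication
  formula.\<close>

definition second_diff :: "(real \<Rightarrow> real) \<Rightarrow> real \<Rightarrow> real \<Rightarrow> real" where
  "second_diff f x z = f (x + z) + f (x - z) - 2 * f x"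

text \<open>Supported on the positive half-line: folding z with -z in the Levy-Khintchine formula
  cancels the compensator, so that neither a derivative nor a cut-off at 1 remains.\<close>

definition levy_kernel :: "real \<Rightarrow> real \<Rightarrow> real" where
  "levy_kernel \<alpha> z = indicator {0<..} z * z powr (-1 - \<alpha>)"

definition slevy :: "real \<Rightarrow> (real \<Rightarrow> real) \<Rightarrow> real \<Rightarrow> real" where
  "slevy \<alpha> f x = (\<integral>z. second_diff f x z * levy_kernel \<alpha> z \<partial>lborel)"

text \<open>An exponent \<gamma> above \<alpha> makes the singular integral converge at 0. It is 2
  for C^2 functions and 1 + \<alpha>/2 for the profile, which is above \<alpha> precisely because
  \<alpha> < 2.\<close>

definition levy_bound :: "real \<Rightarrow> real \<Rightarrow> real \<Rightarrow> (real \<Rightarrow> real) \<Rightarrow> bool" where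
  "levy_bound \<alpha> c \<gamma> f \<longleftrightarrow> 0 < \<alpha> \<and> \<alpha> < \<gamma> \<and> continuous_on UNIV f \<and>
     (\<forall>x. \<forall>z>0. \<bar>second_diff f x z\<bar> \<le> c * min (z powr \<gamma>) 1)"

definition C2_bounded :: "(real \<Rightarrow> real) \<Rightarrow> bool" where
  "C2_bounded f \<longleftrightarrow> (\<exists>f' f''. (\<forall>x. (f has_real_derivative f' x) (at x)) \<and>
     (\<forall>x. (f' has_real_derivative f'' x) (at x)) \<and> continuous_on UNIV f'' \<and>
     bounded (range f) \<and> bounded (range f') \<and> bounded (range f''))"

lemma levy_kernel_nonneg: "0 \<le> levy_kernel \<alpha> z"
  by (simp add: levy_kernel_def)

lemma levy_kernel_measurable [measurable]: "levy_kernel \<alpha> \<in> borel_measurable borel"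
  unfolding levy_kernel_def by measurable

text \<open>The common majorant: integrable near 0 since \<gamma> > \<alpha>, and at infinity since
  \<alpha> > 0.\<close>

lemma min_powr_kernel_integrable:
  assumes "0 < \<alpha>" "\<alpha> < \<gamma>"
  shows "integrable lborel (\<lambda>z. min (z powr \<gamma>) 1 * levy_kernel \<alpha> z)"
proof -
  let ?f = "\<lambda>z::real. (if z \<in> {0..1} then z powr (\<gamma> - 1 - \<alpha>) else 0)"
  let ?g = "\<lambda>z::real. (if z \<in> {1..} then z powr (-1 - \<alpha>) else 0)"
  have "(?f has_integral (1 powr (\<gamma> - 1 - \<alpha> + 1) / (\<gamma> - 1 - \<alpha> + 1))) UNIV"
    using has_integral_powr_from_0[of "\<gamma> - 1 - \<alpha>" 1] assms
    by (subst has_integral_restrict_UNIV) auto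
  hence "integral\<^sup>N lborel ?f = ennreal (1 powr (\<gamma> - 1 - \<alpha> + 1) / (\<gamma> - 1 - \<alpha> + 1))"
    by (intro nn_integral_has_integral_lborel) auto
  hence f: "integrable lborel ?f"
    by (intro integrableI_nn_integral_finite) auto
  have "(?g has_integral (-(1 powr (-1 - \<alpha> + 1)) / (-1 - \<alpha> + 1))) UNIV"
    using has_integral_powr_to_inf[of "-1 - \<alpha>" 1] assms
    by (subst has_integral_restrict_UNIV) auto
  hence "integral\<^sup>N lborel ?g = ennreal (-(1 powr (-1 - \<alpha> + 1)) / (-1 - \<alpha> + 1))"
    by (intro nn_integral_has_integral_lborel) auto
  hence g: "integrable lborel ?g"
    by (intro integrableI_nn_integral_finite) auto
  show ?thesis
  proof (rule Bochner_Integration.integrable_bound[OF Bochner_Integration.integrable_add[OF f g]])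
    show "AE z in lborel. norm (min (z powr \<gamma>) 1 * levy_kernel \<alpha> z) \<le> norm (?f z + ?g z)"
    proof (rule AE_I2)
      fix z :: real
      consider "z \<le> 0" | "0 < z" "z < 1" | "1 \<le> z" by linarith
      thus "norm (min (z powr \<gamma>) 1 * levy_kernel \<alpha> z) \<le> norm (?f z + ?g z)"
      proof cases
        case 2
        hence "min (z powr \<gamma>) 1 * z powr (-1 - \<alpha>) \<le> z powr \<gamma> * z powr (-1 - \<alpha>)"
          by (intro mult_right_mono) auto
        also have "\<dots> = z powr (\<gamma> - 1 - \<alpha>)"
          by (simp add: powr_add[symmetric] algebra_simps)
        finally show ?thesis using 2 by (simp add: levy_kernel_def)
      next
        case 3
        have "min (z powr \<gamma>) 1 * z powr (-1 - \<alpha>) \<le> 1 * z powr (-1 - \<alpha>)"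
          by (intro mult_right_mono) auto
        thus ?thesis using 3 by (auto simp: levy_kernel_def)
      qed (auto simp: levy_kernel_def)
    qed
  qed measurable
qed

lemma levy_bound_measurable:
  "levy_bound \<alpha> c \<gamma> f \<Longrightarrow> f \<in> borel_measurable borel"
  by (auto simp: levy_bound_def intro: borel_measurable_continuous_onI)

lemma second_diff_measurable [measurable]:
  assumes [measurable]: "f \<in> borel_measurable borel"
  shows "(\<lambda>z. second_diff f x z) \<in> borel_measurable borel"
  unfolding second_diff_def by measurable

lemma levy_bound_le:
  assumes "levy_bound \<alpha> c \<gamma> f"
  shows "\<bar>second_diff f x z * levy_kernel \<alpha> z\<bar> \<le> c * (min (z powr \<gamma>) 1 * levy_kernel \<alpha> z)"
proof (cases "0 < z")
  case True
  hence "\<bar>second_diff f x z\<bar> * levy_kernel \<alpha> z \<le> c * min (z powr \<gamma>) 1 * levy_kernel \<alpha> z"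
    using assms by (intro mult_right_mono levy_kernel_nonneg) (auto simp: levy_bound_def)
  thus ?thesis by (simp add: abs_mult levy_kernel_nonneg mult.assoc)
qed (simp add: levy_kernel_def)

lemma slevy_integrable:
  assumes "levy_bound \<alpha> c \<gamma> f"
  shows "integrable lborel (\<lambda>z. second_diff f x z * levy_kernel \<alpha> z)"
proof (rule Bochner_Integration.integrable_bound)
  show "integrable lborel (\<lambda>z. c * (min (z powr \<gamma>) 1 * levy_kernel \<alpha> z))"
    using assms by (intro integrable_mult_right min_powr_kernel_integrable) (auto simp: levy_bound_def)
  have [measurable]: "f \<in> borel_measurable borel" by (rule levy_bound_measurable[OF assms])
  show "(\<lambda>z. second_diff f x z * levy_kernel \<alpha> z) \<in> borel_measurable lborel" by simp
  show "AE z in lborel. norm (second_diff f x z * levy_kernel \<alpha> z)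
    \<le> norm (c * (min (z powr \<gamma>) 1 * levy_kernel \<alpha> z))"
    using levy_bound_le[OF assms, of x] by (intro AE_I2) (smt (verit, ccfv_SIG) real_norm_def)
qed

lemma slevy_bounded:
  assumes "levy_bound \<alpha> c \<gamma> f"
  shows "\<bar>slevy \<alpha> f x\<bar> \<le> c * (\<integral>z. min (z powr \<gamma>) 1 * levy_kernel \<alpha> z \<partial>lborel)"
proof -
  have 1: "integrable lborel (\<lambda>z. c * (min (z powr \<gamma>) 1 * levy_kernel \<alpha> z))"
    using assms by (intro integrable_mult_right min_powr_kernel_integrable) (auto simp: levy_bound_def)
  have "\<bar>slevy \<alpha> f x\<bar> \<le> (\<integral>z. \<bar>second_diff f x z * levy_kernel \<alpha> z\<bar> \<partial>lborel)"
    unfolding slevy_def by (rule integral_abs_bound)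
  also have "\<dots> \<le> (\<integral>z. c * (min (z powr \<gamma>) 1 * levy_kernel \<alpha> z) \<partial>lborel)"
    by (intro integral_mono integrable_abs slevy_integrable[OF assms] 1 levy_bound_le[OF assms])
  finally show ?thesis by simp
qed

text \<open>The majorant does not depend on x, so dominated convergence applies. Continuity is what
  carries information from one point (the top of the bump) or from an open interval (the support of
  the profile) to a neighbourhood.\<close>

lemma slevy_continuous:
  assumes "levy_bound \<alpha> c \<gamma> f"
  shows "continuous_on UNIV (slevy \<alpha> f)"
proof -
  have cont: "isCont f x" for x
    using assms by (simp add: levy_bound_def continuous_on_eq_continuous_at)
  have [measurable]: "f \<in> borel_measurable borel" by (rule levy_bound_measurable[OF assms])
  have "isCont (slevy \<alpha> f) x" for x
    unfolding continuous_at_sequentially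
  proof safe
    fix X assume X: "X \<longlonglongrightarrow> x"
    show "(slevy \<alpha> f \<circ> X) \<longlonglongrightarrow> slevy \<alpha> f x"
      unfolding slevy_def comp_def
    proof (rule integral_dominated_convergence)
      show "integrable lborel (\<lambda>z. c * (min (z powr \<gamma>) 1 * levy_kernel \<alpha> z))"
        using assms by (intro integrable_mult_right min_powr_kernel_integrable) (auto simp: levy_bound_def)
      have "(\<lambda>n. second_diff f (X n) z) \<longlonglongrightarrow> second_diff f x z" for z
        unfolding second_diff_def
        by (intro tendsto_intros isCont_tendsto_compose[OF cont] X)
      thus "AE z in lborel. (\<lambda>n. second_diff f (X n) z * levy_kernel \<alpha> z)
          \<longlonglongrightarrow> second_diff f x z * levy_kernel \<alpha> z"
        by (intro AE_I2 tendsto_intros)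
    qed (use levy_bound_le[OF assms] in auto)
  qed
  thus ?thesis by (simp add: continuous_at_imp_continuous_on)
qed

lemma slevy_add:
  assumes "levy_bound \<alpha> c \<gamma> f" "levy_bound \<alpha> d \<delta> g"
  shows "slevy \<alpha> (\<lambda>y. f y + g y) x = slevy \<alpha> f x + slevy \<alpha> g x"
  unfolding slevy_def
  by (subst Bochner_Integration.integral_add[OF slevy_integrable[OF assms(1)] slevy_integrable[OF assms(2)], symmetric])
     (auto intro!: Bochner_Integration.integral_cong simp: second_diff_def algebra_simps)

lemma slevy_affine:
  "slevy \<alpha> (\<lambda>y. a * f y + b) x = a * slevy \<alpha> f x"
  unfolding slevy_def
  by (subst integral_mult_right_zero[symmetric])
     (auto intro!: Bochner_Integration.integral_cong simp: second_diff_def algebra_simps)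

lemma levy_kernel_scale:
  assumes "0 < r"
  shows "levy_kernel \<alpha> (z / r) = r powr (1 + \<alpha>) * levy_kernel \<alpha> z"
proof (cases "0 < z")
  case True
  thus ?thesis using assms
    by (simp add: levy_kernel_def powr_divide powr_minus divide_simps powr_diff powr_add)
next
  case False
  hence "\<not> 0 < z / r" using assms by (simp add: zero_less_divide_iff)
  thus ?thesis using False by (simp add: levy_kernel_def)
qed

text \<open>Substitute |m| z in the integral; the sign of m disappears because the second difference
  is even in z.\<close>

lemma slevy_scale:
  assumes "m \<noteq> 0"
  shows "slevy \<alpha> (\<lambda>y. f (m * y + n)) x = \<bar>m\<bar> powr \<alpha> * slevy \<alpha> f (m * x + n)"
proof -
  let ?g = "\<lambda>z. second_diff f (m * x + n) z * levy_kernel \<alpha> (z / \<bar>m\<bar>)"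
  have sd: "second_diff (\<lambda>y. f (m * y + n)) x z = second_diff f (m * x + n) (\<bar>m\<bar> * z)" for z
    by (cases "m > 0") (auto simp: second_diff_def algebra_simps)
  have "slevy \<alpha> (\<lambda>y. f (m * y + n)) x = (\<integral>z. ?g (0 + \<bar>m\<bar> * z) \<partial>lborel)"
    using assms by (simp add: slevy_def sd)
  also have "\<dots> = (1 / \<bar>m\<bar>) * (\<integral>z. ?g z \<partial>lborel)"
    using lborel_integral_real_affine[of "\<bar>m\<bar>" ?g 0] assms by simp
  also have "(\<integral>z. ?g z \<partial>lborel) = (\<integral>z. \<bar>m\<bar> powr (1 + \<alpha>) * (second_diff f (m * x + n) z * levy_kernel \<alpha> z) \<partial>lborel)"
    using assms by (intro Bochner_Integration.integral_cong) (auto simp: levy_kernel_scale)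
  also have "\<dots> = \<bar>m\<bar> powr (1 + \<alpha>) * slevy \<alpha> f (m * x + n)"
    by (simp add: slevy_def)
  finally show ?thesis using assms by (simp add: powr_add)
qed

section \<open>Bounded C^2 functions and the Levy-Khintchine formula\<close>

lemma derivative_bound_imp_lipschitz:
  fixes f :: "real \<Rightarrow> real"
  assumes "\<And>x. (f has_real_derivative f' x) (at x)" "\<And>x. \<bar>f' x\<bar> \<le> D"
  shows "\<bar>f x - f y\<bar> \<le> D * \<bar>x - y\<bar>"
  using field_differentiable_bound[of UNIV f f' D x y] assms by auto

lemma C2_boundedE:
  assumes "C2_bounded f"
  obtains f' f'' D where "\<And>x. (f has_real_derivative f' x) (at x)"
    "\<And>x. (f' has_real_derivative f'' x) (at x)" "continuous_on UNIV f''"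
    "\<And>x. \<bar>f x\<bar> \<le> D" "\<And>x. \<bar>f' x\<bar> \<le> D" "\<And>x. \<bar>f'' x\<bar> \<le> D" "0 < D"
proof -
  obtain f' f'' where 1: "\<And>x. (f has_real_derivative f' x) (at x)"
     "\<And>x. (f' has_real_derivative f'' x) (at x)" "continuous_on UNIV f''"
     "bounded (range f)" "bounded (range f')" "bounded (range f'')"
    using assms unfolding C2_bounded_def by blast
  obtain D1 D2 D3 where "\<And>x. \<bar>f x\<bar> \<le> D1" "\<And>x. \<bar>f' x\<bar> \<le> D2" "\<And>x. \<bar>f'' x\<bar> \<le> D3"
    using 1(4-6) unfolding bounded_iff by auto
  hence "\<And>x. \<bar>f x\<bar> \<le> max 1 (max D1 (max D2 D3))" "\<And>x. \<bar>f' x\<bar> \<le> max 1 (max D1 (max D2 D3))"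
     "\<And>x. \<bar>f'' x\<bar> \<le> max 1 (max D1 (max D2 D3))" "0 < max 1 (max D1 (max D2 D3))"
    by (auto simp: le_max_iff_disj)
  with 1(1-3) show ?thesis using that by blast
qed

lemma C2_boundedI:
  assumes "\<And>x. (f has_real_derivative f' x) (at x)"
    "\<And>x. (f' has_real_derivative f'' x) (at x)" "continuous_on UNIV f''"
    "\<And>x. \<bar>f x\<bar> \<le> D0" "\<And>x. \<bar>f' x\<bar> \<le> D1" "\<And>x. \<bar>f'' x\<bar> \<le> D2"
  shows "C2_bounded f"
proof -
  have "bounded (range f)" "bounded (range f')" "bounded (range f'')"
    using assms(4-6) by (auto simp: bounded_iff)
  thus ?thesis unfolding C2_bounded_def using assms(1-3) by blast
qed

text \<open>The mean value theorem in z reduces the second difference to z times a difference of f'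
  over a distance below 2 z, which the bound on f'' controls.\<close>

lemma C2_bounded_levy_bound:
  assumes "C2_bounded f" "0 < \<alpha>" "\<alpha> < 2"
  shows "\<exists>c. levy_bound \<alpha> c 2 f"
proof -
  obtain f' f'' D where f: "\<And>x. (f has_real_derivative f' x) (at x)"
    "\<And>x. (f' has_real_derivative f'' x) (at x)"
    "\<And>x. \<bar>f x\<bar> \<le> D" "\<And>x. \<bar>f'' x\<bar> \<le> D" "0 < D"
    using C2_boundedE[OF assms(1)] by metis
  have "\<bar>second_diff f x z\<bar> \<le> (4 * D) * min (z powr 2) 1" if "z > 0" for x z
  proof -
    have "\<exists>y>0. y < z \<and> second_diff f x z - second_diff f x 0 = (z - 0) * (f' (x + y) - f' (x - y))"
      using that unfolding second_diff_def
      by (intro MVT2) (auto intro!: derivative_eq_intros DERIV_chain2[OF f(1)])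
    then obtain y where y: "0 < y" "y < z" "second_diff f x z = z * (f' (x + y) - f' (x - y))"
      by (auto simp: second_diff_def)
    have "\<bar>f' (x + y) - f' (x - y)\<bar> \<le> D * \<bar>(x + y) - (x - y)\<bar>"
      by (rule derivative_bound_imp_lipschitz[OF f(2) f(4)])
    also have "\<dots> \<le> D * (2 * z)" using y f(5) by (intro mult_left_mono) auto
    finally have "\<bar>second_diff f x z\<bar> \<le> z * (D * (2 * z))"
      using y that by (simp add: abs_mult)
    also have "\<dots> \<le> 4 * D * z powr 2" using that f(5) by (simp add: power2_eq_square algebra_simps)
    finally have "\<bar>second_diff f x z\<bar> \<le> 4 * D * z powr 2" .
    moreover have "\<bar>second_diff f x z\<bar> \<le> 4 * D"
      using f(3)[of "x+z"] f(3)[of "x-z"] f(3)[of x] by (simp add: second_diff_def)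
    ultimately show ?thesis by (simp add: min_def)
  qed
  moreover have "continuous_on UNIV f"
    using f(1) by (meson DERIV_isCont continuous_at_imp_continuous_on)
  ultimately show ?thesis using assms by (auto simp: levy_bound_def)
qed

text \<open>The compensated integrand is absolutely integrable on each half-line. After reflecting
  the negative half, the two compensators, being odd in z, cancel.\<close>

lemma levy_integral_eq_slevy:
  assumes "C2_bounded f" "0 < \<alpha>" "\<alpha> < 2"
  shows "levy_integral \<alpha> f x = slevy \<alpha> f x"
proof -
  obtain f' f'' D where f: "\<And>x. (f has_real_derivative f' x) (at x)"
    "\<And>x. (f' has_real_derivative f'' x) (at x)"
    "\<And>x. \<bar>f x\<bar> \<le> D" "\<And>x. \<bar>f'' x\<bar> \<le> D" "0 < D"
    using C2_boundedE[OF assms(1)] by metis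
  have d: "deriv f x = f' x" using f(1) by (rule DERIV_imp_deriv)
  have [measurable]: "f \<in> borel_measurable borel"
    using f(1) by (meson DERIV_isCont continuous_at_imp_continuous_on borel_measurable_continuous_onI)
  define g where "g z = (f (x + z) - f x - z * f' x * indicator {-1..1} z) / \<bar>z\<bar> powr (1 + \<alpha>)" for z
  have [measurable]: "g \<in> borel_measurable borel" unfolding g_def by measurable
  define h where "h z = min (z powr 2) 1 * levy_kernel \<alpha> z" for z
  have h: "integrable lborel h" unfolding h_def using assms by (intro min_powr_kernel_integrable) auto
  have h0: "h z \<ge> 0" for z by (simp add: h_def levy_kernel_nonneg)
  have h': "integrable lborel (\<lambda>z. h (-z))"
    using lborel_integrable_real_affine[OF h, of "-1" 0] by simp
  \<comment> \<open>For |z| at most 1 this is Taylor's estimate, obtained by applying the mean value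
    inequality to f (x + y) - y f'(x); beyond 1 the compensator is absent and boundedness of f is
    enough.\<close>
  have num: "\<bar>f (x + z) - f x - z * f' x * indicator {-1..1} z\<bar> \<le> 4 * D * min (\<bar>z\<bar> powr 2) 1" for z
  proof (cases "\<bar>z\<bar> \<le> 1")
    case True
    have "\<bar>(\<lambda>y. f (x + y) - y * f' x) z - (\<lambda>y. f (x + y) - y * f' x) 0\<bar> \<le> (D * \<bar>z\<bar>) * \<bar>z - 0\<bar>"
    proof -
      have "norm ((\<lambda>y. f (x + y) - y * f' x) z - (\<lambda>y. f (x + y) - y * f' x) 0) \<le> (D * \<bar>z\<bar>) * norm (z - 0)"
      proof (rule field_differentiable_bound[of "cball 0 \<bar>z\<bar>" _ "\<lambda>y. f' (x + y) - f' x"])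
        show "((\<lambda>y. f (x + y) - y * f' x) has_real_derivative f' (x + y) - f' x) (at y within cball 0 \<bar>z\<bar>)" for y
          by (rule has_field_derivative_at_within) (auto intro!: derivative_eq_intros DERIV_chain2[OF f(1)])
        fix y :: real assume "y \<in> cball 0 \<bar>z\<bar>"
        have "\<bar>f' (x + y) - f' x\<bar> \<le> D * \<bar>(x + y) - x\<bar>"
          by (rule derivative_bound_imp_lipschitz[OF f(2) f(4)])
        also have "\<dots> \<le> D * \<bar>z\<bar>" using \<open>y \<in> _\<close> f(5) by (intro mult_left_mono) auto
        finally show "norm (f' (x + y) - f' x) \<le> D * \<bar>z\<bar>" by simp
      qed auto
      thus ?thesis by simp
    qed
    also have "\<dots> \<le> 4 * D * min (\<bar>z\<bar> powr 2) 1"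
    proof -
      have "\<bar>z\<bar> * \<bar>z\<bar> \<le> 1" using True mult_mono[of "\<bar>z\<bar>" 1 "\<bar>z\<bar>" 1] by simp
      hence "min (\<bar>z\<bar> powr 2) 1 = \<bar>z\<bar> * \<bar>z\<bar>" by (cases "z = 0") (auto simp: power2_eq_square)
      thus ?thesis using f(5) by (simp add: mult.assoc)
    qed
    finally show ?thesis using True by (simp add: abs_le_iff)
  next
    case False
    hence "1 \<le> \<bar>z\<bar> powr 2" by (intro ge_one_powr_ge_zero) auto
    moreover have "indicator {-1..1} z = (0::real)" using False by (simp add: indicator_def abs_le_iff) linarith
    ultimately show ?thesis using f(3)[of "x + z"] f(3)[of x] f(5) by (simp add: min_absorb2)
  qed
  have bnd: "\<bar>g z\<bar> \<le> 4 * D * (h z + h (-z))" for z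
  proof (cases "z = 0")
    case False
    have "\<bar>g z\<bar> \<le> 4 * D * min (\<bar>z\<bar> powr 2) 1 / \<bar>z\<bar> powr (1 + \<alpha>)"
      unfolding g_def abs_divide using num[of z] by (simp add: divide_right_mono)
    also have "\<dots> = 4 * D * (h z + h (-z))"
      using False by (cases "z > 0")
        (auto simp: h_def levy_kernel_def powr_minus divide_simps powr_add powr_diff)
    finally show ?thesis .
  qed (use h0 f(5) in \<open>auto simp: g_def\<close>)
  have "integrable lborel (\<lambda>z. 4 * D * (h z + h (-z)))" using h h' by auto
  hence g: "integrable lborel g"
    by (rule Bochner_Integration.integrable_bound) (use bnd h0 f(5) in \<open>auto intro!: AE_I2 simp: abs_mult\<close>)
  have g1: "integrable lborel (\<lambda>z. indicator {0<..} z * g z)"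
    using integrable_mult_indicator[OF _ g, of "{0<..}"] by simp
  have g2: "integrable lborel (\<lambda>z. indicator {..<0} z * g z)"
    using integrable_mult_indicator[OF _ g, of "{..<0}"] by simp
  have g3: "integrable lborel (\<lambda>z. indicator {0<..} z * g (-z))"
    using lborel_integrable_real_affine[OF g2, of "-1" 0]
    by (auto elim!: Bochner_Integration.integrable_cong[THEN iffD1, rotated 2] split: split_indicator)
  have "levy_integral \<alpha> f x = (\<integral>z. g z \<partial>lborel)"
    by (simp add: levy_integral_def d g_def)
  also have "\<dots> = (\<integral>z. indicator {0<..} z * g z + indicator {..<0} z * g z \<partial>lborel)"
    by (intro Bochner_Integration.integral_cong) (auto simp: g_def split: split_indicator)
  also have "\<dots> = (\<integral>z. indicator {0<..} z * g z \<partial>lborel) + (\<integral>z. indicator {..<0} z * g z \<partial>lborel)"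
    by (rule Bochner_Integration.integral_add[OF g1 g2])
  also have "(\<integral>z. indicator {..<0} z * g z \<partial>lborel) = (\<integral>z. indicator {0<..} z * g (-z) \<partial>lborel)"
    by (subst lborel_integral_real_affine[of "-1" _ 0])
       (auto intro!: Bochner_Integration.integral_cong split: split_indicator)
  also have "(\<integral>z. indicator {0<..} z * g z \<partial>lborel) + \<dots> = (\<integral>z. indicator {0<..} z * g z + indicator {0<..} z * g (-z) \<partial>lborel)"
    by (rule Bochner_Integration.integral_add[OF g1 g3, symmetric])
  also have "\<dots> = slevy \<alpha> f x"
    unfolding slevy_def
    by (intro Bochner_Integration.integral_cong)
       (auto simp: g_def levy_kernel_def second_diff_def powr_minus divide_simps powr_add powr_diff split: split_indicator)
  finally show ?thesis .
qed

subsection \<open>Box averages\<close>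

text \<open>A uniform average is all the mollification required: it turns a C^1 function into a C^2
  one with explicit derivatives, reproduces affine functions exactly, and widens the support of the
  slope by \<delta> only.\<close>

definition box_avg :: "real \<Rightarrow> (real \<Rightarrow> real) \<Rightarrow> real \<Rightarrow> real" where
  "box_avg \<delta> f x = (\<integral>h. indicator {-\<delta>..\<delta>} h * f (x + h) \<partial>lborel) / (2 * \<delta>)"

lemma box_integrable:
  assumes "continuous_on UNIV f"
  shows "integrable lborel (\<lambda>h. indicator {-\<delta>..\<delta>} h * f (x + h :: real) :: real)"
proof -
  have "continuous_on {-\<delta>..\<delta>} (\<lambda>h. f (x + h))"
    by (intro continuous_on_compose2[OF assms] continuous_intros) auto
  from borel_integrable_atLeastAtMost'[OF this] show ?thesis
    by (simp add: set_integrable_def)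
qed

lemma box_avg_mono:
  assumes "continuous_on UNIV f" "continuous_on UNIV g" "0 < \<delta>"
    "\<And>h. \<bar>h\<bar> \<le> \<delta> \<Longrightarrow> f (x + h) \<le> g (x + h)"
  shows "box_avg \<delta> f x \<le> box_avg \<delta> g x"
  unfolding box_avg_def using assms
  by (intro divide_right_mono integral_mono box_integrable) (auto split: split_indicator)

lemma box_avg_affine:
  assumes "0 < \<delta>"
  shows "box_avg \<delta> (\<lambda>y. a * y + b) x = a * x + b"
proof -
  have "(\<integral>h. indicator {-\<delta>..\<delta>} h * (a * (x + h) + b) \<partial>lborel) = (a * (x + \<delta>)\<^sup>2 / 2 + b * \<delta>) - (a * (x - \<delta>)\<^sup>2 / 2 - b * \<delta>)"
  proof -
    have "(\<integral>h. (a * (x + h) + b) * indicator {-\<delta>..\<delta>} h \<partial>lborel) =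
      (\<lambda>h. a * (x + h)\<^sup>2 / 2 + b * h) \<delta> - (\<lambda>h. a * (x + h)\<^sup>2 / 2 + b * h) (-\<delta>)"
      using assms
      by (intro integral_FTC_Icc_real) (auto intro!: derivative_eq_intros continuous_intros)
    thus ?thesis by (simp add: mult.commute)
  qed
  also have "\<dots> = (a * x + b) * (2 * \<delta>)" by (simp add: power2_eq_square field_simps)
  finally show ?thesis using assms by (simp add: box_avg_def)
qed

lemma box_avg_deriv:
  assumes "continuous_on UNIV f" "0 < \<delta>"
  shows "(box_avg \<delta> f has_real_derivative ((f (x + \<delta>) - f (x - \<delta>)) / (2 * \<delta>))) (at x)"
proof -
  have cont: "isCont f y" for y using assms(1) by (simp add: continuous_on_eq_continuous_at)
  define F where "F y = (LBINT t=ereal 0..ereal y. f t)" for y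
  have F: "(F has_real_derivative f y) (at y)" for y
  proof -
    have "((\<lambda>u. LBINT t=ereal 0..ereal u. f t) has_vector_derivative f y)
        (at y within {- \<bar>y\<bar> - 1..\<bar>y\<bar> + 1})"
      by (rule interval_integral_FTC2) (auto intro: continuous_on_subset[OF assms(1)])
    moreover have "at y within {- \<bar>y\<bar> - 1..\<bar>y\<bar> + 1} = at y"
      by (rule at_within_interior) auto
    ultimately show ?thesis
      by (simp add: F_def[abs_def] has_real_derivative_iff_has_vector_derivative)
  qed
  have eq: "box_avg \<delta> f y = (F (y + \<delta>) - F (y - \<delta>)) / (2 * \<delta>)" for y
  proof -
    have "(\<integral>h. f (y + h) * indicator {-\<delta>..\<delta>} h \<partial>lborel) = (\<lambda>h. F (y + h)) \<delta> - (\<lambda>h. F (y + h)) (-\<delta>)"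
      using assms(2)
      by (intro integral_FTC_Icc_real)
         (auto intro!: derivative_eq_intros DERIV_chain2[OF F, THEN DERIV_cong] continuous_intros isCont_o2[OF _ cont])
    thus ?thesis by (simp add: box_avg_def mult.commute)
  qed
  have "((\<lambda>y. (F (y + \<delta>) - F (y - \<delta>)) / (2 * \<delta>)) has_real_derivative ((f (x + \<delta>) - f (x - \<delta>)) / (2 * \<delta>))) (at x)"
    using assms(2) by (auto intro!: derivative_eq_intros DERIV_chain2[OF F] simp: field_simps)
  thus ?thesis by (simp add: eq[abs_def])
qed

text \<open>The operator commutes with translations, hence with averages of translates. Fubini
  applies because the double integrand is dominated by an indicator in h times the fixed majorant in
  z.\<close>

lemma slevy_box_avg:
  assumes "levy_bound \<alpha> c \<gamma> f" "0 < \<delta>"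
  shows "slevy \<alpha> (box_avg \<delta> f) x = box_avg \<delta> (slevy \<alpha> f) x"
proof -
  have cf: "continuous_on UNIV f" using assms by (simp add: levy_bound_def)
  have [measurable]: "f \<in> borel_measurable borel" by (rule levy_bound_measurable[OF assms(1)])
  let ?k = "\<lambda>z. min (z powr \<gamma>) 1 * levy_kernel \<alpha> z"
  have k: "integrable lborel ?k"
    using assms by (intro min_powr_kernel_integrable) (auto simp: levy_bound_def)
  let ?G = "\<lambda>h z. indicator {-\<delta>..\<delta>} h * (second_diff f (x + h) z * levy_kernel \<alpha> z)"
  have sd: "second_diff (box_avg \<delta> f) x z * levy_kernel \<alpha> z = (\<integral>h. ?G h z \<partial>lborel) / (2 * \<delta>)" for z
  proof -
    have "second_diff (box_avg \<delta> f) x z =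
      ((\<integral>h. indicator {-\<delta>..\<delta>} h * f ((x + z) + h) \<partial>lborel) + (\<integral>h. indicator {-\<delta>..\<delta>} h * f ((x - z) + h) \<partial>lborel)
        - 2 * (\<integral>h. indicator {-\<delta>..\<delta>} h * f (x + h) \<partial>lborel)) / (2 * \<delta>)"
      by (simp add: second_diff_def box_avg_def diff_divide_distrib add_divide_distrib)
    also have "\<dots> = (\<integral>h. indicator {-\<delta>..\<delta>} h * f ((x + z) + h) + indicator {-\<delta>..\<delta>} h * f ((x - z) + h)
        - 2 * (indicator {-\<delta>..\<delta>} h * f (x + h)) \<partial>lborel) / (2 * \<delta>)"
      by (simp add: Bochner_Integration.integral_diff Bochner_Integration.integral_add
          Bochner_Integration.integrable_add box_integrable[OF cf])
    also have "\<dots> = (\<integral>h. indicator {-\<delta>..\<delta>} h * second_diff f (x + h) z \<partial>lborel) / (2 * \<delta>)"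
      by (intro arg_cong2[where f="(/)"] Bochner_Integration.integral_cong)
         (auto simp: second_diff_def algebra_simps)
    finally show ?thesis
      by (simp add: mult.assoc[symmetric] integral_mult_left_zero)
  qed
  have meas [measurable]: "(\<lambda>(h, z). ?G h z) \<in> borel_measurable (lborel \<Otimes>\<^sub>M lborel)"
    unfolding second_diff_def by measurable
  have bd: "\<bar>?G h z\<bar> \<le> indicator {-\<delta>..\<delta>} h * (c * ?k z)" for h z
    using levy_bound_le[OF assms(1), of "x + h" z]
    by (auto split: split_indicator)
  have int_z: "integrable lborel (\<lambda>z. ?G h z)" for h
    by (intro integrable_mult_right slevy_integrable[OF assms(1)])
  have "integrable (lborel \<Otimes>\<^sub>M lborel) (\<lambda>(h, z). ?G h z)"
  proof (rule lborel_pair.Fubini_integrable[OF meas])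
    show "AE h in lborel. integrable lborel (\<lambda>z. case (h, z) of (h, z) \<Rightarrow> ?G h z)"
      using int_z by simp
    show "integrable lborel (\<lambda>h. \<integral>z. norm (case (h, z) of (h, z) \<Rightarrow> ?G h z) \<partial>lborel)"
    proof (rule Bochner_Integration.integrable_bound)
      show "integrable lborel (\<lambda>h. indicator {-\<delta>..\<delta>} h * (c * (\<integral>z. ?k z \<partial>lborel)) :: real)"
        using box_integrable[of "\<lambda>_. c * (\<integral>z. ?k z \<partial>lborel)" \<delta> 0] by simp
      show "(\<lambda>h. \<integral>z. norm (case (h, z) of (h, z) \<Rightarrow> ?G h z) \<partial>lborel) \<in> borel_measurable lborel"
        by (intro lborel.borel_measurable_lebesgue_integral) (use meas in \<open>simp add: case_prod_beta\<close>)
      show "AE h in lborel. norm (\<integral>z. norm (case (h, z) of (h, z) \<Rightarrow> ?G h z) \<partial>lborel)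
         \<le> norm (indicator {-\<delta>..\<delta>} h * (c * (\<integral>z. ?k z \<partial>lborel)) :: real)"
      proof (rule AE_I2)
        fix h :: real
        have "(\<integral>z. \<bar>?G h z\<bar> \<partial>lborel) \<le> (\<integral>z. indicator {-\<delta>..\<delta>} h * (c * ?k z) \<partial>lborel)"
          by (intro integral_mono integrable_abs int_z integrable_mult_right k bd)
        thus "norm (\<integral>z. norm (case (h, z) of (h, z) \<Rightarrow> ?G h z) \<partial>lborel)
         \<le> norm (indicator {-\<delta>..\<delta>} h * (c * (\<integral>z. ?k z \<partial>lborel)) :: real)"
          by (simp add: integral_nonneg_AE)
      qed
    qed
  qed
  from lborel_pair.Fubini_integral[OF this]
  have "(\<integral>z. \<integral>h. ?G h z \<partial>lborel \<partial>lborel) = (\<integral>h. \<integral>z. ?G h z \<partial>lborel \<partial>lborel)"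
    by simp
  also have "\<dots> = (\<integral>h. indicator {-\<delta>..\<delta>} h * slevy \<alpha> f (x + h) \<partial>lborel)"
    by (simp add: slevy_def)
  finally show ?thesis
    unfolding box_avg_def slevy_def[of \<alpha> "\<lambda>x. _ x / _"]
    using sd[unfolded box_avg_def[abs_def]] by (simp add: slevy_def box_avg_def[abs_def])
qed

section \<open>The fractional Laplacian of the profile\<close>

text \<open>A Beta integral in disguise, with value pi / (2 sin (pi \<alpha> / 2)) for 0 < \<alpha>
  < 2. It appears once in the operator applied to the profile and once in the normalising constant,
  and cancels in \<open>levy_const_slevy_profile_U\<close>.\<close>

definition J_int :: "real \<Rightarrow> real" where
  "J_int \<alpha> = (LBINT t:{0<..}. t powr (\<alpha> - 1) / (1 + t\<^sup>2))"

lemma K_const_pos: "0 < \<alpha> \<Longrightarrow> 0 < K_const \<alpha>"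
  unfolding K_const_def by (intro divide_pos_pos mult_pos_pos Gamma_real_pos) auto

text \<open>Legendre's duplication formula at (1 + \<alpha>)/2. It is stated for complex arguments
  away from the non-positive integers, hence the detour through complex numbers.\<close>

lemma K_const_Gamma:
  assumes "0 < \<alpha>"
  shows "K_const \<alpha> * Gamma (1 + \<alpha>) = 1"
proof -
  define z where "z = (1 + \<alpha>) / 2"
  have pos: "0 < z" using assms by (simp add: z_def)
  have 1: "complex_of_real z \<notin> \<int>\<^sub>\<le>\<^sub>0"
  proof
    assume "complex_of_real z \<in> \<int>\<^sub>\<le>\<^sub>0"
    then obtain n where "complex_of_real z = of_int n" "n \<le> 0" by (auto elim!: nonpos_Ints_cases)
    hence "Re (complex_of_real z) = of_int n" by (metis Re_complex_of_real of_real_of_int_eq)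
    with pos \<open>n \<le> 0\<close> show False by simp
  qed
  have 2: "complex_of_real z + 1 / 2 \<notin> \<int>\<^sub>\<le>\<^sub>0"
  proof
    assume "complex_of_real z + 1 / 2 \<in> \<int>\<^sub>\<le>\<^sub>0"
    then obtain n where "complex_of_real z + 1 / 2 = of_int n" "n \<le> 0" by (auto elim!: nonpos_Ints_cases)
    hence "Re (complex_of_real z + 1 / 2) = of_int n" by (metis Re_complex_of_real of_real_of_int_eq)
    with pos \<open>n \<le> 0\<close> show False by simp
  qed
  have "complex_of_real (Gamma z * Gamma (z + 1 / 2)) = Gamma (complex_of_real z) * Gamma (complex_of_real z + 1 / 2)"
    by (simp add: Gamma_complex_of_real[symmetric])
  also have "\<dots> = complex_of_real (exp ((1 - 2 * z) * ln 2) * sqrt pi * Gamma (2 * z))"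
    unfolding Gamma_legendre_duplication[OF 1 2] by (simp add: Gamma_complex_of_real[symmetric] exp_of_real[symmetric])
  finally have "Gamma z * Gamma (z + 1 / 2) = exp ((1 - 2 * z) * ln 2) * sqrt pi * Gamma (2 * z)"
    by (simp only: of_real_eq_iff)
  moreover have "1 - 2 * z = - \<alpha>" "2 * z = 1 + \<alpha>" by (simp_all add: z_def field_simps)
  ultimately have "Gamma ((1 + \<alpha>) / 2) * Gamma ((1 + \<alpha>) / 2 + 1 / 2) = exp (- \<alpha> * ln 2) * sqrt pi * Gamma (1 + \<alpha>)"
    unfolding z_def[symmetric] by metis
  moreover have "(1 + \<alpha>) / 2 + 1 / 2 = 1 + \<alpha> / 2" by (simp add: field_simps)
  moreover have "exp (- \<alpha> * ln 2) = 1 / 2 powr \<alpha>" by (simp add: powr_def exp_minus field_simps)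
  ultimately have "2 powr \<alpha> * Gamma (1 + \<alpha> / 2) * Gamma ((1 + \<alpha>) / 2) = sqrt pi * Gamma (1 + \<alpha>)"
    by (simp add: field_simps)
  moreover have "Gamma (1 + \<alpha>) > 0" using assms by (intro Gamma_real_pos) auto
  ultimately show ?thesis
    by (simp add: K_const_def Gamma_one_half_real)
qed

section \<open>Elementary properties and Hoelder regularity of the profile\<close>

lemma powr_diff_le_powr_abs:
  fixes a b \<beta> :: real
  assumes "0 \<le> a" "0 \<le> b" "0 < \<beta>" "\<beta> \<le> 1"
  shows "\<bar>a powr \<beta> - b powr \<beta>\<bar> \<le> \<bar>a - b\<bar> powr \<beta>"
proof -
  have *: "a powr \<beta> - b powr \<beta> \<le> (a - b) powr \<beta> \<and> b powr \<beta> \<le> a powr \<beta>" if "0 \<le> b" "b \<le> a" for a b :: real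
  proof (cases "a = 0")
    case False
    hence a: "a > 0" using that by simp
    define s where "s = b / a"
    have s: "0 \<le> s" "s \<le> 1" using that a by (auto simp: s_def)
    \<comment> \<open>Subadditivity of the power: the two fractions s and 1 - s add up to 1, and
      raising a number in [0, 1] to an exponent at most 1 does not decrease it.\<close>
    have "s powr 1 \<le> s powr \<beta>" "(1 - s) powr 1 \<le> (1 - s) powr \<beta>"
      using s assms powr_mono'[of \<beta> 1 s] powr_mono'[of \<beta> 1 "1 - s"] by auto
    hence "1 \<le> s powr \<beta> + (1 - s) powr \<beta>" using s by simp
    hence "a powr \<beta> * 1 \<le> a powr \<beta> * (s powr \<beta> + (1 - s) powr \<beta>)"
      by (intro mult_left_mono) auto
    also have "\<dots> = (a * s) powr \<beta> + (a * (1 - s)) powr \<beta>"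
      using a s by (simp add: powr_mult distrib_left)
    also have "\<dots> = b powr \<beta> + (a - b) powr \<beta>"
    proof -
      have "a * s = b" "a * (1 - s) = a - b" using a by (auto simp: s_def field_simps)
      thus ?thesis by simp
    qed
    finally show ?thesis using that assms by (auto intro: powr_mono2)
  qed (use that in auto)
  show ?thesis
    using *[of b a] *[of a b] assms(1,2) by (cases "b \<le> a") (auto simp: abs_if)
qed

text \<open>Written with a positive part, v is a power composed with a Lipschitz function, so
  continuity and the Hoelder bound need no case distinction at the edges.\<close>

lemma profile_v_eq: "profile_v \<alpha> x = K_const \<alpha> * (max 0 (1 - x\<^sup>2)) powr (\<alpha> / 2)"
proof (cases "\<bar>x\<bar> < 1")
  case True
  hence "x\<^sup>2 < 1" by (simp add: abs_square_less_1)
  thus ?thesis using True by (simp add: profile_v_def)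
next
  case False
  hence "1 \<le> x\<^sup>2" by (simp add: abs_square_less_1 flip: not_less)
  thus ?thesis using False by (simp add: profile_v_def)
qed

lemma profile_v_nonneg: "0 < \<alpha> \<Longrightarrow> 0 \<le> profile_v \<alpha> x"
  using K_const_pos[of \<alpha>] by (simp add: profile_v_eq)

lemma profile_v_pos: "0 < \<alpha> \<Longrightarrow> \<bar>x\<bar> < 1 \<Longrightarrow> 0 < profile_v \<alpha> x"
  using K_const_pos[of \<alpha>] by (auto simp: profile_v_def abs_square_eq_1)

lemma profile_v_zero: "1 \<le> \<bar>x\<bar> \<Longrightarrow> profile_v \<alpha> x = 0"
  by (simp add: profile_v_def)

lemma profile_v_even: "profile_v \<alpha> (- x) = profile_v \<alpha> x"
  by (simp add: profile_v_def)

lemma profile_v_continuous: "0 < \<alpha> \<Longrightarrow> continuous_on A (profile_v \<alpha>)"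
  unfolding profile_v_eq[abs_def]
  by (intro continuous_on_mult continuous_on_const continuous_on_powr' continuous_intros) auto

lemma profile_v_holder:
  assumes "0 < \<alpha>" "\<alpha> < 2"
  shows "\<bar>profile_v \<alpha> x - profile_v \<alpha> y\<bar> \<le> K_const \<alpha> * (2 * \<bar>x - y\<bar>) powr (\<alpha> / 2)"
proof -
  have lip: "\<bar>max 0 (1 - x\<^sup>2) - max 0 (1 - y\<^sup>2)\<bar> \<le> 2 * \<bar>x - y\<bar>" for x y :: real
  proof -
    \<comment> \<open>Clamping x to [-1, 1] turns the positive part into a polynomial, whose
      differences factor as (p + q)(p - q) with both points in [-1, 1].\<close>
    have c: "max 0 (1 - x\<^sup>2) = 1 - (min 1 (max (-1) x))\<^sup>2" for x :: real
    proof -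
      consider "x < -1" | "1 < x" | "\<bar>x\<bar> \<le> 1" by linarith
      thus ?thesis
      proof cases
        case 1
        have "1 < (- x)\<^sup>2" using 1 by (intro one_less_power) auto
        hence "1 < x\<^sup>2" by simp
        thus ?thesis using 1 by simp
      next
        case 2
        have "1 < x\<^sup>2" using 2 by (simp add: one_less_power)
        thus ?thesis using 2 by simp
      next
        case 3
        hence "x\<^sup>2 \<le> 1" by (simp add: abs_square_le_1)
        moreover have "min 1 (max (-1) x) = x" using 3 by linarith
        ultimately show ?thesis by simp
      qed
    qed
    define p q where "p = min 1 (max (-1) x)" and "q = min 1 (max (-1) y)"
    have "\<bar>(1 - p\<^sup>2) - (1 - q\<^sup>2)\<bar> = \<bar>p + q\<bar> * \<bar>p - q\<bar>"
      by (simp add: abs_mult[symmetric] power2_eq_square algebra_simps abs_minus_commute)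
    also have "\<dots> \<le> 2 * \<bar>x - y\<bar>"
      by (intro mult_mono) (auto simp: p_def q_def)
    finally show ?thesis by (simp add: c p_def q_def)
  qed
  have "\<bar>profile_v \<alpha> x - profile_v \<alpha> y\<bar> =
      K_const \<alpha> * \<bar>max 0 (1 - x\<^sup>2) powr (\<alpha>/2) - max 0 (1 - y\<^sup>2) powr (\<alpha>/2)\<bar>"
    using K_const_pos[OF assms(1)] by (simp add: profile_v_eq abs_mult right_diff_distrib[symmetric])
  also have "\<dots> \<le> K_const \<alpha> * (\<bar>max 0 (1 - x\<^sup>2) - max 0 (1 - y\<^sup>2)\<bar> powr (\<alpha>/2))"
    using assms K_const_pos[OF assms(1)]
    by (intro mult_left_mono powr_diff_le_powr_abs) auto
  also have "\<dots> \<le> K_const \<alpha> * (2 * \<bar>x - y\<bar>) powr (\<alpha> / 2)"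
    using assms K_const_pos[OF assms(1)] by (intro mult_left_mono powr_mono2 lip) auto
  finally show ?thesis .
qed

lemma profile_U_deriv:
  assumes "0 < \<alpha>"
  shows "(profile_U \<alpha> has_real_derivative profile_v \<alpha> x) (at x)"
proof -
  have "((\<lambda>u. LBINT t=ereal 0..ereal u. profile_v \<alpha> t) has_vector_derivative profile_v \<alpha> x)
      (at x within {- \<bar>x\<bar> - 1..\<bar>x\<bar> + 1})"
    by (rule interval_integral_FTC2) (auto intro: profile_v_continuous[OF assms])
  moreover have "at x within {- \<bar>x\<bar> - 1..\<bar>x\<bar> + 1} = at x"
    by (rule at_within_interior) auto
  ultimately show ?thesis
    by (simp add: profile_U_def[abs_def] has_real_derivative_iff_has_vector_derivative)
qed

lemmas profile_U_deriv' [derivative_intros] = DERIV_chain2[OF profile_U_deriv]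

lemma profile_U_0 [simp]: "profile_U \<alpha> 0 = 0"
  by (simp add: profile_U_def)

lemma profile_U_odd:
  assumes "0 < \<alpha>"
  shows "profile_U \<alpha> (- x) = - profile_U \<alpha> x"
proof -
  have "((\<lambda>x. profile_U \<alpha> (- x) + profile_U \<alpha> x) has_real_derivative 0) (at x)" for x
    using assms by (auto intro!: derivative_eq_intros simp: profile_v_even)
  from DERIV_isconst_all[OF allI[OF this], of x 0] show ?thesis by simp
qed

lemma profile_U_mono:
  assumes "0 < \<alpha>" "x \<le> y"
  shows "profile_U \<alpha> x \<le> profile_U \<alpha> y"
  using assms(2) by (rule DERIV_nonneg_imp_nondecreasing)
    (use profile_U_deriv[OF assms(1)] profile_v_nonneg[OF assms(1)] in blast)

lemma profile_M_eq: "profile_M \<alpha> = profile_U \<alpha> 1"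
  by (simp add: profile_M_def profile_U_def one_ereal_def zero_ereal_def)

lemma profile_U_ge_1:
  assumes "0 < \<alpha>" "1 \<le> x"
  shows "profile_U \<alpha> x = profile_M \<alpha>"
proof (cases "x = 1")
  case False
  have "profile_U \<alpha> x = profile_U \<alpha> 1"
  proof (rule DERIV_isconst_end[of 1 x "profile_U \<alpha>"])
    show "1 < x" using False assms by simp
    show "continuous_on {1..x} (profile_U \<alpha>)"
      by (meson DERIV_isCont assms(1) continuous_at_imp_continuous_on profile_U_deriv)
    show "(profile_U \<alpha> has_real_derivative 0) (at y)" if "1 < y" "y < x" for y
      using profile_U_deriv[OF assms(1), of y] that by (simp add: profile_v_zero)
  qed
  thus ?thesis by (simp add: profile_M_eq)
qed (simp add: profile_M_eq)

lemma profile_U_le_minus_1: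
  assumes "0 < \<alpha>" "x \<le> -1"
  shows "profile_U \<alpha> x = - profile_M \<alpha>"
  using profile_U_ge_1[of \<alpha> "-x"] profile_U_odd[of \<alpha> "-x"] assms by simp

lemma profile_U_abs_le:
  assumes "0 < \<alpha>"
  shows "\<bar>profile_U \<alpha> x\<bar> \<le> profile_M \<alpha>"
  using profile_U_mono[OF assms, of x "max x 1"] profile_U_mono[OF assms, of "min x (-1)" x]
    profile_U_ge_1[OF assms, of "max x 1"] profile_U_le_minus_1[OF assms, of "min x (-1)"]
  by (simp add: abs_le_iff)

lemma profile_M_pos:
  assumes "0 < \<alpha>"
  shows "0 < profile_M \<alpha>"
proof -
  have "profile_U \<alpha> 0 < profile_U \<alpha> (1/2)"
    by (rule DERIV_pos_imp_increasing)
       (use profile_U_deriv[OF assms] profile_v_pos[OF assms] in force)+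
  also have "\<dots> \<le> profile_U \<alpha> 1" by (rule profile_U_mono[OF assms]) simp
  finally show ?thesis by (simp add: profile_M_eq)
qed

lemma profile_U_continuous: "0 < \<alpha> \<Longrightarrow> continuous_on A (profile_U \<alpha>)"
  by (meson DERIV_isCont continuous_at_imp_continuous_on profile_U_deriv)

text \<open>The z-derivative of the second difference is v (x + z) - v (x - z), so the mean value
  theorem adds one power of z to the Hoelder exponent of v.\<close>

lemma profile_U_second_diff:
  assumes "0 < \<alpha>" "\<alpha> < 2" "0 < z"
  shows "\<bar>second_diff (profile_U \<alpha>) x z\<bar> \<le> K_const \<alpha> * 4 powr (\<alpha> / 2) * z powr (1 + \<alpha> / 2)"
proof -
  have "\<exists>y>0. y < z \<and> second_diff (profile_U \<alpha>) x z - second_diff (profile_U \<alpha>) x 0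
      = (z - 0) * (profile_v \<alpha> (x + y) - profile_v \<alpha> (x - y))"
    using assms unfolding second_diff_def
    by (intro MVT2) (auto intro!: derivative_eq_intros)
  then obtain y where y: "0 < y" "y < z"
      "second_diff (profile_U \<alpha>) x z = z * (profile_v \<alpha> (x + y) - profile_v \<alpha> (x - y))"
    by (auto simp: second_diff_def)
  have "\<bar>profile_v \<alpha> (x + y) - profile_v \<alpha> (x - y)\<bar> \<le> K_const \<alpha> * (2 * \<bar>(x + y) - (x - y)\<bar>) powr (\<alpha> / 2)"
    by (rule profile_v_holder) fact+
  also have "\<dots> \<le> K_const \<alpha> * (4 * z) powr (\<alpha> / 2)"
    using K_const_pos[OF assms(1)] assms y by (intro mult_left_mono powr_mono2) auto
  finally have "\<bar>second_diff (profile_U \<alpha>) x z\<bar> \<le> z * (K_const \<alpha> * (4 * z) powr (\<alpha> / 2))"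
    using assms y by (simp add: abs_mult)
  also have "\<dots> = K_const \<alpha> * 4 powr (\<alpha> / 2) * z powr (1 + \<alpha> / 2)"
    using assms by (simp add: powr_mult powr_add)
  finally show ?thesis .
qed

lemma profile_U_levy_bound:
  assumes "0 < \<alpha>" "\<alpha> < 2"
  shows "\<exists>c. levy_bound \<alpha> c (1 + \<alpha> / 2) (profile_U \<alpha>)"
proof -
  define c where "c = max (K_const \<alpha> * 4 powr (\<alpha> / 2)) (4 * profile_M \<alpha>)"
  have "\<bar>second_diff (profile_U \<alpha>) x z\<bar> \<le> c * min (z powr (1 + \<alpha> / 2)) 1" if "0 < z" for x z
  proof -
    have "\<bar>second_diff (profile_U \<alpha>) x z\<bar> \<le> 4 * profile_M \<alpha>"
      using profile_U_abs_le[OF assms(1), of "x + z"] profile_U_abs_le[OF assms(1), of "x - z"]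
        profile_U_abs_le[OF assms(1), of x] by (simp add: second_diff_def)
    also have "\<dots> \<le> c" by (simp add: c_def)
    finally have 1: "\<bar>second_diff (profile_U \<alpha>) x z\<bar> \<le> c" .
    have "K_const \<alpha> * 4 powr (\<alpha> / 2) * z powr (1 + \<alpha> / 2) \<le> c * z powr (1 + \<alpha> / 2)"
      by (intro mult_right_mono) (auto simp: c_def)
    with profile_U_second_diff[OF assms that, of x]
    have "\<bar>second_diff (profile_U \<alpha>) x z\<bar> \<le> c * z powr (1 + \<alpha> / 2)" by linarith
    with 1 show ?thesis by (simp add: min_def)
  qed
  thus ?thesis using assms profile_U_continuous[OF assms(1)] by (auto simp: levy_bound_def)
qed

subsection \<open>One-sided truncated integrals\<close>

definition sub_kernel :: "real \<Rightarrow> real \<Rightarrow> real" where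
  "sub_kernel x t = t * (1 - x\<^sup>2)\<^sup>2 /
     (sqrt (1 + (1 - x\<^sup>2) * t\<^sup>2) * (sqrt (1 + (1 - x\<^sup>2) * t\<^sup>2) + x)\<^sup>2)"

definition sub_var :: "real \<Rightarrow> real \<Rightarrow> real" where
  "sub_var x z = sqrt (1 - (x + z)\<^sup>2) / z"

definition sub_int :: "real \<Rightarrow> real \<Rightarrow> real \<Rightarrow> real" where
  "sub_int \<alpha> x s = (LBINT t=ereal 0..ereal s. t powr \<alpha> * sub_kernel x t)"

lemma sub_sqrt_gt:
  assumes "\<bar>x\<bar> < 1"
  shows "\<bar>x\<bar> < sqrt (1 + (1 - x\<^sup>2) * t\<^sup>2)" "1 \<le> sqrt (1 + (1 - x\<^sup>2) * t\<^sup>2)"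
proof -
  have "x\<^sup>2 < 1" using assms by (simp add: abs_square_less_1)
  thus "1 \<le> sqrt (1 + (1 - x\<^sup>2) * t\<^sup>2)" by simp
  with assms show "\<bar>x\<bar> < sqrt (1 + (1 - x\<^sup>2) * t\<^sup>2)" by linarith
qed

lemma sub_integrand_continuous:
  assumes "\<bar>x\<bar> < 1" "0 < \<alpha>"
  shows "continuous_on {0..} (\<lambda>t. t powr \<alpha> * sub_kernel x t)"
proof -
  have "sqrt (1 + (1 - x\<^sup>2) * t\<^sup>2) \<noteq> 0" "sqrt (1 + (1 - x\<^sup>2) * t\<^sup>2) + x \<noteq> 0" for t
    using sub_sqrt_gt[OF assms(1), of t] by auto
  hence "\<forall>t\<in>{0..}. (sqrt (1 + (1 - x\<^sup>2) * t\<^sup>2) * (sqrt (1 + (1 - x\<^sup>2) * t\<^sup>2) + x)\<^sup>2) \<noteq> 0"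
    by simp
  hence "continuous_on {0..} (sub_kernel x)"
    unfolding sub_kernel_def by (intro continuous_intros)
  moreover have "continuous_on {0..} (\<lambda>t::real. t powr \<alpha>)"
    using assms by (intro continuous_on_powr' continuous_intros) auto
  ultimately show ?thesis by (rule continuous_on_mult[rotated])
qed

lemma sub_kernel_nonneg: "\<bar>x\<bar> < 1 \<Longrightarrow> 0 \<le> t \<Longrightarrow> 0 \<le> sub_kernel x t"
  unfolding sub_kernel_def using sub_sqrt_gt[of x t] by auto

text \<open>Let s be the square root. Then (s + x)(s - x) = (1 - x^2)(1 + t^2), and (s - x)^2 - (s +
  x)^2 = -4 s x cancels the remaining factor s. So everything irrational drops out and x survives as
  a mere factor; this is why the operator maps the profile to a linear function.\<close>

lemma sub_kernel_diff:
  assumes "\<bar>x\<bar> < 1"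
  shows "sub_kernel x t - sub_kernel (- x) t = - 4 * x * t / (1 + t\<^sup>2)\<^sup>2"
proof -
  define a s where "a = 1 - x\<^sup>2" and "s = sqrt (1 + a * t\<^sup>2)"
  have a: "a > 0" using assms by (simp add: a_def abs_square_less_1)
  have s: "s > \<bar>x\<bar>" "1 \<le> s" using sub_sqrt_gt[OF assms, of t] by (auto simp: s_def a_def)
  have "s\<^sup>2 = 1 + a * t\<^sup>2" using a by (simp add: s_def)
  hence s2: "s\<^sup>2 - x\<^sup>2 = a * (1 + t\<^sup>2)" by (simp add: a_def algebra_simps)
  have "(s + x) * (s - x) = a * (1 + t\<^sup>2)" using s2 by (simp add: power2_eq_square algebra_simps)
  hence "((s + x) * (s - x))\<^sup>2 = (a * (1 + t\<^sup>2))\<^sup>2" by simp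
  hence prod: "(s + x)\<^sup>2 * (s - x)\<^sup>2 = a\<^sup>2 * (1 + t\<^sup>2)\<^sup>2" by (simp only: power_mult_distrib)
  have nz: "s \<noteq> 0" "s + x \<noteq> 0" "s - x \<noteq> 0" "1 + t\<^sup>2 \<noteq> 0" "a \<noteq> 0"
    using s a by (auto simp: add_nonneg_eq_0_iff)
  have "sub_kernel x t - sub_kernel (- x) t = t * a\<^sup>2 / (s * (s + x)\<^sup>2) - t * a\<^sup>2 / (s * (s - x)\<^sup>2)"
    by (simp add: sub_kernel_def s_def a_def)
  also have "\<dots> = t * a\<^sup>2 * ((s - x)\<^sup>2 - (s + x)\<^sup>2) / (s * ((s + x)\<^sup>2 * (s - x)\<^sup>2))"
    using nz by (simp add: field_simps)
  also have "(s - x)\<^sup>2 - (s + x)\<^sup>2 = - 4 * s * x" by (simp add: power2_eq_square algebra_simps)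
  also have "t * a\<^sup>2 * (- 4 * s * x) / (s * ((s + x)\<^sup>2 * (s - x)\<^sup>2)) = - 4 * x * t / (1 + t\<^sup>2)\<^sup>2"
    unfolding prod using nz by (simp add: field_simps)
  finally show ?thesis .
qed

lemma sub_int_deriv:
  assumes "\<bar>x\<bar> < 1" "0 < \<alpha>" "0 < s"
  shows "(sub_int \<alpha> x has_real_derivative s powr \<alpha> * sub_kernel x s) (at s)"
proof -
  have "((\<lambda>u. LBINT t=ereal 0..ereal u. t powr \<alpha> * sub_kernel x t) has_vector_derivative s powr \<alpha> * sub_kernel x s)
      (at s within {0..s + 1})"
    using assms
    by (intro interval_integral_FTC2 continuous_on_subset[OF sub_integrand_continuous]) auto
  moreover have "at s within {0..s + 1} = at s"
    using assms by (intro at_within_interior) auto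
  ultimately show ?thesis
    by (simp add: sub_int_def[abs_def] has_real_derivative_iff_has_vector_derivative)
qed

text \<open>Serves the outer end of the integral: as z tends to 1 - x, where the profile ends, the
  new variable \<open>sub_var x z\<close> tends to 0 from the right.\<close>

lemma sub_int_continuous_0:
  assumes "\<bar>x\<bar> < 1" "0 < \<alpha>"
  shows "continuous (at 0 within {0..}) (sub_int \<alpha> x)"
proof -
  have "((\<lambda>u. LBINT t=ereal 0..ereal u. t powr \<alpha> * sub_kernel x t) has_vector_derivative 0 powr \<alpha> * sub_kernel x 0)
      (at 0 within {0..1})"
    using assms
    by (intro interval_integral_FTC2 continuous_on_subset[OF sub_integrand_continuous]) auto
  hence "continuous (at 0 within {0..1}) (sub_int \<alpha> x)"
    unfolding sub_int_def[abs_def] by (rule has_vector_derivative_continuous)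
  moreover have "at 0 within {0..1} = at (0::real) within {0..}"
    by (rule at_within_nhd[of _ "{-1<..<1}"]) auto
  ultimately show ?thesis by simp
qed

text \<open>The substitution \<open>t = sub_var x z\<close>, that is \<open>t = sqrt (1 - y\<^sup>2) / (y - x)\<close> with \<open>y = x + z\<close>, turns
  both singular factors of the integrand together into \<open>t powr \<alpha>\<close>; \<open>sub_kernel x t\<close> is
  \<open>- dz / dt\<close> expressed in \<open>t\<close>.\<close>

lemma truncated_profile_integral:
  assumes x: "\<bar>x\<bar> < 1" and \<alpha>: "0 < \<alpha>" and \<epsilon>: "0 < \<epsilon>" "\<epsilon> < 1 - x"
  shows "integrable lborel (\<lambda>z. indicator {\<epsilon><..} z * (profile_v \<alpha> (x + z) * z powr (- \<alpha>)))"
    and "(\<integral>z. indicator {\<epsilon><..} z * (profile_v \<alpha> (x + z) * z powr (- \<alpha>)) \<partial>lborel)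
          = K_const \<alpha> * sub_int \<alpha> x (sub_var x \<epsilon>)"
proof -
  define f where "f z = profile_v \<alpha> (x + z) * z powr (- \<alpha>)" for z
  define F where "F z = - (K_const \<alpha> * sub_int \<alpha> x (sub_var x z))" for z
  have y: "\<bar>x + z\<bar> < 1" "(x + z)\<^sup>2 < 1" if "0 < z" "z < 1 - x" for z
  proof -
    show "\<bar>x + z\<bar> < 1" using that x by linarith
    thus "(x + z)\<^sup>2 < 1" by (simp add: abs_square_less_1)
  qed
  have T: "(sub_var x has_real_derivative - ((1 - x * (x + z)) / (z\<^sup>2 * sqrt (1 - (x + z)\<^sup>2)))) (at z)"
    if "0 < z" "z < 1 - x" for z
  proof -
    have pos: "0 < sqrt (1 - (x + z)\<^sup>2)" using y[OF that] by simp
    have sq: "sqrt (1 - (x + z)\<^sup>2) * sqrt (1 - (x + z)\<^sup>2) = 1 - (x + z)\<^sup>2" using y[OF that] by simp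
    have "(sub_var x has_real_derivative
      ((- (2 * (x + z)) * (inverse (sqrt (1 - (x + z)\<^sup>2)) / 2)) * z - sqrt (1 - (x + z)\<^sup>2) * 1) / (z * z)) (at z)"
      unfolding sub_var_def using that y[OF that]
      by (auto intro!: derivative_eq_intros simp: field_simps)
    also have "((- (2 * (x + z)) * (inverse (sqrt (1 - (x + z)\<^sup>2)) / 2)) * z - sqrt (1 - (x + z)\<^sup>2) * 1) / (z * z)
      = - ((x + z) * z + sqrt (1 - (x + z)\<^sup>2) * sqrt (1 - (x + z)\<^sup>2)) / (z\<^sup>2 * sqrt (1 - (x + z)\<^sup>2))"
      using that pos by (simp add: field_simps power2_eq_square)
    also have "\<dots> = - ((1 - x * (x + z)) / (z\<^sup>2 * sqrt (1 - (x + z)\<^sup>2)))"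
    proof -
      have num: "(x + z) * z + (1 - (x + z)\<^sup>2) = 1 - x * (x + z)" by (simp add: power2_eq_square algebra_simps)
      show ?thesis unfolding sq num by (simp only: minus_divide_left)
    qed
    finally show ?thesis .
  qed
  have Tpos: "0 < sub_var x z" if "0 < z" "z < 1 - x" for z
    using y[OF that] that by (simp add: sub_var_def)
  have key: "sub_kernel x (sub_var x z) * ((1 - x * (x + z)) / (z\<^sup>2 * sqrt (1 - (x + z)\<^sup>2))) = 1"
    if z: "0 < z" "z < 1 - x" for z
  proof -
    define a r where "a = 1 - x\<^sup>2" and "r = sqrt (1 - (x + z)\<^sup>2)"
    have a: "a > 0" using x by (simp add: a_def abs_square_less_1)
    have r: "r > 0" using y[OF z] by (simp add: r_def)
    have r2: "r\<^sup>2 = 1 - (x + z)\<^sup>2" using y[OF z] by (simp add: r_def)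
    have "\<bar>x * (x + z)\<bar> < 1 * 1" unfolding abs_mult
      using x y[OF z] by (intro mult_strict_mono') auto
    hence p: "0 < 1 - x * (x + z)" by simp
    \<comment> \<open>The root in \<open>sub_kernel\<close> becomes rational because, with y = x +
      z, (y - x)^2 + (1 - x^2)(1 - y^2) = (1 - x y)^2.\<close>
    have "1 + a * (r / z)\<^sup>2 = (z\<^sup>2 + a * r\<^sup>2) / z\<^sup>2" using z by (simp add: field_simps)
    also have "z\<^sup>2 + a * r\<^sup>2 = (1 - x * (x + z))\<^sup>2"
      unfolding r2 a_def by (simp add: power2_eq_square algebra_simps)
    finally have "1 + a * (r / z)\<^sup>2 = ((1 - x * (x + z)) / z)\<^sup>2" by (simp add: power_divide)
    hence s: "sqrt (1 + a * (r / z)\<^sup>2) = (1 - x * (x + z)) / z" using p z by simp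
    have sx: "(1 - x * (x + z)) / z + x = a / z" using z by (simp add: a_def field_simps power2_eq_square)
    have "sub_kernel x (sub_var x z) = (r / z) * a\<^sup>2 / ((1 - x * (x + z)) / z * (a / z)\<^sup>2)"
      unfolding sub_kernel_def sub_var_def a_def[symmetric] r_def[symmetric] s sx ..
    also have "\<dots> = r * z\<^sup>2 / (1 - x * (x + z))"
    proof -
      have "(r / z) * a\<^sup>2 / (q / z * (a / z)\<^sup>2) = r * z\<^sup>2 / q" if "0 < q" for q
        using a z that by (simp add: field_simps power2_eq_square)
      thus ?thesis using p by blast
    qed
    finally show ?thesis using r z p unfolding r_def[symmetric] by (simp add: field_simps)
  qed
  have F: "(F has_real_derivative f z) (at z)" if "0 < z" "z < 1 - x" for z
  proof -
    have pw: "sub_var x z powr \<alpha> = (1 - (x + z)\<^sup>2) powr (\<alpha> / 2) * z powr (- \<alpha>)"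
      using that y[OF that]
      by (simp add: sub_var_def powr_divide powr_half_sqrt[symmetric] powr_powr powr_minus field_simps)
    have "(F has_real_derivative - (K_const \<alpha> * (sub_var x z powr \<alpha> * sub_kernel x (sub_var x z)
        * - ((1 - x * (x + z)) / (z\<^sup>2 * sqrt (1 - (x + z)\<^sup>2)))))) (at z)"
      unfolding F_def
      by (intro DERIV_minus DERIV_cmult DERIV_chain2[OF sub_int_deriv[OF x \<alpha> Tpos[OF that]] T[OF that]])
    also have "- (K_const \<alpha> * (sub_var x z powr \<alpha> * sub_kernel x (sub_var x z)
        * - ((1 - x * (x + z)) / (z\<^sup>2 * sqrt (1 - (x + z)\<^sup>2)))))
      = K_const \<alpha> * (sub_var x z powr \<alpha>) * (sub_kernel x (sub_var x z) * ((1 - x * (x + z)) / (z\<^sup>2 * sqrt (1 - (x + z)\<^sup>2))))"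
      by (simp only: mult_minus_right minus_minus mult.assoc)
    also have "\<dots> = f z"
      unfolding key[OF that] pw f_def using y[OF that] by (simp add: profile_v_def mult_ac)
    finally show ?thesis .
  qed
  have f_cont: "isCont f z" if "0 < z" for z
  proof -
    have "isCont (profile_v \<alpha>) u" for u
      using profile_v_continuous[OF \<alpha>, of UNIV] by (simp add: continuous_on_eq_continuous_at)
    moreover have "isCont (\<lambda>z. x + z) z" by (intro continuous_intros)
    ultimately have "isCont (\<lambda>z. profile_v \<alpha> (x + z)) z" by (rule isCont_o2[rotated])
    moreover have "isCont (\<lambda>z. z powr (- \<alpha>)) z" using that by (intro continuous_intros) auto
    ultimately show ?thesis unfolding f_def by (rule isCont_mult)
  qed
  have f_nonneg: "0 \<le> f z" for z
    by (simp add: f_def profile_v_nonneg[OF \<alpha>])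
  have A: "((F \<circ> real_of_ereal) \<longlongrightarrow> F \<epsilon>) (at_right (ereal \<epsilon>))"
    unfolding ereal_tendsto_simps
    using F[OF \<epsilon>] by (meson DERIV_isCont isCont_def filterlim_at_split)
  have "((\<lambda>z. sub_int \<alpha> x (sub_var x z)) \<longlongrightarrow> sub_int \<alpha> x 0) (at_left (1 - x))"
  proof (rule continuous_within_tendsto_compose[OF sub_int_continuous_0[OF x \<alpha>]])
    have "1 - x \<noteq> 0" using x by auto
    have "((\<lambda>z. sqrt (1 - (x + z)\<^sup>2) / z) \<longlongrightarrow> sqrt (1 - (x + (1 - x))\<^sup>2) / (1 - x)) (at_left (1 - x))"
      using \<open>1 - x \<noteq> 0\<close> by (intro tendsto_intros) auto
    thus "(sub_var x \<longlongrightarrow> 0) (at_left (1 - x))" by (simp add: sub_var_def[abs_def])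
    have "eventually (\<lambda>z. z \<in> {0<..<1 - x}) (at_left (1 - x))"
      using x by (intro eventually_at_leftI[of 0]) auto
    thus "eventually (\<lambda>z. sub_var x z \<in> {0..}) (at_left (1 - x))"
      by eventually_elim (use Tpos in \<open>auto intro: less_imp_le\<close>)
  qed
  hence "(F \<longlongrightarrow> - (K_const \<alpha> * sub_int \<alpha> x 0)) (at_left (1 - x))"
    unfolding F_def by (intro tendsto_intros)
  hence B: "((F \<circ> real_of_ereal) \<longlongrightarrow> 0) (at_left (ereal (1 - x)))"
    by (simp add: ereal_tendsto_simps sub_int_def)
  \<comment> \<open>Since f is nonnegative, this form of the fundamental theorem delivers the
    integrability together with the value.\<close>
  note FTC = interval_integral_FTC_nonneg[of "ereal \<epsilon>" "ereal (1 - x)" F f, OF _ _ _ _ A B]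
  have int: "set_integrable lborel {\<epsilon><..<1 - x} f"
    using FTC(1) F f_cont f_nonneg \<epsilon> by auto
  have val: "(LBINT z=ereal \<epsilon>..ereal (1 - x). f z) = - F \<epsilon>"
    using FTC(2) F f_cont f_nonneg \<epsilon> by auto
  have eq: "indicator {\<epsilon><..} z * f z = indicator {\<epsilon><..<1 - x} z * f z" for z
    using x by (auto simp: f_def profile_v_zero split: split_indicator)
  show "integrable lborel (\<lambda>z. indicator {\<epsilon><..} z * (profile_v \<alpha> (x + z) * z powr (- \<alpha>)))"
    using int unfolding f_def[symmetric] eq by (simp add: set_integrable_def)
  show "(\<integral>z. indicator {\<epsilon><..} z * (profile_v \<alpha> (x + z) * z powr (- \<alpha>)) \<partial>lborel)
          = K_const \<alpha> * sub_int \<alpha> x (sub_var x \<epsilon>)"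
    using val \<epsilon> unfolding f_def[symmetric] eq
    by (simp add: interval_lebesgue_integral_def set_lebesgue_integral_def F_def)
qed

text \<open>Both s and s + x grow at least linearly in t, so \<open>sub_kernel x t\<close> is of
  order t^(-2), and \<alpha> < 2.\<close>

lemma sub_integrand_tendsto_0:
  assumes x: "\<bar>x\<bar> < 1" and \<alpha>: "0 < \<alpha>" "\<alpha> < 2"
  shows "((\<lambda>t. t powr \<alpha> * sub_kernel x t) \<longlongrightarrow> 0) at_top"
proof -
  define a where "a = 1 - x\<^sup>2"
  have a: "a > 0" using x by (simp add: a_def abs_square_less_1)
  define C where "C = a\<^sup>2 / (a * sqrt a * (1 - \<bar>x\<bar>)\<^sup>2)"
  have bd: "t powr \<alpha> * sub_kernel x t \<le> C * t powr (\<alpha> - 2)" if t: "t \<ge> 1" for t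
  proof -
    define s where "s = sqrt (1 + a * t\<^sup>2)"
    have s1: "1 \<le> s" using a by (simp add: s_def)
    have "sqrt (a * t\<^sup>2) \<le> s" unfolding s_def by (intro real_sqrt_le_mono) simp
    hence s2: "sqrt a * t \<le> s" using t a by (simp add: real_sqrt_mult)
    have "\<bar>x\<bar> * 1 \<le> \<bar>x\<bar> * s" using s1 by (intro mult_left_mono) auto
    hence "(1 - \<bar>x\<bar>) * s \<le> s + x" by (simp add: algebra_simps)
    moreover have "(1 - \<bar>x\<bar>) * (sqrt a * t) \<le> (1 - \<bar>x\<bar>) * s"
      using x s2 by (intro mult_left_mono) auto
    ultimately have s3: "(1 - \<bar>x\<bar>) * (sqrt a * t) \<le> s + x" by linarith
    have pos: "0 < (1 - \<bar>x\<bar>) * (sqrt a * t)" "0 < sqrt a * t" using x a t by auto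
    have "sqrt a * t * ((1 - \<bar>x\<bar>) * (sqrt a * t))\<^sup>2 \<le> s * (s + x)\<^sup>2"
      using s2 s3 pos s1 by (intro mult_mono power_mono) auto
    moreover have "0 < sqrt a * t * ((1 - \<bar>x\<bar>) * (sqrt a * t))\<^sup>2"
      by (rule mult_pos_pos[OF pos(2) zero_less_power[OF pos(1)]])
    ultimately have "t powr \<alpha> * (t * a\<^sup>2 / (s * (s + x)\<^sup>2)) \<le> t powr \<alpha> * (t * a\<^sup>2 / (sqrt a * t * ((1 - \<bar>x\<bar>) * (sqrt a * t))\<^sup>2))"
      using t by (intro mult_left_mono frac_le) auto
    also have "\<dots> = t powr \<alpha> / t\<^sup>2 * C"
    proof -
      have "sqrt a * t * ((1 - \<bar>x\<bar>) * (sqrt a * t))\<^sup>2 = (a * sqrt a * (1 - \<bar>x\<bar>)\<^sup>2) * t ^ 3"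
        using a by (simp add: power_mult_distrib power3_eq_cube power2_eq_square)
      moreover have "t powr \<alpha> * (t * a\<^sup>2 / (D * t ^ 3)) = t powr \<alpha> / t\<^sup>2 * (a\<^sup>2 / D)" if "D > 0" for D
        using t that by (simp add: field_simps power3_eq_cube power2_eq_square)
      moreover have "0 < a * sqrt a * (1 - \<bar>x\<bar>)\<^sup>2"
        using a x by simp
      ultimately show ?thesis unfolding C_def by metis
    qed
    also have "t powr \<alpha> / t\<^sup>2 = t powr (\<alpha> - 2)" using t by (simp add: powr_diff)
    finally show ?thesis by (simp add: sub_kernel_def s_def a_def mult_ac)
  qed
  have "((\<lambda>t. C * t powr (\<alpha> - 2)) \<longlongrightarrow> C * 0) at_top"
    using \<alpha> by (intro tendsto_intros tendsto_neg_powr filterlim_ident) auto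
  hence "((\<lambda>t. C * t powr (\<alpha> - 2)) \<longlongrightarrow> 0) at_top" by simp
  thus ?thesis
    by (rule tendsto_sandwich[OF _ _ tendsto_const, rotated 2])
       (auto intro!: eventually_mono[OF eventually_ge_at_top[of 1]] bd simp: sub_kernel_nonneg[OF x])
qed

section \<open>The integral J\<close>

lemma J_integrands:
  fixes \<alpha> :: real
  assumes \<alpha>: "0 < \<alpha>" "\<alpha> < 2"
  shows "set_integrable lborel {0<..} (\<lambda>t. t powr (\<alpha> - 1) / (1 + t\<^sup>2))"
    and "set_integrable lborel {0<..} (\<lambda>t. t powr (\<alpha> + 1) / (1 + t\<^sup>2)\<^sup>2)"
proof -
  \<comment> \<open>t^(\<alpha> - 3) is the Levy kernel of order 2 - \<alpha>, again an order
    between 0 and 2, so the earlier majorant can be reused.\<close>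
  have i: "integrable lborel (\<lambda>t. min (t powr 2) 1 * levy_kernel (2 - \<alpha>) t)"
    using \<alpha> by (intro min_powr_kernel_integrable) auto
  have *: "t powr (\<alpha> - 1) / (1 + t\<^sup>2) \<le> min (t powr 2) 1 * t powr (\<alpha> - 3)" if "t > 0" for t :: real
  proof -
    have e: "t powr (\<alpha> - 1) = t powr (\<alpha> - 3) * t\<^sup>2"
      using that powr_add[of t "\<alpha> - 3" 2] by simp
    have "t\<^sup>2 / (1 + t\<^sup>2) \<le> min (t powr 2) 1"
      using that by (auto simp: divide_simps add_pos_nonneg power2_eq_square)
    hence "t powr (\<alpha> - 3) * (t\<^sup>2 / (1 + t\<^sup>2)) \<le> t powr (\<alpha> - 3) * min (t powr 2) 1"
      by (intro mult_left_mono) auto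
    thus ?thesis by (simp add: e mult_ac)
  qed
  have **: "t powr (\<alpha> + 1) / (1 + t\<^sup>2)\<^sup>2 \<le> t powr (\<alpha> - 1) / (1 + t\<^sup>2)" if "t > 0" for t :: real
  proof -
    have e: "t powr (\<alpha> + 1) = t powr (\<alpha> - 1) * t\<^sup>2"
      using that powr_add[of t "\<alpha> - 1" 2] by (simp add: add.commute)
    have "t\<^sup>2 / (1 + t\<^sup>2) \<le> 1" by (simp add: divide_simps add_pos_nonneg)
    hence "t powr (\<alpha> - 1) / (1 + t\<^sup>2) * (t\<^sup>2 / (1 + t\<^sup>2)) \<le> t powr (\<alpha> - 1) / (1 + t\<^sup>2) * 1"
      by (intro mult_left_mono) auto
    thus ?thesis by (simp add: e power2_eq_square)
  qed
  show 1: "set_integrable lborel {0<..} (\<lambda>t. t powr (\<alpha> - 1) / (1 + t\<^sup>2))"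
    unfolding set_integrable_def
  proof (rule Bochner_Integration.integrable_bound[OF i])
    show "AE t in lborel. norm (indicator {0<..} t *\<^sub>R (t powr (\<alpha> - 1) / (1 + t\<^sup>2)))
      \<le> norm (min (t powr 2) 1 * levy_kernel (2 - \<alpha>) t)"
      using * by (intro AE_I2) (auto simp: levy_kernel_def split: split_indicator)
  qed simp
  show "set_integrable lborel {0<..} (\<lambda>t. t powr (\<alpha> + 1) / (1 + t\<^sup>2)\<^sup>2)"
    by (rule set_integrable_bound[OF 1])
       (use ** in \<open>auto intro!: AE_I2 simp: set_borel_measurable_def\<close>)
qed

lemma J_int_pos:
  assumes "0 < \<alpha>" "\<alpha> < 2"
  shows "0 < J_int \<alpha>"
proof -
  have "0 \<le> J_int \<alpha>" unfolding J_int_def set_lebesgue_integral_def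
    by (intro integral_nonneg_AE AE_I2) (auto split: split_indicator)
  moreover have "J_int \<alpha> \<noteq> 0"
  proof
    assume "J_int \<alpha> = 0"
    hence "AE t in lborel. indicator {0<..} t *\<^sub>R (t powr (\<alpha> - 1) / (1 + t\<^sup>2)) = 0"
      using J_integrands(1)[OF assms]
      unfolding J_int_def set_lebesgue_integral_def set_integrable_def
      by (subst (asm) integral_nonneg_eq_0_iff_AE) (auto split: split_indicator)
    hence "AE t in lborel. t \<notin> {0<..<(1::real)}"
      by eventually_elim (auto split: split_indicator_asm simp: add_nonneg_eq_0_iff)
    hence "emeasure lborel {0<..<(1::real)} = 0"
      by (subst (asm) AE_iff_measurable[where N="{0<..<(1::real)}"]) auto
    thus False by simp
  qed
  ultimately show ?thesis by simp
qed

text \<open>The function t^\<alpha> / (1 + t^2) vanishes at 0 because \<alpha> > 0 and at infinity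
  because \<alpha> < 2; hence its derivative has integral zero.\<close>

lemma J_int_by_parts:
  assumes \<alpha>: "0 < \<alpha>" "\<alpha> < 2"
  shows "(LBINT t:{0<..}. t powr (\<alpha> + 1) / (1 + t\<^sup>2)\<^sup>2) = \<alpha> * J_int \<alpha> / 2"
proof -
  define f where "f t = \<alpha> * (t powr (\<alpha> - 1) / (1 + t\<^sup>2)) - 2 * (t powr (\<alpha> + 1) / (1 + t\<^sup>2)\<^sup>2)" for t :: real
  define F where "F t = t powr \<alpha> / (1 + t\<^sup>2)" for t :: real
  have nz: "1 + t\<^sup>2 \<noteq> 0" for t :: real by (simp add: add_nonneg_eq_0_iff)
  have int: "set_integrable lborel {0<..} f"
    unfolding f_def by (intro set_integral_diff set_integrable_mult_right J_integrands[OF \<alpha>])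
  have "(LBINT t=0..\<infinity>. f t) = 0 - 0"
  proof (rule interval_integral_FTC_integrable)
    show "(F has_vector_derivative f t) (at t)" if "0 < ereal t" for t
    proof -
      have t: "t > 0" using that by simp
      have e: "t powr \<alpha> * t = t powr (\<alpha> + 1)" using t by (simp add: powr_add)
      have "(F has_real_derivative ((\<alpha> * t powr (\<alpha> - 1)) * (1 + t\<^sup>2) - t powr \<alpha> * (2 * t)) / ((1 + t\<^sup>2) * (1 + t\<^sup>2))) (at t)"
        unfolding F_def using t nz by (auto intro!: derivative_eq_intros)
      also have "((\<alpha> * t powr (\<alpha> - 1)) * (1 + t\<^sup>2) - t powr \<alpha> * (2 * t)) / ((1 + t\<^sup>2) * (1 + t\<^sup>2)) = f t"
        unfolding f_def e[symmetric] using nz[of t] by (simp add: divide_simps power2_eq_square)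
      finally show ?thesis by (simp add: has_real_derivative_iff_has_vector_derivative)
    qed
    show "isCont f t" if "0 < ereal t" for t
      unfolding f_def using that nz by (intro continuous_intros) auto
    show "set_integrable lborel (einterval 0 \<infinity>) f"
      using int by (simp add: zero_ereal_def einterval_def greaterThan_def)
    have "(F \<longlongrightarrow> 0 powr \<alpha> / (1 + 0\<^sup>2)) (at_right 0)"
      unfolding F_def using \<alpha> by (intro tendsto_intros tendsto_powr') (auto simp: eventually_at_filter)
    thus "((F \<circ> real_of_ereal) \<longlongrightarrow> 0) (at_right 0)"
      using \<alpha> by (simp add: zero_ereal_def ereal_tendsto_simps)
    have "(F \<longlongrightarrow> 0) at_top"
    proof (rule tendsto_sandwich[OF _ _ tendsto_const])
      show "\<forall>\<^sub>F t in at_top. F t \<le> t powr (\<alpha> - 2)"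
        using eventually_gt_at_top[of 0]
      proof eventually_elim
        case (elim t)
        have "t powr \<alpha> / (1 + t\<^sup>2) \<le> t powr \<alpha> / t\<^sup>2" using elim by (intro divide_left_mono mult_pos_pos) (auto intro: add_pos_nonneg)
        also have "\<dots> = t powr (\<alpha> - 2)" using elim by (simp add: powr_diff)
        finally show ?case by (simp add: F_def)
      qed
      show "((\<lambda>t::real. t powr (\<alpha> - 2)) \<longlongrightarrow> 0) at_top"
        using \<alpha> by (intro tendsto_neg_powr filterlim_ident) auto
    qed (auto simp: F_def)
    thus "((F \<circ> real_of_ereal) \<longlongrightarrow> 0) (at_left \<infinity>)"
      by (simp add: ereal_tendsto_simps)
  qed auto
  hence "0 = (LBINT t:{0<..}. f t)" by (simp add: interval_lebesgue_integral_0_infty)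
  also have "\<dots> = \<alpha> * J_int \<alpha> - 2 * (LBINT t:{0<..}. t powr (\<alpha> + 1) / (1 + t\<^sup>2)\<^sup>2)"
    unfolding f_def J_int_def
    by (simp only: set_integral_diff(2)[OF set_integrable_mult_right[OF J_integrands(1)[OF \<alpha>]]
          set_integrable_mult_right[OF J_integrands(2)[OF \<alpha>]]] set_integral_mult_right)
  finally show ?thesis by simp
qed


lemma sub_var_at_top:
  assumes "\<bar>x\<bar> < 1"
  shows "filterlim (sub_var x) at_top (at_right 0)"
proof -
  have "((\<lambda>z. sqrt (1 - (x + z)\<^sup>2)) \<longlongrightarrow> sqrt (1 - (x + 0)\<^sup>2)) (at_right 0)"
    by (intro tendsto_intros)
  moreover have "0 < sqrt (1 - (x + 0)\<^sup>2)" using assms by (simp add: abs_square_less_1)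
  ultimately have "filterlim (\<lambda>z. sqrt (1 - (x + z)\<^sup>2) * inverse z) at_top (at_right 0)"
    by (intro filterlim_tendsto_pos_mult_at_top[OF _ _ filterlim_inverse_at_top_right])
  thus ?thesis by (simp add: sub_var_def[abs_def] divide_inverse)
qed

lemma sub_int_diff:
  assumes x: "\<bar>x\<bar> < 1" and \<alpha>: "0 < \<alpha>" and s: "0 \<le> s"
  shows "sub_int \<alpha> x s - sub_int \<alpha> (- x) s = - 4 * x * (LBINT t:{0..s}. t powr (\<alpha> + 1) / (1 + t\<^sup>2)\<^sup>2)"
proof -
  have int: "set_integrable lborel {0..s} (\<lambda>t. t powr \<alpha> * sub_kernel y t)" if "\<bar>y\<bar> < 1" for y
    using that \<alpha> by (intro borel_integrable_atLeastAtMost' continuous_on_subset[OF sub_integrand_continuous]) auto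
  have "sub_int \<alpha> x s - sub_int \<alpha> (- x) s =
     (LBINT t:{0..s}. t powr \<alpha> * sub_kernel x t - t powr \<alpha> * sub_kernel (- x) t)"
    unfolding sub_int_def using x s
    by (simp add: interval_integral_Icc set_integral_diff(2)[OF int int])
  also have "\<dots> = (LBINT t:{0..s}. - 4 * x * (t powr (\<alpha> + 1) / (1 + t\<^sup>2)\<^sup>2))"
  proof (rule set_lebesgue_integral_cong)
    show "\<forall>t. t \<in> {0..s} \<longrightarrow> t powr \<alpha> * sub_kernel x t - t powr \<alpha> * sub_kernel (- x) t
        = - 4 * x * (t powr (\<alpha> + 1) / (1 + t\<^sup>2)\<^sup>2)"
    proof (intro allI impI)
      fix t assume "t \<in> {0..s}"
      hence e: "t powr (\<alpha> + 1) = t powr \<alpha> * t" by (simp add: powr_add)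
      have "t powr \<alpha> * sub_kernel x t - t powr \<alpha> * sub_kernel (- x) t
          = t powr \<alpha> * (sub_kernel x t - sub_kernel (- x) t)" by (simp add: right_diff_distrib)
      thus "t powr \<alpha> * sub_kernel x t - t powr \<alpha> * sub_kernel (- x) t
        = - 4 * x * (t powr (\<alpha> + 1) / (1 + t\<^sup>2)\<^sup>2)"
        unfolding sub_kernel_diff[OF x] e by simp
    qed
  qed simp
  finally show ?thesis by (simp only: set_integral_mult_right)
qed

text \<open>For \<alpha> at least 1 \<open>sub_int\<close> diverges at infinity, so its two values
  cannot be compared through a limit. But its derivative tends to 0, so changing the argument by a
  bounded amount is harmless.\<close>

lemma sub_int_shift_tendsto_0:
  assumes x: "\<bar>x\<bar> < 1" and \<alpha>: "0 < \<alpha>" "\<alpha> < 2"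
    and S: "filterlim S at_top F" and T: "filterlim T at_top F"
    and B: "eventually (\<lambda>n. \<bar>S n - T n\<bar> \<le> B) F"
  shows "((\<lambda>n. sub_int \<alpha> x (S n) - sub_int \<alpha> x (T n)) \<longlongrightarrow> 0) F"
proof (rule tendstoI)
  fix e :: real assume e: "0 < e"
  \<comment> \<open>A Lipschitz constant far out that turns a displacement of at most B into less
    than e; the added 1 makes the denominator positive.\<close>
  define \<eta> where "\<eta> = e / (\<bar>B\<bar> + 1)"
  have \<eta>: "\<eta> > 0" using e by (simp add: \<eta>_def)
  have "eventually (\<lambda>t. t powr \<alpha> * sub_kernel x t < \<eta>) at_top"
    using order_tendstoD(2)[OF sub_integrand_tendsto_0[OF x \<alpha>] \<eta>] .
  then obtain s0 where s0: "\<And>t. t \<ge> s0 \<Longrightarrow> t powr \<alpha> * sub_kernel x t < \<eta>"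
    by (auto simp: eventually_at_top_linorder)
  define s1 where "s1 = max 1 s0"
  have lip: "norm (sub_int \<alpha> x s - sub_int \<alpha> x t) \<le> \<eta> * norm (s - t)" if "s \<ge> s1" "t \<ge> s1" for s t
  proof (rule field_differentiable_bound[of "{s1..}"])
    show "(sub_int \<alpha> x has_field_derivative z powr \<alpha> * sub_kernel x z) (at z within {s1..})" if "z \<in> {s1..}" for z
      using that by (intro has_field_derivative_at_within[OF sub_int_deriv[OF x \<alpha>(1)]]) (auto simp: s1_def)
    show "norm (z powr \<alpha> * sub_kernel x z) \<le> \<eta>" if "z \<in> {s1..}" for z
      using that s0[of z] sub_kernel_nonneg[OF x, of z] by (simp add: s1_def less_imp_le)
  qed (use that in auto)
  have "eventually (\<lambda>n. S n \<ge> s1) F" "eventually (\<lambda>n. T n \<ge> s1) F"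
    using S T by (auto simp: filterlim_at_top)
  with B show "eventually (\<lambda>n. dist (sub_int \<alpha> x (S n) - sub_int \<alpha> x (T n)) 0 < e) F"
  proof eventually_elim
    case (elim n)
    have "\<bar>sub_int \<alpha> x (S n) - sub_int \<alpha> x (T n)\<bar> \<le> \<eta> * \<bar>S n - T n\<bar>" using lip[of "S n" "T n"] elim by simp
    also have "\<dots> \<le> \<eta> * \<bar>B\<bar>" using elim \<eta> by (intro mult_left_mono) auto
    also have "\<dots> < \<eta> * (\<bar>B\<bar> + 1)" using \<eta> by simp
    also have "\<dots> = e" by (simp add: \<eta>_def)
    finally show ?case by simp
  qed
qed

text \<open>One integration by parts leaves the difference of the truncated integrals to the right and to the
  left of \<open>x\<close>. Their integrands combine by \<open>sub_kernel_diff\<close>; their upper limits differ by a bounded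
  amount only, which does not matter in the limit.\<close>

theorem slevy_profile_U:
  assumes \<alpha>: "0 < \<alpha>" "\<alpha> < 2" and x: "\<bar>x\<bar> < 1"
  shows "slevy \<alpha> (profile_U \<alpha>) x = - 2 * K_const \<alpha> * J_int \<alpha> * x"
proof -
  let ?v = "profile_v \<alpha>" and ?K = "K_const \<alpha>"
  have x': "\<bar>- x\<bar> < 1" using x by simp
  obtain c where c: "levy_bound \<alpha> c (1 + \<alpha> / 2) (profile_U \<alpha>)"
    using profile_U_levy_bound[OF \<alpha>] by blast
  define sd where "sd = second_diff (profile_U \<alpha>) x"
  have sd_le: "\<bar>sd z\<bar> \<le> c * min (z powr (1 + \<alpha> / 2)) 1" if "z > 0" for z
    using c that by (simp add: levy_bound_def sd_def)
  have c0: "0 \<le> c" using sd_le[of 1] by simp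
  define g where "g z = ?v (x + z) - ?v (x - z)" for z
  have sd_deriv: "(sd has_real_derivative g z) (at z)" for z
    unfolding sd_def second_diff_def g_def using \<alpha> by (auto intro!: derivative_eq_intros)
  have v_cont: "isCont ?v u" for u
    using profile_v_continuous[OF \<alpha>(1), of UNIV] by (simp add: continuous_on_eq_continuous_at)
  have g_cont: "isCont g z" for z
    unfolding g_def
    using isCont_o2[OF _ v_cont, of z "\<lambda>z. x + z"] isCont_o2[OF _ v_cont, of z "\<lambda>z. x - z"]
    by (intro isCont_diff) auto
  define gk where "gk z = indicator {0<..} z * (g z * z powr (- \<alpha>))" for z
  have [measurable]: "g \<in> borel_measurable borel"
    using g_cont by (intro borel_measurable_continuous_onI continuous_at_imp_continuous_on) auto
  have [measurable]: "gk \<in> borel_measurable borel" unfolding gk_def by measurable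
  \<comment> \<open>For z < 2 the Hoelder bound is at most K 8^(\<alpha>/2) and the extra factor z
    at most 2; for larger z both values of v vanish.\<close>
  define C where "C = 2 * ?K * 8 powr (\<alpha> / 2)"
  have C0: "0 \<le> C" using K_const_pos[OF \<alpha>(1)] by (simp add: C_def)
  have g_le: "\<bar>g z\<bar> * z \<le> C * min (z powr (1 + \<alpha> / 2)) 1" if z: "0 < z" for z
  proof (cases "2 \<le> z")
    case True
    hence "g z = 0" using x by (simp add: g_def profile_v_zero)
    thus ?thesis using C0 by simp
  next
    case False
    have h: "\<bar>g z\<bar> \<le> ?K * (4 * z) powr (\<alpha> / 2)"
      using profile_v_holder[OF \<alpha>, of "x + z" "x - z"] z by (simp add: g_def)
    also have "\<dots> \<le> ?K * 8 powr (\<alpha> / 2)"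
      using False z K_const_pos[OF \<alpha>(1)] \<alpha> by (intro mult_left_mono powr_mono2) auto
    finally have "\<bar>g z\<bar> * z \<le> ?K * 8 powr (\<alpha> / 2) * 2"
      using False z by (intro mult_mono) auto
    hence 1: "\<bar>g z\<bar> * z \<le> C" by (simp add: C_def)
    have "?K * (4 * z) powr (\<alpha> / 2) \<le> ?K * (8 * z) powr (\<alpha> / 2)"
      using z K_const_pos[OF \<alpha>(1)] \<alpha> by (intro mult_left_mono powr_mono2) auto
    with h have "\<bar>g z\<bar> \<le> ?K * (8 * z) powr (\<alpha> / 2)" by linarith
    hence "\<bar>g z\<bar> * z \<le> ?K * (8 * z) powr (\<alpha> / 2) * z" using z by (intro mult_right_mono) auto
    also have "\<dots> = ?K * 8 powr (\<alpha> / 2) * z powr (1 + \<alpha> / 2)" using z by (simp add: powr_mult powr_add)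
    also have "\<dots> \<le> C * z powr (1 + \<alpha> / 2)" using K_const_pos[OF \<alpha>(1)] by (simp add: C_def)
    finally show ?thesis using 1 by (simp add: min_def)
  qed
  have gk_int: "integrable lborel gk"
  proof (rule Bochner_Integration.integrable_bound)
    show "integrable lborel (\<lambda>z. C * (min (z powr (1 + \<alpha> / 2)) 1 * levy_kernel \<alpha> z))"
      using \<alpha> by (intro integrable_mult_right min_powr_kernel_integrable) auto
    show "AE z in lborel. norm (gk z) \<le> norm (C * (min (z powr (1 + \<alpha> / 2)) 1 * levy_kernel \<alpha> z))"
    proof (rule AE_I2)
      fix z :: real
      show "norm (gk z) \<le> norm (C * (min (z powr (1 + \<alpha> / 2)) 1 * levy_kernel \<alpha> z))"
      proof (cases "0 < z")
        case True
        have "\<bar>g z\<bar> * z powr (- \<alpha>) = (\<bar>g z\<bar> * z) * z powr (-1 - \<alpha>)"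
          using True powr_add[of z 1 "-1 - \<alpha>"] by simp
        also have "\<dots> \<le> C * min (z powr (1 + \<alpha> / 2)) 1 * z powr (-1 - \<alpha>)"
          using g_le[OF True] by (intro mult_right_mono) auto
        finally show ?thesis using True C0 by (simp add: gk_def levy_kernel_def abs_mult)
      qed (simp add: gk_def)
    qed
  qed simp
  have sd_int: "set_integrable lborel {0<..} (\<lambda>z. sd z * z powr (-1 - \<alpha>))"
    using slevy_integrable[OF c, of x]
    by (simp add: set_integrable_def sd_def levy_kernel_def mult_ac)
  have g_int: "set_integrable lborel {0<..} (\<lambda>z. (1 / \<alpha>) * (g z * z powr (- \<alpha>)))"
    using gk_int unfolding gk_def by (intro set_integrable_mult_right) (simp add: set_integrable_def)
  define f where "f z = sd z * z powr (-1 - \<alpha>) - (1 / \<alpha>) * (g z * z powr (- \<alpha>))" for z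
  \<comment> \<open>The boundary term of the integration by parts. It vanishes at 0, where the
    second difference is of order z^(1 + \<alpha>/2), and at infinity, where it is bounded.\<close>
  define F where "F z = - (1 / \<alpha>) * (sd z * z powr (- \<alpha>))" for z
  have F_le: "\<bar>F z\<bar> \<le> c / \<alpha> * (min (z powr (1 + \<alpha> / 2)) 1 * z powr (- \<alpha>))" if "z > 0" for z
  proof -
    have "\<bar>sd z\<bar> * z powr (- \<alpha>) \<le> c * min (z powr (1 + \<alpha> / 2)) 1 * z powr (- \<alpha>)"
      using sd_le[OF that] by (intro mult_right_mono) auto
    thus ?thesis using \<alpha> by (simp add: F_def abs_mult field_simps)
  qed
  have "(LBINT z=0..\<infinity>. f z) = 0 - 0"
  proof (rule interval_integral_FTC_integrable)
    show "(F has_vector_derivative f z) (at z)" if "0 < ereal z" for z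
    proof -
      have z: "z > 0" using that by simp
      have "(F has_real_derivative - (1 / \<alpha>) * (g z * z powr (- \<alpha>) + (- \<alpha> * z powr (- \<alpha> - 1)) * sd z)) (at z)"
        unfolding F_def using z \<alpha> by (auto intro!: derivative_eq_intros sd_deriv)
      also have "- (1 / \<alpha>) * (g z * z powr (- \<alpha>) + (- \<alpha> * z powr (- \<alpha> - 1)) * sd z) = f z"
      proof -
        have e: "- \<alpha> - 1 = -1 - \<alpha>" by simp
        show ?thesis unfolding f_def e using \<alpha> by (simp add: field_simps)
      qed
      finally show ?thesis by (simp add: has_real_derivative_iff_has_vector_derivative)
    qed
    show "isCont f z" if "0 < ereal z" for z
      unfolding f_def using that g_cont[of z] DERIV_isCont[OF sd_deriv, of z]
      by (intro isCont_diff isCont_mult continuous_at_within_powr continuous_const) auto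
    show "set_integrable lborel (einterval 0 \<infinity>) f"
      using set_integral_diff(1)[OF sd_int g_int]
      by (simp add: f_def[abs_def] zero_ereal_def einterval_def greaterThan_def)
    have "(F \<longlongrightarrow> 0) (at_right 0)"
    proof (rule Lim_null_comparison)
      show "eventually (\<lambda>z. norm (F z) \<le> c / \<alpha> * z powr (1 - \<alpha> / 2)) (at_right 0)"
        unfolding eventually_at_right_field
      proof (intro exI[of _ 1] conjI allI impI)
        fix z :: real assume z: "0 < z" "z < 1"
        have "min (z powr (1 + \<alpha> / 2)) 1 * z powr (- \<alpha>) \<le> z powr (1 + \<alpha> / 2) * z powr (- \<alpha>)"
          by (intro mult_right_mono) auto
        also have "\<dots> = z powr (1 - \<alpha> / 2)" by (simp add: powr_add[symmetric])
        finally have "c / \<alpha> * (min (z powr (1 + \<alpha> / 2)) 1 * z powr (- \<alpha>)) \<le> c / \<alpha> * z powr (1 - \<alpha> / 2)"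
          using c0 \<alpha> by (intro mult_left_mono) auto
        with F_le[OF z(1)] show "norm (F z) \<le> c / \<alpha> * z powr (1 - \<alpha> / 2)" by simp
      qed simp
      have "((\<lambda>z. c / \<alpha> * z powr (1 - \<alpha> / 2)) \<longlongrightarrow> c / \<alpha> * 0 powr (1 - \<alpha> / 2)) (at_right 0)"
        using \<alpha> by (intro tendsto_intros tendsto_powr') (auto simp: eventually_at_filter)
      thus "((\<lambda>z. c / \<alpha> * z powr (1 - \<alpha> / 2)) \<longlongrightarrow> 0) (at_right 0)" using \<alpha> by simp
    qed
    thus "((F \<circ> real_of_ereal) \<longlongrightarrow> 0) (at_right 0)"
      by (simp add: zero_ereal_def ereal_tendsto_simps)
    have "(F \<longlongrightarrow> 0) at_top"
    proof (rule Lim_null_comparison)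
      show "eventually (\<lambda>z. norm (F z) \<le> c / \<alpha> * z powr (- \<alpha>)) at_top"
        using eventually_gt_at_top[of 0]
      proof eventually_elim
        case (elim z)
        have "min (z powr (1 + \<alpha> / 2)) 1 * z powr (- \<alpha>) \<le> 1 * z powr (- \<alpha>)"
          by (intro mult_right_mono) auto
        hence "c / \<alpha> * (min (z powr (1 + \<alpha> / 2)) 1 * z powr (- \<alpha>)) \<le> c / \<alpha> * (1 * z powr (- \<alpha>))"
          using c0 \<alpha> by (intro mult_left_mono) auto
        with F_le[OF elim] show ?case by simp
      qed
      have "((\<lambda>z. c / \<alpha> * z powr (- \<alpha>)) \<longlongrightarrow> c / \<alpha> * 0) at_top"
        using \<alpha> by (intro tendsto_intros tendsto_neg_powr filterlim_ident) auto
      thus "((\<lambda>z. c / \<alpha> * z powr (- \<alpha>)) \<longlongrightarrow> 0) at_top" by simp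
    qed
    thus "((F \<circ> real_of_ereal) \<longlongrightarrow> 0) (at_left \<infinity>)"
      by (simp add: ereal_tendsto_simps)
  qed auto
  hence "0 = (LBINT z:{0<..}. sd z * z powr (-1 - \<alpha>)) - (LBINT z:{0<..}. (1 / \<alpha>) * (g z * z powr (- \<alpha>)))"
    by (simp only: interval_lebesgue_integral_0_infty f_def set_integral_diff(2)[OF sd_int g_int] diff_self)
  moreover have "(LBINT z:{0<..}. sd z * z powr (-1 - \<alpha>)) = slevy \<alpha> (profile_U \<alpha>) x"
    by (simp add: slevy_def set_lebesgue_integral_def sd_def levy_kernel_def mult_ac)
  moreover have "(LBINT z:{0<..}. (1 / \<alpha>) * (g z * z powr (- \<alpha>))) = (1 / \<alpha>) * (\<integral>z. gk z \<partial>lborel)"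
    unfolding set_integral_mult_right by (simp add: set_lebesgue_integral_def gk_def)
  ultimately have by_parts: "slevy \<alpha> (profile_U \<alpha>) x = (1 / \<alpha>) * (\<integral>z. gk z \<partial>lborel)" by linarith

  \<comment> \<open>Truncation is unavoidable: for \<alpha> at least 1 the integrals of v (x + z)
    z^(-\<alpha>) and v (x - z) z^(-\<alpha>) diverge separately at 0. By evenness of v the second
    one is the first one taken at -x.\<close>
  define e where "e n = inverse (real (Suc n))" for n
  have e: "filterlim e (at_right 0) sequentially"
    unfolding e_def filterlim_at
    by (intro conjI LIMSEQ_inverse_real_of_nat always_eventually) auto
  have e_pos: "0 < e n" for n by (simp add: e_def)
  have e_lim: "e \<longlonglongrightarrow> 0" unfolding e_def by (rule LIMSEQ_inverse_real_of_nat)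
  have e_small: "eventually (\<lambda>n. e n < 1 - x \<and> e n < 1 + x) sequentially"
    using order_tendstoD(2)[OF e_lim, of "1 - x"] order_tendstoD(2)[OF e_lim, of "1 + x"] x
    by (auto intro: eventually_conj)
  have lim1: "(\<lambda>n. \<integral>z. indicator {e n<..} z * gk z \<partial>lborel) \<longlonglongrightarrow> (\<integral>z. gk z \<partial>lborel)"
  proof (rule integral_dominated_convergence[where w = "\<lambda>z. \<bar>gk z\<bar>"])
    show "AE z in lborel. (\<lambda>n. indicator {e n<..} z * gk z) \<longlonglongrightarrow> gk z"
    proof (rule AE_I2)
      fix z :: real
      show "(\<lambda>n. indicator {e n<..} z * gk z) \<longlonglongrightarrow> gk z"
      proof (cases "0 < z")
        case True
        have "eventually (\<lambda>n. indicator {e n<..} z * gk z = gk z) sequentially"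
          using order_tendstoD(2)[OF e_lim True] by eventually_elim simp
        thus ?thesis by (rule tendsto_eventually)
      qed (simp add: gk_def)
    qed
  qed (use gk_int in \<open>auto split: split_indicator\<close>)
  have trunc: "(\<integral>z. indicator {e n<..} z * gk z \<partial>lborel) =
      ?K * (sub_int \<alpha> x (sub_var x (e n)) - sub_int \<alpha> (- x) (sub_var (- x) (e n)))"
    if n: "e n < 1 - x \<and> e n < 1 + x" for n
  proof -
    have n': "e n < 1 - (- x)" using n by simp
    note R = truncated_profile_integral[OF x \<alpha>(1) e_pos conjunct1[OF n]]
    note L = truncated_profile_integral[OF x' \<alpha>(1) e_pos n']
    have "indicator {e n<..} z * gk z = indicator {e n<..} z * (?v (x + z) * z powr (- \<alpha>))
        - indicator {e n<..} z * (?v (- x + z) * z powr (- \<alpha>))" for z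
      using e_pos[of n] profile_v_even[of \<alpha> "x - z"]
      by (auto simp: gk_def g_def left_diff_distrib split: split_indicator)
    hence "(\<integral>z. indicator {e n<..} z * gk z \<partial>lborel) = (\<integral>z. indicator {e n<..} z * (?v (x + z) * z powr (- \<alpha>))
        - indicator {e n<..} z * (?v (- x + z) * z powr (- \<alpha>)) \<partial>lborel)"
      by (intro Bochner_Integration.integral_cong refl)
    thus ?thesis
      unfolding Bochner_Integration.integral_diff[OF R(1) L(1)] R(2) L(2) by (simp add: right_diff_distrib)
  qed
  have S: "filterlim (\<lambda>n. sub_var x (e n)) at_top sequentially"
    by (rule filterlim_compose[OF sub_var_at_top[OF x] e])
  have T: "filterlim (\<lambda>n. sub_var (- x) (e n)) at_top sequentially"
    by (rule filterlim_compose[OF sub_var_at_top[OF x'] e])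
  have S0: "eventually (\<lambda>n. 0 \<le> sub_var x (e n)) sequentially"
    using S by (auto simp: filterlim_at_top)
  \<comment> \<open>The two upper limits differ by \<phi>(h) / h. As \<phi> vanishes at 0 and is
    differentiable there, this quotient converges and is therefore bounded along the
    sequence.\<close>
  define \<phi> where "\<phi> h = sqrt (1 - (x + h)\<^sup>2) - sqrt (1 - (- x + h)\<^sup>2)" for h
  have "1 - x\<^sup>2 > 0" using x by (simp add: abs_square_less_1)
  hence "(\<phi> has_real_derivative inverse (sqrt (1 - x\<^sup>2)) / 2 * (- (2 * x)) - inverse (sqrt (1 - x\<^sup>2)) / 2 * (2 * x)) (at 0)"
    unfolding \<phi>_def by (auto intro!: derivative_eq_intros)
  then obtain D where "(\<phi> has_real_derivative D) (at 0)" by blast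
  hence "(\<lambda>h. \<phi> h / h) \<midarrow>0\<rightarrow> D"
    by (simp add: DERIV_def \<phi>_def)
  hence "(\<lambda>n. \<phi> (e n) / e n) \<longlonglongrightarrow> D"
    by (rule filterlim_compose) (use e in \<open>auto simp: filterlim_at elim: eventually_mono\<close>)
  hence "(\<lambda>n. \<bar>\<phi> (e n) / e n\<bar>) \<longlonglongrightarrow> \<bar>D\<bar>" by (rule tendsto_rabs)
  hence "eventually (\<lambda>n. \<bar>\<phi> (e n) / e n\<bar> < \<bar>D\<bar> + 1) sequentially"
    by (rule order_tendstoD) simp
  hence close: "eventually (\<lambda>n. \<bar>sub_var x (e n) - sub_var (- x) (e n)\<bar> \<le> \<bar>D\<bar> + 1) sequentially"
    by eventually_elim (simp add: sub_var_def \<phi>_def diff_divide_distrib[symmetric])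
  have lim2: "(\<lambda>n. sub_int \<alpha> (- x) (sub_var x (e n)) - sub_int \<alpha> (- x) (sub_var (- x) (e n))) \<longlonglongrightarrow> 0"
    by (rule sub_int_shift_tendsto_0[OF x' \<alpha> S T close])
  have ind0: "indicator {0..} t *\<^sub>R (t powr (\<alpha> + 1) / (1 + t\<^sup>2)\<^sup>2) = indicator {0<..} t *\<^sub>R (t powr (\<alpha> + 1) / (1 + t\<^sup>2)\<^sup>2)" for t :: real
    by (auto split: split_indicator)
  have int0: "set_integrable lborel {0..} (\<lambda>t. t powr (\<alpha> + 1) / (1 + t\<^sup>2)\<^sup>2)"
    using J_integrands(2)[OF \<alpha>] unfolding set_integrable_def ind0 .
  have "((\<lambda>s. LBINT t:{0..s}. t powr (\<alpha> + 1) / (1 + t\<^sup>2)\<^sup>2) \<longlongrightarrow> (LBINT t:{0..}. t powr (\<alpha> + 1) / (1 + t\<^sup>2)\<^sup>2)) at_top"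
    by (rule tendsto_set_lebesgue_integral_at_top) (use int0 in auto)
  also have "(LBINT t:{0..}. t powr (\<alpha> + 1) / (1 + t\<^sup>2)\<^sup>2) = \<alpha> * J_int \<alpha> / 2"
    using J_int_by_parts[OF \<alpha>] unfolding set_lebesgue_integral_def ind0 .
  finally have "(\<lambda>n. LBINT t:{0..sub_var x (e n)}. t powr (\<alpha> + 1) / (1 + t\<^sup>2)\<^sup>2) \<longlonglongrightarrow> \<alpha> * J_int \<alpha> / 2"
    by (rule filterlim_compose[OF _ S])
  \<comment> \<open>The first summand compares x with -x at the same upper limit; the second
    corrects the upper limit for -x.\<close>
  hence "(\<lambda>n. ?K * (- 4 * x * (LBINT t:{0..sub_var x (e n)}. t powr (\<alpha> + 1) / (1 + t\<^sup>2)\<^sup>2)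
      + (sub_int \<alpha> (- x) (sub_var x (e n)) - sub_int \<alpha> (- x) (sub_var (- x) (e n)))))
      \<longlonglongrightarrow> ?K * (- 4 * x * (\<alpha> * J_int \<alpha> / 2) + 0)"
    by (intro tendsto_intros lim2)
  moreover have "eventually (\<lambda>n. ?K * (- 4 * x * (LBINT t:{0..sub_var x (e n)}. t powr (\<alpha> + 1) / (1 + t\<^sup>2)\<^sup>2)
      + (sub_int \<alpha> (- x) (sub_var x (e n)) - sub_int \<alpha> (- x) (sub_var (- x) (e n))))
      = (\<integral>z. indicator {e n<..} z * gk z \<partial>lborel)) sequentially"
    using e_small S0
  proof eventually_elim
    case (elim n)
    show ?case
      unfolding trunc[OF elim(1)] sub_int_diff[OF x \<alpha>(1) elim(2), symmetric] by simp
  qed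
  ultimately have "(\<lambda>n. \<integral>z. indicator {e n<..} z * gk z \<partial>lborel) \<longlonglongrightarrow> ?K * (- 4 * x * (\<alpha> * J_int \<alpha> / 2) + 0)"
    by (rule Lim_transform_eventually)
  from LIMSEQ_unique[OF lim1 this] show ?thesis
    unfolding by_parts using \<alpha> by (simp add: field_simps)
qed

section \<open>The normalising constant\<close>

lemma nn_integral_powr_exp:
  fixes \<alpha> z :: real
  assumes "0 < \<alpha>" "0 < z"
  shows "(\<integral>\<^sup>+t. ennreal (indicator {0..} t * t powr \<alpha> * exp (- (t * z))) \<partial>lborel)
    = ennreal (Gamma (1 + \<alpha>) * z powr (-1 - \<alpha>))"
proof -
  have "ennreal (Gamma (1 + \<alpha>)) = (\<integral>\<^sup>+t. ennreal (indicator {0..} t * t powr \<alpha> / exp t) \<partial>lborel)"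
    using Gamma_conv_nn_integral_real[of "1 + \<alpha>"] assms by simp
  also have "\<dots> = ennreal \<bar>z\<bar> * (\<integral>\<^sup>+t. ennreal (indicator {0..} (0 + z * t) * (0 + z * t) powr \<alpha> / exp (0 + z * t)) \<partial>lborel)"
    using assms by (intro nn_integral_real_affine) auto
  also have "(\<integral>\<^sup>+t. ennreal (indicator {0..} (0 + z * t) * (0 + z * t) powr \<alpha> / exp (0 + z * t)) \<partial>lborel)
     = (\<integral>\<^sup>+t. ennreal (z powr \<alpha>) * ennreal (indicator {0..} t * t powr \<alpha> * exp (- (t * z))) \<partial>lborel)"
    using assms
    by (intro nn_integral_cong)
       (auto simp: ennreal_mult[symmetric] powr_mult exp_minus zero_le_mult_iff field_simps split: split_indicator)
  also have "\<dots> = ennreal (z powr \<alpha>) * (\<integral>\<^sup>+t. ennreal (indicator {0..} t * t powr \<alpha> * exp (- (t * z))) \<partial>lborel)"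
    by (intro nn_integral_cmult) auto
  finally have *: "ennreal (Gamma (1 + \<alpha>)) = ennreal (z powr (1 + \<alpha>)) * (\<integral>\<^sup>+t. ennreal (indicator {0..} t * t powr \<alpha> * exp (- (t * z))) \<partial>lborel)"
    using assms by (simp add: mult.assoc[symmetric] ennreal_mult[symmetric] powr_add)
  have "ennreal (Gamma (1 + \<alpha>) * z powr (-1 - \<alpha>)) = ennreal (z powr (-1 - \<alpha>)) * ennreal (Gamma (1 + \<alpha>))"
    using assms by (subst ennreal_mult[symmetric]) (auto simp: mult.commute)
  also have "\<dots> = ennreal (z powr (-1 - \<alpha>) * z powr (1 + \<alpha>)) * (\<integral>\<^sup>+t. ennreal (indicator {0..} t * t powr \<alpha> * exp (- (t * z))) \<partial>lborel)"
    unfolding * by (simp add: mult.assoc[symmetric] ennreal_mult[symmetric])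
  also have "z powr (-1 - \<alpha>) * z powr (1 + \<alpha>) = 1"
    using assms by (simp add: powr_add[symmetric])
  finally show ?thesis by simp
qed

text \<open>A Laplace transform: 1 contributes 1 / t and the cosine t / (1 + t^2).\<close>

lemma nn_integral_one_minus_cos_exp:
  fixes t :: real
  assumes "0 < t"
  shows "(\<integral>\<^sup>+z. ennreal ((1 - cos z) * exp (- (t * z))) * indicator {0..} z \<partial>lborel) = ennreal (1 / (t * (1 + t\<^sup>2)))"
proof -
  have nz: "1 + t\<^sup>2 \<noteq> 0" by (simp add: add_nonneg_eq_0_iff)
  define F where "F z = - (exp (- (t * z)) / t) - exp (- (t * z)) * (sin z - t * cos z) / (1 + t\<^sup>2)" for z
  have "(\<integral>\<^sup>+z. ennreal ((1 - cos z) * exp (- (t * z))) * indicator {0..} z \<partial>lborel) = ennreal (0 - F 0)"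
  proof (rule nn_integral_FTC_atLeast)
    show "(F has_real_derivative (1 - cos z) * exp (- (t * z))) (at z)" for z
    proof -
      have E: "((\<lambda>z. exp (- (t * z))) has_real_derivative exp (- (t * z)) * (- t)) (at z)"
        by (auto intro!: derivative_eq_intros)
      have S: "((\<lambda>z. sin z - t * cos z) has_real_derivative cos z + t * sin z) (at z)"
        by (auto intro!: derivative_eq_intros)
      have "(F has_real_derivative - (exp (- (t * z)) * (- t) / t)
         - (exp (- (t * z)) * (cos z + t * sin z) + (exp (- (t * z)) * (- t)) * (sin z - t * cos z)) / (1 + t\<^sup>2)) (at z)"
        unfolding F_def by (intro DERIV_diff DERIV_minus DERIV_cdivide DERIV_mult' E S)
      also have "exp (- (t * z)) * (cos z + t * sin z) + (exp (- (t * z)) * (- t)) * (sin z - t * cos z)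
        = exp (- (t * z)) * cos z * (1 + t\<^sup>2)" by (simp add: algebra_simps power2_eq_square)
      also have "- (exp (- (t * z)) * (- t) / t) - exp (- (t * z)) * cos z * (1 + t\<^sup>2) / (1 + t\<^sup>2) = (1 - cos z) * exp (- (t * z))"
        unfolding nonzero_mult_div_cancel_right[OF nz] using assms by (simp add: algebra_simps)
      finally show ?thesis .
    qed
    have e: "((\<lambda>z. exp (- (t * z))) \<longlongrightarrow> 0) at_top"
    proof (rule filterlim_compose[OF exp_at_bot])
      show "LIM z at_top. - (t * z) :> at_bot"
        unfolding filterlim_uminus_at_bot minus_minus
        by (rule filterlim_tendsto_pos_mult_at_top[OF tendsto_const assms filterlim_ident])
    qed
    have "((\<lambda>z. exp (- (t * z)) * (sin z - t * cos z)) \<longlongrightarrow> 0) at_top"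
    proof (rule Lim_null_comparison)
      show "\<forall>\<^sub>F z in at_top. norm (exp (- (t * z)) * (sin z - t * cos z)) \<le> exp (- (t * z)) * (1 + t)"
      proof (rule always_eventually, rule allI)
        fix z
        have "\<bar>sin z - t * cos z\<bar> \<le> \<bar>sin z\<bar> + \<bar>t * cos z\<bar>" by (rule abs_triangle_ineq4)
        also have "\<dots> \<le> 1 + t * 1" unfolding abs_mult using assms by (intro add_mono mult_mono) auto
        finally show "norm (exp (- (t * z)) * (sin z - t * cos z)) \<le> exp (- (t * z)) * (1 + t)"
          by (simp add: abs_mult)
      qed
      show "((\<lambda>z. exp (- (t * z)) * (1 + t)) \<longlongrightarrow> 0) at_top"
        by (rule tendsto_mult_left_zero[OF e])
    qed
    hence "(F \<longlongrightarrow> - (0 / t) - 0 / (1 + t\<^sup>2)) at_top"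
      unfolding F_def using assms nz by (intro tendsto_intros e) auto
    thus "(F \<longlongrightarrow> 0) at_top" by simp
  qed auto
  also have "0 - F 0 = 1 / (t * (1 + t\<^sup>2))"
    using assms nz by (simp add: F_def divide_simps power2_eq_square)
  finally show ?thesis .
qed

text \<open>Writing \<open>z powr (-1 - \<alpha>)\<close> as a Gamma integral and exchanging the integrals yields the same
  \<open>J_int\<close> as for the profile, so that its value is never needed.\<close>

lemma slevy_cos:
  assumes "0 < \<alpha>" "\<alpha> < 2"
  shows "slevy \<alpha> cos 0 = - 2 * J_int \<alpha> / Gamma (1 + \<alpha>)"
proof -
  \<comment> \<open>As 1 - cos is nonnegative, everything stays within nonnegative integrals, and
    Tonelli's theorem permits the exchange for free.\<close>
  let ?f = "\<lambda>t z. ennreal (indicator {0..} t * t powr \<alpha> * (indicator {0<..} z * (1 - cos z) * exp (- (t * z))))"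
  have G: "Gamma (1 + \<alpha>) > 0" using assms by (intro Gamma_real_pos) auto
  have int: "integrable lborel (\<lambda>z. (1 - cos z) * levy_kernel \<alpha> z)"
  proof -
    have "C2_bounded cos"
      by (rule C2_boundedI[where f' = "\<lambda>x. - sin x" and f'' = "\<lambda>x. - cos x" and ?D0.0 = 1 and ?D1.0 = 1 and ?D2.0 = 1])
         (auto intro!: derivative_eq_intros continuous_intros)
    then obtain c where "levy_bound \<alpha> c 2 cos" using C2_bounded_levy_bound assms by blast
    from slevy_integrable[OF this, of 0]
    have "integrable lborel (\<lambda>z. - (1 / 2) * (second_diff cos 0 z * levy_kernel \<alpha> z))"
      by (rule integrable_mult_right)
    thus ?thesis by (simp add: second_diff_def algebra_simps)
  qed
  have "(\<integral>\<^sup>+z. \<integral>\<^sup>+t. ?f t z \<partial>lborel \<partial>lborel) = (\<integral>\<^sup>+z. ennreal (Gamma (1 + \<alpha>)) * ennreal ((1 - cos z) * levy_kernel \<alpha> z) \<partial>lborel)"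
  proof (rule nn_integral_cong)
    fix z :: real
    show "(\<integral>\<^sup>+t. ?f t z \<partial>lborel) = ennreal (Gamma (1 + \<alpha>)) * ennreal ((1 - cos z) * levy_kernel \<alpha> z)"
    proof (cases "0 < z")
      case True
      have "(\<integral>\<^sup>+t. ?f t z \<partial>lborel) = (\<integral>\<^sup>+t. ennreal (1 - cos z) * ennreal (indicator {0..} t * t powr \<alpha> * exp (- (t * z))) \<partial>lborel)"
        using True by (intro nn_integral_cong) (auto simp: ennreal_mult[symmetric] mult_ac)
      also have "\<dots> = ennreal (1 - cos z) * (\<integral>\<^sup>+t. ennreal (indicator {0..} t * t powr \<alpha> * exp (- (t * z))) \<partial>lborel)"
        by (intro nn_integral_cmult) auto
      also have "\<dots> = ennreal (1 - cos z) * ennreal (Gamma (1 + \<alpha>) * z powr (-1 - \<alpha>))"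
        by (simp only: nn_integral_powr_exp[OF assms(1) True])
      finally show ?thesis using True G by (simp add: levy_kernel_def ennreal_mult[symmetric] mult_ac)
    qed (simp add: levy_kernel_def)
  qed
  also have "\<dots> = ennreal (Gamma (1 + \<alpha>)) * (\<integral>\<^sup>+z. ennreal ((1 - cos z) * levy_kernel \<alpha> z) \<partial>lborel)"
    by (intro nn_integral_cmult) auto
  also have "(\<integral>\<^sup>+z. ennreal ((1 - cos z) * levy_kernel \<alpha> z) \<partial>lborel) = ennreal (\<integral>z. (1 - cos z) * levy_kernel \<alpha> z \<partial>lborel)"
    by (rule nn_integral_eq_integral[OF int]) (auto simp: levy_kernel_nonneg)
  finally have 1: "(\<integral>\<^sup>+z. \<integral>\<^sup>+t. ?f t z \<partial>lborel \<partial>lborel) = ennreal (Gamma (1 + \<alpha>) * (\<integral>z. (1 - cos z) * levy_kernel \<alpha> z \<partial>lborel))"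
    using G by (subst ennreal_mult) (auto intro!: integral_nonneg_AE AE_I2 simp: levy_kernel_nonneg)
  have "(\<integral>\<^sup>+t. \<integral>\<^sup>+z. ?f t z \<partial>lborel \<partial>lborel) = (\<integral>\<^sup>+t. ennreal (indicator {0<..} t * (t powr (\<alpha> - 1) / (1 + t\<^sup>2))) \<partial>lborel)"
  proof (rule nn_integral_cong)
    fix t :: real
    show "(\<integral>\<^sup>+z. ?f t z \<partial>lborel) = ennreal (indicator {0<..} t * (t powr (\<alpha> - 1) / (1 + t\<^sup>2)))"
    proof (cases "0 < t")
      case True
      have "(\<integral>\<^sup>+z. ?f t z \<partial>lborel) = (\<integral>\<^sup>+z. ennreal (t powr \<alpha>) * (ennreal ((1 - cos z) * exp (- (t * z))) * indicator {0..} z) \<partial>lborel)"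
        using True by (intro nn_integral_cong) (auto simp: ennreal_mult[symmetric] mult_ac split: split_indicator)
      also have "\<dots> = ennreal (t powr \<alpha>) * (\<integral>\<^sup>+z. ennreal ((1 - cos z) * exp (- (t * z))) * indicator {0..} z \<partial>lborel)"
        by (intro nn_integral_cmult) auto
      also have "\<dots> = ennreal (t powr \<alpha>) * ennreal (1 / (t * (1 + t\<^sup>2)))"
        by (simp only: nn_integral_one_minus_cos_exp[OF True])
      also have "\<dots> = ennreal (t powr \<alpha> * (1 / (t * (1 + t\<^sup>2))))"
        using True by (intro ennreal_mult[symmetric]) auto
      also have "t powr \<alpha> * (1 / (t * (1 + t\<^sup>2))) = t powr (\<alpha> - 1) / (1 + t\<^sup>2)"
        using True by (simp add: powr_diff)
      finally show ?thesis using True by simp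
    qed (cases "t = 0"; simp)
  qed
  also have "\<dots> = ennreal (\<integral>t. indicator {0<..} t * (t powr (\<alpha> - 1) / (1 + t\<^sup>2)) \<partial>lborel)"
    using J_integrands(1)[OF assms]
    by (intro nn_integral_eq_integral) (auto simp: set_integrable_def)
  also have "(\<integral>t. indicator {0<..} t * (t powr (\<alpha> - 1) / (1 + t\<^sup>2)) \<partial>lborel) = J_int \<alpha>"
    by (simp add: J_int_def set_lebesgue_integral_def)
  finally have 2: "(\<integral>\<^sup>+t. \<integral>\<^sup>+z. ?f t z \<partial>lborel \<partial>lborel) = ennreal (J_int \<alpha>)" .
  have "(\<integral>\<^sup>+z. \<integral>\<^sup>+t. ?f t z \<partial>lborel \<partial>lborel) = (\<integral>\<^sup>+t. \<integral>\<^sup>+z. ?f t z \<partial>lborel \<partial>lborel)"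
    by (rule lborel_pair.Fubini') measurable
  with 1 2 have "ennreal (Gamma (1 + \<alpha>) * (\<integral>z. (1 - cos z) * levy_kernel \<alpha> z \<partial>lborel)) = ennreal (J_int \<alpha>)"
    by simp
  hence "Gamma (1 + \<alpha>) * (\<integral>z. (1 - cos z) * levy_kernel \<alpha> z \<partial>lborel) = J_int \<alpha>"
    using J_int_pos[OF assms] G
    by (subst (asm) ennreal_inj) (auto intro!: mult_nonneg_nonneg integral_nonneg_AE AE_I2 simp: levy_kernel_nonneg)
  hence I: "(\<integral>z. (1 - cos z) * levy_kernel \<alpha> z \<partial>lborel) = J_int \<alpha> / Gamma (1 + \<alpha>)"
    using G by (metis nonzero_mult_div_cancel_left less_irrefl)
  have "slevy \<alpha> cos 0 = (\<integral>z. - 2 * ((1 - cos z) * levy_kernel \<alpha> z) \<partial>lborel)"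
    unfolding slevy_def by (intro Bochner_Integration.integral_cong) (auto simp: second_diff_def algebra_simps)
  thus ?thesis unfolding integral_mult_right_zero I by simp
qed

lemma slevy_cos_scaled:
  assumes "0 < \<alpha>" "\<alpha> < 2"
  shows "(\<integral>z. (2 * cos (z * \<xi>) - 2) * levy_kernel \<alpha> z \<partial>lborel) = - 2 * J_int \<alpha> / Gamma (1 + \<alpha>) * \<bar>\<xi>\<bar> powr \<alpha>"
proof (cases "\<xi> = 0")
  case False
  have "(\<integral>z. (2 * cos (z * \<xi>) - 2) * levy_kernel \<alpha> z \<partial>lborel) = slevy \<alpha> (\<lambda>y. cos (\<xi> * y + 0)) 0"
    unfolding slevy_def by (intro Bochner_Integration.integral_cong) (auto simp: second_diff_def algebra_simps)
  also have "\<dots> = \<bar>\<xi>\<bar> powr \<alpha> * slevy \<alpha> cos (\<xi> * 0 + 0)" by (rule slevy_scale[OF False])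
  finally show ?thesis using slevy_cos[OF assms] by simp
qed (use assms in simp)

subsection \<open>Schwartz functions\<close>

text \<open>An integrable weight that changes by a bounded factor under unit translations, which is
  what allows second differences of w to be bounded pointwise by it.\<close>

definition quad_decay :: "real \<Rightarrow> real" where
  "quad_decay x = 1 / (1 + x\<^sup>2)"

lemma quad_decay_pos: "0 < quad_decay x"
  by (simp add: quad_decay_def add_pos_nonneg)

lemma quad_decay_measurable [measurable]: "quad_decay \<in> borel_measurable borel"
  unfolding quad_decay_def by measurable

lemma quad_decay_integrable: "integrable lborel quad_decay"
proof -
  have "(\<integral>\<^sup>+x. ennreal (quad_decay x) * indicator {0..} x \<partial>lborel) = ennreal (pi / 2 - arctan 0)"
    unfolding quad_decay_def
    by (rule nn_integral_FTC_atLeast)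
       (auto intro!: derivative_eq_intros tendsto_arctan_at_top simp: inverse_eq_divide)
  also have "(\<integral>\<^sup>+x. ennreal (quad_decay x) * indicator {0..} x \<partial>lborel) = (\<integral>\<^sup>+x. ennreal (quad_decay x * indicator {0..} x) \<partial>lborel)"
    by (intro nn_integral_cong) (auto split: split_indicator)
  finally have i: "integrable lborel (\<lambda>x. quad_decay x * indicator {0..} x)"
    by (intro integrableI_nn_integral_finite) (auto simp: quad_decay_pos less_imp_le)
  have j: "integrable lborel (\<lambda>x. quad_decay x * indicator {..0} x)"
    using lborel_integrable_real_affine[OF i, of "-1" 0]
    by (rule Bochner_Integration.integrable_cong[THEN iffD1, rotated 2])
       (auto simp: quad_decay_def split: split_indicator)
  show ?thesis
    by (rule Bochner_Integration.integrable_bound[OF Bochner_Integration.integrable_add[OF i j]])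
       (auto simp: quad_decay_def split: split_indicator)
qed

lemma schwartzE:
  assumes "schwartz w"
  obtains w' w'' A where "\<And>x. (w has_real_derivative w' x) (at x)"
    "\<And>x. (w' has_real_derivative w'' x) (at x)" "continuous_on UNIV w''"
    "\<And>x. \<bar>w x\<bar> \<le> A * quad_decay x" "\<And>x. \<bar>w'' x\<bar> \<le> A * quad_decay x" "C2_bounded w" "0 < A"
proof -
  have diff: "(deriv ^^ n) w differentiable (at x)" for n x
    using assms by (simp add: schwartz_def)
  have bdd: "\<exists>B. \<forall>x. \<bar>x ^ m * (deriv ^^ n) w x\<bar> \<le> B" for m n
    using assms by (auto simp: schwartz_def bounded_iff)
  have der: "((deriv ^^ n) w has_real_derivative (deriv ^^ Suc n) w x) (at x)" for n x
    using diff[of n x] by (simp add: DERIV_deriv_iff_real_differentiable)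
  have cont: "continuous_on UNIV ((deriv ^^ n) w)" for n
    using der by (meson DERIV_isCont continuous_at_imp_continuous_on)
  have decay: "\<exists>B. \<forall>x. \<bar>(deriv ^^ n) w x\<bar> \<le> B * quad_decay x" for n
  proof -
    obtain B0 B2 where B: "\<And>x. \<bar>x ^ 0 * (deriv ^^ n) w x\<bar> \<le> B0" "\<And>x. \<bar>x ^ 2 * (deriv ^^ n) w x\<bar> \<le> B2"
      using bdd[of 0 n] bdd[of 2 n] by blast
    have "\<bar>(deriv ^^ n) w x\<bar> \<le> (B0 + B2) * quad_decay x" for x
    proof -
      have "(1 + x\<^sup>2) * \<bar>(deriv ^^ n) w x\<bar> \<le> B0 + B2"
        using B(1)[of x] B(2)[of x] by (simp add: abs_mult algebra_simps)
      thus ?thesis by (simp add: quad_decay_def field_simps add_pos_nonneg)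
    qed
    thus ?thesis by blast
  qed
  obtain B0 B1 B2 where B: "\<And>x. \<bar>(deriv ^^ 0) w x\<bar> \<le> B0 * quad_decay x"
     "\<And>x. \<bar>(deriv ^^ 1) w x\<bar> \<le> B1 * quad_decay x" "\<And>x. \<bar>(deriv ^^ 2) w x\<bar> \<le> B2 * quad_decay x"
    using decay[of 0] decay[of 1] decay[of 2] by blast
  define A where "A = max 1 (max B0 (max B1 B2))"
  have le: "\<bar>y\<bar> \<le> A * quad_decay x" if "\<bar>y\<bar> \<le> b * quad_decay x" "b \<le> A" for y b x
    using that quad_decay_pos[of x] by (meson less_imp_le mult_right_mono order_trans)
  have A: "B0 \<le> A" "B1 \<le> A" "B2 \<le> A" "0 < A" by (auto simp: A_def)
  have q1: "A * quad_decay x \<le> A" for x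
    using A(4) by (simp add: quad_decay_def divide_simps add_pos_nonneg)
  note b0 = le[OF B(1) A(1)] and b1 = le[OF B(2) A(2)] and b2 = le[OF B(3) A(3)]
  have C2: "C2_bounded w"
    using der[of 0] der[of 1] cont[of 2] order_trans[OF b0 q1] order_trans[OF b1 q1] order_trans[OF b2 q1]
    by (intro C2_boundedI[where f' = "(deriv ^^ 1) w" and f'' = "(deriv ^^ 2) w"]) (auto simp: numeral_2_eq_2)
  show ?thesis
    by (rule that[of "(deriv ^^ 1) w" "(deriv ^^ 2) w" A])
       (use der[of 0] der[of 1] cont[of 2] b0 b2 C2 A(4) in \<open>auto simp: numeral_2_eq_2\<close>)
qed

text \<open>This is x^2 \<le> 2 (x - y)^2 + 2 y^2 with |x - y| at most 1; the term q in the proof is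
  the square discarded in that inequality.\<close>

lemma quad_decay_shift_le:
  assumes "\<bar>x - y\<bar> \<le> 1"
  shows "quad_decay y \<le> 3 * quad_decay x"
proof -
  define p q where "p = (x - y)\<^sup>2" and "q = (x - 2 * y)\<^sup>2"
  have "0 \<le> q" "0 \<le> y\<^sup>2" by (simp_all add: q_def)
  moreover have "p \<le> 1" using assms by (simp add: p_def abs_square_le_1)
  moreover have "x\<^sup>2 = 2 * p - q + 2 * y\<^sup>2"
    by (simp add: p_def q_def power2_eq_square algebra_simps)
  ultimately have "1 + x\<^sup>2 \<le> 3 * (1 + y\<^sup>2)" unfolding distrib_left by argo
  thus ?thesis by (simp add: quad_decay_def field_simps add_pos_nonneg)
qed

text \<open>Splits off a factor in z that is integrable against the kernel from a sum of translates
  in x whose integral does not depend on z. That product form is the majorant for Fubini. Small z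
  take the mean value theorem twice, large z the triangle inequality.\<close>

lemma schwartz_second_diff_le:
  assumes "\<And>x. (w has_real_derivative w' x) (at x)"
    "\<And>x. (w' has_real_derivative w'' x) (at x)"
    "\<And>x. \<bar>w x\<bar> \<le> A * quad_decay x" "\<And>x. \<bar>w'' x\<bar> \<le> A * quad_decay x" "0 < A" "0 < z"
  shows "\<bar>second_diff w x z\<bar> \<le>
    6 * A * min (z powr 2) 1 * (quad_decay (x + z) + quad_decay (x - z) + 2 * quad_decay x)"
proof (cases "z \<le> 1")
  case True
  note q = quad_decay_pos[of "x + z"] quad_decay_pos[of "x - z"] quad_decay_pos[of x]
  have "\<exists>y>0. y < z \<and> second_diff w x z - second_diff w x 0 = (z - 0) * (w' (x + y) - w' (x - y))"
    using assms unfolding second_diff_def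
    by (intro MVT2) (auto intro!: derivative_eq_intros DERIV_chain2[OF assms(1)])
  then obtain y where y: "0 < y" "y < z" "second_diff w x z = z * (w' (x + y) - w' (x - y))"
    by (auto simp: second_diff_def)
  have "\<exists>u>x - y. u < x + y \<and> w' (x + y) - w' (x - y) = ((x + y) - (x - y)) * w'' u"
    using y assms(2) by (intro MVT2) auto
  then obtain u where u: "x - y < u" "u < x + y" "w' (x + y) - w' (x - y) = 2 * y * w'' u" by auto
  have "\<bar>w'' u\<bar> \<le> A * (3 * quad_decay x)"
    using quad_decay_shift_le[of x u] assms(4)[of u] assms(5) u y True
    by (smt (verit) mult_left_mono)
  hence "\<bar>second_diff w x z\<bar> \<le> z * (2 * y * (A * (3 * quad_decay x)))"
    unfolding y(3) u(3) abs_mult using y assms(6) by (intro mult_mono) auto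
  also have "\<dots> \<le> z * (2 * z * (A * (3 * quad_decay x)))"
    using y q assms by (intro mult_left_mono mult_right_mono) auto
  also have "\<dots> = 6 * A * min (z powr 2) 1 * quad_decay x"
    using True assms mult_mono[of z 1 z 1] by (simp add: power2_eq_square)
  also have "\<dots> \<le> 6 * A * min (z powr 2) 1 * (quad_decay (x + z) + quad_decay (x - z) + 2 * quad_decay x)"
    using assms q by (intro mult_left_mono mult_nonneg_nonneg) auto
  finally show ?thesis .
next
  case False
  note q = quad_decay_pos[of "x + z"] quad_decay_pos[of "x - z"] quad_decay_pos[of x]
  have "1 \<le> z powr 2" using False by (intro ge_one_powr_ge_zero) auto
  hence m: "min (z powr 2) 1 = 1" by simp
  have "\<bar>second_diff w x z\<bar> \<le> \<bar>w (x + z)\<bar> + \<bar>w (x - z)\<bar> + 2 * \<bar>w x\<bar>"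
    by (simp add: second_diff_def)
  also have "\<dots> \<le> A * quad_decay (x + z) + A * quad_decay (x - z) + 2 * (A * quad_decay x)"
    using assms(3)[of "x+z"] assms(3)[of "x-z"] assms(3)[of x] by linarith
  also have "\<dots> = A * (quad_decay (x + z) + quad_decay (x - z) + 2 * quad_decay x)"
    by (simp add: algebra_simps)
  also have "\<dots> \<le> 6 * A * (quad_decay (x + z) + quad_decay (x - z) + 2 * quad_decay x)"
    using q assms(5) by (intro mult_right_mono) auto
  finally show ?thesis unfolding m by simp
qed

lemma fourier_shift:
  fixes w :: "real \<Rightarrow> real"
  assumes "integrable lborel w"
  shows "integrable lborel (\<lambda>x. cis (- (x * \<xi>)) * complex_of_real (w (x + z)))"
    and "(\<integral>x. cis (- (x * \<xi>)) * complex_of_real (w (x + z)) \<partial>lborel) = cis (z * \<xi>) * fourier w \<xi>"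
proof -
  have [measurable]: "w \<in> borel_measurable borel" using borel_measurable_integrable[OF assms] by simp
  have wz: "integrable lborel (\<lambda>x. w (x + z))"
    using lborel_integrable_real_affine[OF assms, of 1 z] by (simp add: add.commute)
  have cm [measurable]: "(\<lambda>x. cis (- (x * \<xi>))) \<in> borel_measurable borel"
    by (intro borel_measurable_continuous_onI continuous_intros)
  show "integrable lborel (\<lambda>x. cis (- (x * \<xi>)) * complex_of_real (w (x + z)))"
    by (rule Bochner_Integration.integrable_bound[OF wz]) (auto simp: norm_mult)
  have "fourier w \<xi> = (\<integral>x. cis (- ((z + 1 * x) * \<xi>)) * complex_of_real (w (z + 1 * x)) \<partial>lborel)"
    unfolding fourier_def by (subst lborel_integral_real_affine[of 1 _ z]) auto
  also have "\<dots> = (\<integral>x. cis (- (z * \<xi>)) * (cis (- (x * \<xi>)) * complex_of_real (w (x + z))) \<partial>lborel)"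
    by (intro Bochner_Integration.integral_cong) (auto simp: mult.assoc[symmetric] cis_mult algebra_simps)
  also have "\<dots> = cis (- (z * \<xi>)) * (\<integral>x. cis (- (x * \<xi>)) * complex_of_real (w (x + z)) \<partial>lborel)"
    by (rule integral_mult_right_zero)
  finally show "(\<integral>x. cis (- (x * \<xi>)) * complex_of_real (w (x + z)) \<partial>lborel) = cis (z * \<xi>) * fourier w \<xi>"
    by (simp add: mult.assoc[symmetric] cis_mult)
qed

text \<open>For fixed z the second difference multiplies the transform by 2 cos (z \<xi>) - 2;
  Fubini then leaves the scaled cosine integral as symbol. The factor C is kept arbitrary so that
  the lemma serves both existence and uniqueness of the normalising constant.\<close>

lemma fourier_levy_integral:
  assumes w: "schwartz w" and \<alpha>: "0 < \<alpha>" "\<alpha> < 2"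
  shows "fourier (\<lambda>x. - (C * levy_integral \<alpha> w x)) \<xi> =
    complex_of_real (C * (2 * J_int \<alpha> / Gamma (1 + \<alpha>)) * \<bar>\<xi>\<bar> powr \<alpha>) * fourier w \<xi>"
proof -
  obtain w' w'' A where W: "\<And>x. (w has_real_derivative w' x) (at x)"
    "\<And>x. (w' has_real_derivative w'' x) (at x)" "continuous_on UNIV w''"
    "\<And>x. \<bar>w x\<bar> \<le> A * quad_decay x" "\<And>x. \<bar>w'' x\<bar> \<le> A * quad_decay x" "C2_bounded w" "0 < A"
    using schwartzE[OF w] by metis
  have [measurable]: "w \<in> borel_measurable borel"
    using W(1) by (meson DERIV_isCont continuous_at_imp_continuous_on borel_measurable_continuous_onI)
  have q_int: "integrable lborel (\<lambda>x. quad_decay (x + a))" for a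
    using lborel_integrable_real_affine[OF quad_decay_integrable, of 1 a] by (simp add: add.commute)
  have w_int: "integrable lborel w"
    by (rule Bochner_Integration.integrable_bound[OF integrable_mult_right[OF quad_decay_integrable, of A]])
       (use W(4,7) quad_decay_pos in \<open>auto simp: abs_mult less_imp_le\<close>)
  have cm [measurable]: "(\<lambda>x. cis (- (x * \<xi>))) \<in> borel_measurable borel"
    by (intro borel_measurable_continuous_onI continuous_intros)
  define Q where "Q z x = quad_decay (x + z) + quad_decay (x - z) + 2 * quad_decay x" for z x
  have Q_int: "integrable lborel (Q z)" for z
    unfolding Q_def using q_int[of z] q_int[of "-z"] quad_decay_integrable by simp
  have Q_val: "(\<integral>x. Q z x \<partial>lborel) = 4 * (\<integral>x. quad_decay x \<partial>lborel)" for z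
  proof -
    have s: "(\<integral>x. quad_decay (x + a) \<partial>lborel) = (\<integral>x. quad_decay x \<partial>lborel)" for a
      by (subst lborel_integral_real_affine[of 1 quad_decay a]) (auto simp: add.commute)
    show ?thesis unfolding Q_def
      using q_int[of z] q_int[of "-z"] quad_decay_integrable s[of z] s[of "-z"] by simp
  qed
  define f where "f z x = cis (- (x * \<xi>)) * complex_of_real (second_diff w x z * levy_kernel \<alpha> z)" for z x
  have f_meas [measurable]: "case_prod f \<in> borel_measurable (lborel \<Otimes>\<^sub>M lborel)"
    unfolding f_def second_diff_def by measurable
  have f_le: "norm (f z x) \<le> 6 * A * (min (z powr 2) 1 * levy_kernel \<alpha> z) * Q z x" for z x
  proof (cases "0 < z")
    case True
    have "\<bar>second_diff w x z\<bar> * levy_kernel \<alpha> z \<le> (6 * A * min (z powr 2) 1 * Q z x) * levy_kernel \<alpha> z"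
      unfolding Q_def using schwartz_second_diff_le[OF W(1,2,4,5,7) True]
      by (intro mult_right_mono levy_kernel_nonneg)
    thus ?thesis by (simp add: f_def norm_mult levy_kernel_nonneg mult_ac)
  qed (simp add: f_def levy_kernel_def)
  have [measurable]: "f z \<in> borel_measurable borel" for z
    unfolding f_def second_diff_def by measurable
  have f_int_x: "integrable lborel (f z)" for z
    by (rule Bochner_Integration.integrable_bound[OF integrable_mult_right[OF Q_int[of z], of "6 * A * (min (z powr 2) 1 * levy_kernel \<alpha> z)"]])
       (use order_trans[OF f_le abs_ge_self] in auto)
  have int_pair: "integrable (lborel \<Otimes>\<^sub>M lborel) (case_prod f)"
  proof (rule lborel_pair.Fubini_integrable[OF f_meas])
    show "AE z in lborel. integrable lborel (\<lambda>x. case (z, x) of (z, x) \<Rightarrow> f z x)"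
      using f_int_x by simp
    let ?B = "\<lambda>z. 6 * A * (min (z powr 2) 1 * levy_kernel \<alpha> z) * (4 * (\<integral>x. quad_decay x \<partial>lborel))"
    show "integrable lborel (\<lambda>z. \<integral>x. norm (case (z, x) of (z, x) \<Rightarrow> f z x) \<partial>lborel)"
    proof (rule Bochner_Integration.integrable_bound)
      show "integrable lborel ?B"
        using \<alpha> by (intro integrable_mult_left integrable_mult_right min_powr_kernel_integrable) auto
      show "(\<lambda>z. \<integral>x. norm (case (z, x) of (z, x) \<Rightarrow> f z x) \<partial>lborel) \<in> borel_measurable lborel"
        by (intro lborel.borel_measurable_lebesgue_integral) (use f_meas in \<open>simp add: case_prod_beta\<close>)
      show "AE z in lborel. norm (\<integral>x. norm (case (z, x) of (z, x) \<Rightarrow> f z x) \<partial>lborel) \<le> norm (?B z)"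
      proof (rule AE_I2)
        fix z :: real
        have "(\<integral>x. norm (f z x) \<partial>lborel) \<le> (\<integral>x. 6 * A * (min (z powr 2) 1 * levy_kernel \<alpha> z) * Q z x \<partial>lborel)"
          by (intro integral_mono integrable_norm f_int_x integrable_mult_right Q_int f_le)
        also have "\<dots> = ?B z" by (simp add: Q_val)
        also have "\<dots> \<le> norm (?B z)" by simp
        finally show "norm (\<integral>x. norm (case (z, x) of (z, x) \<Rightarrow> f z x) \<partial>lborel) \<le> norm (?B z)"
          by (simp add: integral_nonneg_AE)
      qed
    qed
  qed
  have inner: "(\<integral>x. f z x \<partial>lborel) = complex_of_real ((2 * cos (z * \<xi>) - 2) * levy_kernel \<alpha> z) * fourier w \<xi>" for z
  proof -
    have eq: "f z x = complex_of_real (levy_kernel \<alpha> z) *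
       (cis (- (x * \<xi>)) * complex_of_real (w (x + z)) + cis (- (x * \<xi>)) * complex_of_real (w (x + - z))
          - 2 * (cis (- (x * \<xi>)) * complex_of_real (w (x + 0))))" for x
      by (simp add: f_def second_diff_def algebra_simps)
    note s = fourier_shift[OF w_int, of \<xi>]
    have "(\<integral>x. f z x \<partial>lborel) = complex_of_real (levy_kernel \<alpha> z) *
       (cis (z * \<xi>) * fourier w \<xi> + cis (- z * \<xi>) * fourier w \<xi> - 2 * (cis (0 * \<xi>) * fourier w \<xi>))"
      unfolding eq integral_mult_right_zero
      by (subst Bochner_Integration.integral_diff,
          intro Bochner_Integration.integrable_add s(1), intro integrable_mult_right s(1),
          subst Bochner_Integration.integral_add, rule s(1), rule s(1))
         (simp only: integral_mult_right_zero s(2))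
    also have "\<dots> = complex_of_real (levy_kernel \<alpha> z) * ((cis (z * \<xi>) + cis (- (z * \<xi>)) - 2) * fourier w \<xi>)"
      by (simp add: algebra_simps)
    also have "cis (z * \<xi>) + cis (- (z * \<xi>)) - 2 = complex_of_real (2 * cos (z * \<xi>) - 2)"
      by (simp add: complex_eq_iff)
    finally show ?thesis by (simp add: mult_ac)
  qed
  have "fourier (\<lambda>x. - (C * levy_integral \<alpha> w x)) \<xi> = (\<integral>x. - complex_of_real C * (\<integral>z. f z x \<partial>lborel) \<partial>lborel)"
    unfolding fourier_def
  proof (rule Bochner_Integration.integral_cong[OF refl])
    fix x :: real
    have "(\<integral>z. f z x \<partial>lborel) = cis (- (x * \<xi>)) * complex_of_real (slevy \<alpha> w x)"
      unfolding f_def slevy_def integral_mult_right_zero integral_complex_of_real ..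
    thus "cis (- (x * \<xi>)) * complex_of_real (- (C * levy_integral \<alpha> w x)) = - complex_of_real C * (\<integral>z. f z x \<partial>lborel)"
      by (simp add: levy_integral_eq_slevy[OF W(6) \<alpha>])
  qed
  also have "\<dots> = - complex_of_real C * (\<integral>x. \<integral>z. f z x \<partial>lborel \<partial>lborel)"
    by (rule integral_mult_right_zero)
  also have "(\<integral>x. \<integral>z. f z x \<partial>lborel \<partial>lborel) = (\<integral>z. \<integral>x. f z x \<partial>lborel \<partial>lborel)"
    using lborel_pair.Fubini_integral[OF int_pair] .
  also have "\<dots> = (\<integral>z. complex_of_real ((2 * cos (z * \<xi>) - 2) * levy_kernel \<alpha> z) \<partial>lborel) * fourier w \<xi>"
    unfolding inner by (rule integral_mult_left_zero)
  also have "(\<integral>z. complex_of_real ((2 * cos (z * \<xi>) - 2) * levy_kernel \<alpha> z) \<partial>lborel)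
      = complex_of_real (- 2 * J_int \<alpha> / Gamma (1 + \<alpha>) * \<bar>\<xi>\<bar> powr \<alpha>)"
    unfolding integral_complex_of_real slevy_cos_scaled[OF \<alpha>] ..
  finally show ?thesis by simp
qed

section \<open>The Gaussian and the value of the normalising constant\<close>

lemma power_div_fact_le_exp:
  fixes y :: real
  assumes "0 \<le> y"
  shows "y ^ k / fact k \<le> exp y"
proof -
  have "(\<Sum>n\<in>{k}. y ^ n /\<^sub>R fact n) \<le> (\<Sum>n. y ^ n /\<^sub>R fact n)"
    using assms by (intro sum_le_suminf[OF summable_exp_generic]) auto
  thus ?thesis by (simp add: exp_def divide_inverse mult.commute)
qed

text \<open>The free exponent m lets the induction over p absorb one factor x at each coefficient.
  For monomials a single term of the exponential series bounds x^(2 k) by 2^k k! exp (x^2 / 2), and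
  |x|^k is at most 1 + x^(2 k).\<close>

lemma gaussian_poly_bounded:
  "bounded (range (\<lambda>x::real. x ^ m * poly p x * exp (- x\<^sup>2 / 2)))"
proof (induction p arbitrary: m)
  case (pCons a p)
  have mono: "bounded (range (\<lambda>x::real. x ^ k * exp (- x\<^sup>2 / 2)))" for k
  proof -
    have "\<bar>x ^ k * exp (- x\<^sup>2 / 2)\<bar> \<le> 1 + 2 ^ k * fact k" for x :: real
    proof -
      define P where "P = \<bar>x\<bar> ^ (2 * k)"
      have "(x\<^sup>2 / 2) ^ k / fact k \<le> exp (x\<^sup>2 / 2)"
        by (rule power_div_fact_le_exp) simp
      moreover have "(x\<^sup>2 / 2) ^ k = P / 2 ^ k"
        unfolding P_def power_mult power_divide by simp
      ultimately have "P / 2 ^ k / fact k \<le> exp (x\<^sup>2 / 2)" by simp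
      hence "P \<le> 2 ^ k * fact k * exp (x\<^sup>2 / 2)"
        by (simp add: field_simps)
      moreover have "\<bar>x\<bar> ^ k \<le> 1 + P"
      proof (cases "\<bar>x\<bar> \<le> 1")
        case True
        hence "\<bar>x\<bar> ^ k \<le> 1" by (simp add: power_le_one)
        moreover have "0 \<le> P" by (simp add: P_def)
        ultimately show ?thesis by linarith
      next
        case False
        hence "\<bar>x\<bar> ^ k \<le> \<bar>x\<bar> ^ (2 * k)" by (intro power_increasing) auto
        thus ?thesis by (simp add: P_def)
      qed
      moreover have "1 \<le> exp (x\<^sup>2 / 2)" by simp
      ultimately have "\<bar>x\<bar> ^ k \<le> (1 + 2 ^ k * fact k) * exp (x\<^sup>2 / 2)"
        unfolding distrib_right mult_1 by linarith
      hence "\<bar>x\<bar> ^ k * exp (- x\<^sup>2 / 2) \<le> (1 + 2 ^ k * fact k) * exp (x\<^sup>2 / 2) * exp (- x\<^sup>2 / 2)"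
        by (intro mult_right_mono) auto
      thus ?thesis by (simp add: abs_mult power_abs mult.assoc exp_add[symmetric])
    qed
    thus ?thesis unfolding bounded_iff by auto
  qed
  have "bounded (range (\<lambda>x. a * (x ^ m * exp (- x\<^sup>2 / 2)) + x ^ Suc m * poly p x * exp (- x\<^sup>2 / 2)))"
  proof -
    obtain B1 B2 where "\<And>x::real. \<bar>x ^ m * exp (- x\<^sup>2 / 2)\<bar> \<le> B1" "\<And>x. \<bar>x ^ Suc m * poly p x * exp (- x\<^sup>2 / 2)\<bar> \<le> B2"
      using mono[of m] pCons.IH[of "Suc m"] unfolding bounded_iff real_norm_def by blast
    hence "\<bar>a * (x ^ m * exp (- x\<^sup>2 / 2)) + x ^ Suc m * poly p x * exp (- x\<^sup>2 / 2)\<bar> \<le> \<bar>a\<bar> * B1 + B2" for x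
      by (intro order_trans[OF abs_triangle_ineq] add_mono) (auto simp only: abs_mult intro!: mult_left_mono)
    thus ?thesis unfolding bounded_iff by auto
  qed
  thus ?case by (simp add: algebra_simps)
qed simp

text \<open>Differentiation sends the polynomial factor p to p' - X p. The Gaussian is the test
  function that singles out the normalising constant.\<close>

lemma schwartz_gaussian: "schwartz (\<lambda>x. exp (- x\<^sup>2 / 2))"
proof -
  have der: "((\<lambda>x. poly p x * exp (- x\<^sup>2 / 2)) has_real_derivative poly (pderiv p - [:0, 1:] * p) x * exp (- x\<^sup>2 / 2)) (at x)" for p x
    by (auto intro!: derivative_eq_intros poly_DERIV simp: algebra_simps)
  have ex: "\<exists>p. (deriv ^^ n) (\<lambda>x::real. exp (- x\<^sup>2 / 2)) = (\<lambda>x. poly p x * exp (- x\<^sup>2 / 2))" for n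
  proof (induction n)
    case 0
    show ?case by (rule exI[of _ 1]) simp
  next
    case (Suc n)
    then obtain p where "(deriv ^^ n) (\<lambda>x::real. exp (- x\<^sup>2 / 2)) = (\<lambda>x. poly p x * exp (- x\<^sup>2 / 2))" by blast
    hence "(deriv ^^ Suc n) (\<lambda>x::real. exp (- x\<^sup>2 / 2)) = deriv (\<lambda>x. poly p x * exp (- x\<^sup>2 / 2))"
      by simp
    also have "\<dots> = (\<lambda>x. poly (pderiv p - [:0, 1:] * p) x * exp (- x\<^sup>2 / 2))"
      by (intro ext DERIV_imp_deriv der)
    finally show ?case by blast
  qed
  show ?thesis unfolding schwartz_def
  proof (intro conjI allI)
    fix n and x :: real
    obtain p where "(deriv ^^ n) (\<lambda>x::real. exp (- x\<^sup>2 / 2)) = (\<lambda>x. poly p x * exp (- x\<^sup>2 / 2))" using ex by blast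
    note eq = this
    show "(deriv ^^ n) (\<lambda>x::real. exp (- x\<^sup>2 / 2)) differentiable at x"
      unfolding eq real_differentiable_def using der by blast
  next
    fix m n
    obtain p where "(deriv ^^ n) (\<lambda>x::real. exp (- x\<^sup>2 / 2)) = (\<lambda>x. poly p x * exp (- x\<^sup>2 / 2))" using ex by blast
    thus "bounded (range (\<lambda>x. x ^ m * (deriv ^^ n) (\<lambda>x::real. exp (- x\<^sup>2 / 2)) x))"
      using gaussian_poly_bounded[of m p] by (simp add: mult.assoc)
  qed
qed

text \<open>Up to a factor, this is the characteristic function of the standard normal law; the sign
  convention of \<open>fourier\<close> puts it at -1.\<close>

lemma fourier_gaussian_nonzero: "fourier (\<lambda>x. exp (- x\<^sup>2 / 2)) 1 \<noteq> 0"
proof -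
  have "complex_of_real (exp (- ((-1)\<^sup>2) / 2)) = char std_normal_distribution (-1)"
    by (simp add: char_std_normal_distribution)
  also have "\<dots> = (\<integral>x. std_normal_density x *\<^sub>R iexp ((-1) * x) \<partial>lborel)"
    unfolding char_def by (subst integral_density) (auto simp: normal_density_nonneg)
  also have "\<dots> = (\<integral>x. complex_of_real (1 / sqrt (2 * pi)) * (cis (- (x * 1)) * complex_of_real (exp (- x\<^sup>2 / 2))) \<partial>lborel)"
    by (intro Bochner_Integration.integral_cong)
       (auto simp: std_normal_density_def cis_conv_exp scaleR_conv_of_real mult_ac)
  also have "\<dots> = complex_of_real (1 / sqrt (2 * pi)) * fourier (\<lambda>x. exp (- x\<^sup>2 / 2)) 1"
    unfolding fourier_def by (rule integral_mult_right_zero)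
  finally show ?thesis by (auto simp del: of_real_exp)
qed

text \<open>The definite description has to be shown to have exactly one solution. Any candidate C
  satisfies the identity for the Gaussian at frequency 1, where the transform does not vanish, and
  this determines C.\<close>

theorem levy_const_eq:
  assumes \<alpha>: "0 < \<alpha>" "\<alpha> < 2"
  shows "levy_const \<alpha> = Gamma (1 + \<alpha>) / (2 * J_int \<alpha>)"
  unfolding levy_const_def
proof (rule the_equality)
  have G: "Gamma (1 + \<alpha>) > 0" using \<alpha> by (intro Gamma_real_pos) auto
  note J = J_int_pos[OF \<alpha>]
  have one: "Gamma (1 + \<alpha>) / (2 * J_int \<alpha>) * (2 * J_int \<alpha> / Gamma (1 + \<alpha>)) = 1"
    using G J by (simp add: field_simps)
  show "0 < Gamma (1 + \<alpha>) / (2 * J_int \<alpha>) \<and> (\<forall>w. schwartz w \<longrightarrow> (\<forall>\<xi>.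
      fourier (\<lambda>x. - (Gamma (1 + \<alpha>) / (2 * J_int \<alpha>) * levy_integral \<alpha> w x)) \<xi> =
        complex_of_real (\<bar>\<xi>\<bar> powr \<alpha>) * fourier w \<xi>))"
    unfolding fourier_levy_integral[OF _ \<alpha>]
    using G J by (auto simp only: fourier_levy_integral[OF _ \<alpha>] one mult_1 intro!: divide_pos_pos)
next
  fix C
  assume C: "0 < C \<and> (\<forall>w. schwartz w \<longrightarrow> (\<forall>\<xi>. fourier (\<lambda>x. - (C * levy_integral \<alpha> w x)) \<xi> =
     complex_of_real (\<bar>\<xi>\<bar> powr \<alpha>) * fourier w \<xi>))"
  have G: "Gamma (1 + \<alpha>) > 0" using \<alpha> by (intro Gamma_real_pos) auto
  note J = J_int_pos[OF \<alpha>]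
  let ?w = "\<lambda>x::real. exp (- x\<^sup>2 / 2)"
  have "complex_of_real (C * (2 * J_int \<alpha> / Gamma (1 + \<alpha>)) * \<bar>1\<bar> powr \<alpha>) * fourier ?w 1
     = complex_of_real (\<bar>1\<bar> powr \<alpha>) * fourier ?w 1"
    using C schwartz_gaussian unfolding fourier_levy_integral[OF schwartz_gaussian \<alpha>, symmetric] by blast
  hence "complex_of_real (C * (2 * J_int \<alpha> / Gamma (1 + \<alpha>)) * \<bar>1\<bar> powr \<alpha>) = complex_of_real (\<bar>1\<bar> powr \<alpha>)"
    by (metis mult_cancel_right fourier_gaussian_nonzero)
  hence A: "C * (2 * J_int \<alpha> / Gamma (1 + \<alpha>)) = 1"
    by (simp only: of_real_eq_iff) (simp only: abs_one powr_one_eq_one mult_1_right)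
  have "C = C * (2 * J_int \<alpha> / Gamma (1 + \<alpha>)) * (Gamma (1 + \<alpha>) / (2 * J_int \<alpha>))"
    using G J by simp
  thus "C = Gamma (1 + \<alpha>) / (2 * J_int \<alpha>)" unfolding A mult_1 .
qed

lemma levy_const_pos: "0 < \<alpha> \<Longrightarrow> \<alpha> < 2 \<Longrightarrow> 0 < levy_const \<alpha>"
  using J_int_pos[of \<alpha>] by (auto simp: levy_const_eq intro!: divide_pos_pos Gamma_real_pos)

lemma frac_lap_eq_slevy:
  "C2_bounded f \<Longrightarrow> 0 < \<alpha> \<Longrightarrow> \<alpha> < 2 \<Longrightarrow> frac_lap \<alpha> f x = - (levy_const \<alpha> * slevy \<alpha> f x)"
  by (simp add: frac_lap_def levy_integral_eq_slevy)

text \<open>The factor \<open>J_int\<close> cancels, and K Gamma (1 + \<alpha>) = 1 leaves the slope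
  exactly 1.\<close>

lemma levy_const_slevy_profile_U:
  assumes "0 < \<alpha>" "\<alpha> < 2" "\<bar>x\<bar> < 1"
  shows "- (levy_const \<alpha> * slevy \<alpha> (profile_U \<alpha>) x) = x"
proof -
  have "- (levy_const \<alpha> * slevy \<alpha> (profile_U \<alpha>) x) = (K_const \<alpha> * Gamma (1 + \<alpha>)) * x"
    using J_int_pos[OF assms(1,2)] assms
    by (simp add: levy_const_eq slevy_profile_U field_simps)
  thus ?thesis using K_const_Gamma[OF assms(1)] by simp
qed

section \<open>Calculus of test functions\<close>

lemma C2_on_continuous:
  assumes "C2_on S f"
  shows "continuous_on S f"
  using assms unfolding C2_on_def
  by (meson continuous_at_imp_continuous_on has_derivative_continuous)

lemma C2_on_const: "C2_on S (\<lambda>_. c)"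
  unfolding C2_on_def by (rule exI[of _ "\<lambda>_. 0"], rule exI[of _ "\<lambda>_. 0"]) (auto intro!: derivative_eq_intros)

lemma C2_on_linear:
  assumes "bounded_linear L"
  shows "C2_on S L"
  unfolding C2_on_def
  by (rule exI[of _ "\<lambda>_. Blinfun L"], rule exI[of _ "\<lambda>_. 0"])
     (auto simp: bounded_linear_Blinfun_apply[OF assms] zero_blinfun.rep_eq
       intro!: bounded_linear_imp_has_derivative assms derivative_eq_intros)

lemma C2_on_add:
  assumes "C2_on S f" "C2_on S g"
  shows "C2_on S (\<lambda>p. f p + g p)"
proof -
  obtain f' f'' g' g'' where "\<And>p. p \<in> S \<Longrightarrow> (f has_derivative blinfun_apply (f' p)) (at p)"
     "\<And>p. p \<in> S \<Longrightarrow> (f' has_derivative blinfun_apply (f'' p)) (at p)" "continuous_on S f''"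
     "\<And>p. p \<in> S \<Longrightarrow> (g has_derivative blinfun_apply (g' p)) (at p)"
     "\<And>p. p \<in> S \<Longrightarrow> (g' has_derivative blinfun_apply (g'' p)) (at p)" "continuous_on S g''"
    using assms unfolding C2_on_def by metis
  thus ?thesis unfolding C2_on_def
    by (intro exI[of _ "\<lambda>p. f' p + g' p"] exI[of _ "\<lambda>p. f'' p + g'' p"])
       (auto intro!: derivative_eq_intros continuous_intros simp: plus_blinfun.rep_eq)
qed

lemma C2_on_compose:
  fixes f :: "'a::real_normed_vector \<Rightarrow> real"
  assumes f: "C2_on S f"
    and g: "\<And>p. p \<in> S \<Longrightarrow> (g has_real_derivative g' (f p)) (at (f p))"
    and g': "\<And>p. p \<in> S \<Longrightarrow> (g' has_real_derivative g'' (f p)) (at (f p))"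
    and g'': "continuous_on (f ` S) g''"
  shows "C2_on S (\<lambda>p. g (f p))"
proof -
  obtain f' f'' where F: "\<And>p. p \<in> S \<Longrightarrow> (f has_derivative blinfun_apply (f' p)) (at p)"
     "\<And>p. p \<in> S \<Longrightarrow> (f' has_derivative blinfun_apply (f'' p)) (at p)" "continuous_on S f''"
    using f unfolding C2_on_def by metis
  have cf: "continuous_on S f" by (rule C2_on_continuous[OF f])
  have cf': "continuous_on S f'"
    using F(2) by (meson continuous_at_imp_continuous_on has_derivative_continuous)
  have cg': "continuous_on S (\<lambda>p. g' (f p))"
    by (rule continuous_on_compose2[OF _ cf, of "f ` S"])
       (auto intro!: continuous_at_imp_continuous_on DERIV_isCont g')
  have cg'': "continuous_on S (\<lambda>p. g'' (f p))"
    by (rule continuous_on_compose2[OF g'' cf]) auto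
  show ?thesis unfolding C2_on_def
  proof (intro exI conjI ballI)
    fix p assume p: "p \<in> S"
    show "((\<lambda>p. g (f p)) has_derivative blinfun_apply (g' (f p) *\<^sub>R f' p)) (at p)"
      using has_derivative_compose[OF F(1)[OF p] has_field_derivative_imp_has_derivative[OF g[OF p]]]
      by (simp add: scaleR_blinfun.rep_eq[abs_def])
    show "((\<lambda>p. g' (f p) *\<^sub>R f' p) has_derivative
        blinfun_apply (g'' (f p) *\<^sub>R (blinfun_scaleR_left (f' p) o\<^sub>L f' p) + g' (f p) *\<^sub>R f'' p)) (at p)"
      by (rule has_derivative_eq_rhs[OF has_derivative_scaleR[OF
            has_derivative_compose[OF F(1)[OF p] has_field_derivative_imp_has_derivative[OF g'[OF p]]] F(2)[OF p]]])
         (auto simp: fun_eq_iff plus_blinfun.rep_eq scaleR_blinfun.rep_eq)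
  next
    show "continuous_on S (\<lambda>p. g'' (f p) *\<^sub>R (blinfun_scaleR_left (f' p) o\<^sub>L f' p) + g' (f p) *\<^sub>R f'' p)"
      by (intro continuous_on_add continuous_on_scaleR cg' cg'' F(3)
          bounded_bilinear.continuous_on[OF bounded_bilinear_blinfun_compose] cf'
          bounded_linear.continuous_on[OF bounded_linear_blinfun_scaleR_left])
  qed
qed

lemma C2_on_cmult:
  fixes f :: "'a::real_normed_vector \<Rightarrow> real"
  assumes "C2_on S f"
  shows "C2_on S (\<lambda>p. c * f p)"
  by (rule C2_on_compose[OF assms, of "\<lambda>y. c * y" "\<lambda>_. c" "\<lambda>_. 0"])
     (auto intro!: derivative_eq_intros)

text \<open>Polarization, f g = ((f + g)^2 - f^2 - g^2) / 2, reduces products to the chain rule for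
  the square.\<close>

lemma C2_on_mult:
  fixes f g :: "'a::real_normed_vector \<Rightarrow> real"
  assumes "C2_on S f" "C2_on S g"
  shows "C2_on S (\<lambda>p. f p * g p)"
proof -
  have sq: "C2_on S (\<lambda>p. (h p)\<^sup>2)" if "C2_on S h" for h :: "'a \<Rightarrow> real"
    by (rule C2_on_compose[OF that, of "\<lambda>y. y\<^sup>2" "\<lambda>y. 2 * y" "\<lambda>_. 2"])
       (auto intro!: derivative_eq_intros)
  have "C2_on S (\<lambda>p. (1 / 2) * (f p + g p)\<^sup>2 + ((- (1 / 2)) * (f p)\<^sup>2 + (- (1 / 2)) * (g p)\<^sup>2))"
    by (intro C2_on_add C2_on_cmult sq assms)
  also have "(\<lambda>p. (1 / 2) * (f p + g p)\<^sup>2 + ((- (1 / 2)) * (f p)\<^sup>2 + (- (1 / 2)) * (g p)\<^sup>2)) = (\<lambda>p. f p * g p)"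
    by (simp add: fun_eq_iff power2_eq_square field_simps)
  finally show ?thesis .
qed

text \<open>Meant for the reflection (x, t) -> (-x, t) of test functions, where the linear map is
  the inner function.\<close>

lemma C2_on_compose_linear:
  fixes f :: "'a::real_normed_vector \<Rightarrow> real"
  assumes f: "C2_on S f" and L: "bounded_linear L" and S: "L ` S \<subseteq> S"
  shows "C2_on S (\<lambda>p. f (L p))"
proof -
  obtain f' f'' where F: "\<And>p. p \<in> S \<Longrightarrow> (f has_derivative blinfun_apply (f' p)) (at p)"
     "\<And>p. p \<in> S \<Longrightarrow> (f' has_derivative blinfun_apply (f'' p)) (at p)" "continuous_on S f''"
    using f unfolding C2_on_def by metis
  define Lb where "Lb = Blinfun L"
  have Lb: "blinfun_apply Lb = L" by (simp add: Lb_def bounded_linear_Blinfun_apply[OF L])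
  have Ld: "(L has_derivative L) (at p)" for p by (rule bounded_linear_imp_has_derivative[OF L])
  have bl: "bounded_linear (\<lambda>A. A o\<^sub>L Lb)"
    by (rule bounded_bilinear.bounded_linear_left[OF bounded_bilinear_blinfun_compose])
  define R where "R = Blinfun (\<lambda>A::'a \<Rightarrow>\<^sub>L real. A o\<^sub>L Lb)"
  have R: "blinfun_apply R A = A o\<^sub>L Lb" for A by (simp add: R_def bounded_linear_Blinfun_apply[OF bl])
  show ?thesis unfolding C2_on_def
  proof (intro exI conjI ballI)
    fix p assume "p \<in> S"
    hence p: "L p \<in> S" using S by auto
    show "((\<lambda>p. f (L p)) has_derivative blinfun_apply (f' (L p) o\<^sub>L Lb)) (at p)"
      by (rule has_derivative_eq_rhs[OF has_derivative_compose[OF Ld F(1)[OF p]]]) (simp add: fun_eq_iff Lb)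
    show "((\<lambda>p. f' (L p) o\<^sub>L Lb) has_derivative blinfun_apply (R o\<^sub>L f'' (L p) o\<^sub>L Lb)) (at p)"
      by (rule has_derivative_eq_rhs[OF bounded_linear.has_derivative[OF bl has_derivative_compose[OF Ld F(2)[OF p]]]])
         (simp add: fun_eq_iff Lb R)
  next
    have "continuous_on S (\<lambda>p. f'' (L p))"
      by (rule continuous_on_compose2[OF F(3) _ S]) (rule linear_continuous_on[OF L])
    thus "continuous_on S (\<lambda>p. R o\<^sub>L f'' (L p) o\<^sub>L Lb)"
      by (intro bounded_bilinear.continuous_on[OF bounded_bilinear_blinfun_compose] continuous_on_const)
  qed
qed

section \<open>Slices of test functions and the operator on bounded C^2 functions\<close>

lemma C2_on_partial_x:
  assumes "C2_on open_half f" "0 < t"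
  shows "(\<lambda>x. f (x, t)) differentiable (at x)"
proof -
  obtain f' where "(f has_derivative f') (at (x, t))"
    using assms unfolding C2_on_def by fastforce
  moreover have "((\<lambda>x. (x, t)) has_derivative (\<lambda>h. (h, 0))) (at x)"
    by (auto intro!: derivative_eq_intros)
  ultimately have "((\<lambda>x. f (x, t)) has_derivative (\<lambda>h. f' (h, 0))) (at x)"
    using has_derivative_compose[of "\<lambda>x. (x, t)" "\<lambda>h. (h, 0)" x UNIV f f'] by simp
  thus ?thesis by (rule differentiableI)
qed

lemma C2_on_partial_t:
  assumes "C2_on open_half f" "0 < t"
  shows "(\<lambda>t. f (x, t)) differentiable (at t)"
proof -
  obtain f' where "(f has_derivative f') (at (x, t))"
    using assms unfolding C2_on_def by fastforce
  moreover have "((\<lambda>t. (x, t)) has_derivative (\<lambda>h. (0, h))) (at t)"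
    by (auto intro!: derivative_eq_intros)
  ultimately have "((\<lambda>t. f (x, t)) has_derivative (\<lambda>h. f' (0, h))) (at t)"
    using has_derivative_compose[of "\<lambda>t. (x, t)" "\<lambda>h. (0, h)" t UNIV f f'] by simp
  thus ?thesis by (rule differentiableI)
qed

lemma C2_bounded_affine_arg:
  assumes "C2_bounded f"
  shows "C2_bounded (\<lambda>x. a * f (m * x + n) + b)"
proof -
  obtain f' f'' D where f: "\<And>x. (f has_real_derivative f' x) (at x)"
    "\<And>x. (f' has_real_derivative f'' x) (at x)" "continuous_on UNIV f''"
    "\<And>x. \<bar>f x\<bar> \<le> D" "\<And>x. \<bar>f' x\<bar> \<le> D" "\<And>x. \<bar>f'' x\<bar> \<le> D" "0 < D"
    using C2_boundedE[OF assms] by metis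
  show ?thesis
  proof (rule C2_boundedI)
    show "((\<lambda>x. a * f (m * x + n) + b) has_real_derivative a * m * f' (m * x + n)) (at x)" for x
      by (auto intro!: derivative_eq_intros DERIV_chain2[OF f(1)])
    show "((\<lambda>x. a * m * f' (m * x + n)) has_real_derivative a * m\<^sup>2 * f'' (m * x + n)) (at x)" for x
      by (auto intro!: derivative_eq_intros DERIV_chain2[OF f(2)] simp: power2_eq_square)
    show "continuous_on UNIV (\<lambda>x. a * m\<^sup>2 * f'' (m * x + n))"
      by (intro continuous_intros continuous_on_compose2[OF f(3)]) auto
    show "\<bar>a * f (m * x + n) + b\<bar> \<le> \<bar>a\<bar> * D + \<bar>b\<bar>" for x
      by (intro order_trans[OF abs_triangle_ineq] add_mono) (auto simp: abs_mult intro!: mult_left_mono f)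
    show "\<bar>a * m * f' (m * x + n)\<bar> \<le> \<bar>a * m\<bar> * D" for x
      by (auto simp: abs_mult intro!: mult_left_mono f)
    show "\<bar>a * m\<^sup>2 * f'' (m * x + n)\<bar> \<le> \<bar>a * m\<^sup>2\<bar> * D" for x
      unfolding abs_mult[of "a * m\<^sup>2"] by (intro mult_left_mono f) auto
  qed
qed

lemma C2_bounded_add:
  assumes "C2_bounded f" "C2_bounded g"
  shows "C2_bounded (\<lambda>x. f x + g x)"
proof -
  obtain f' f'' D where f: "\<And>x. (f has_real_derivative f' x) (at x)"
    "\<And>x. (f' has_real_derivative f'' x) (at x)" "continuous_on UNIV f''"
    "\<And>x. \<bar>f x\<bar> \<le> D" "\<And>x. \<bar>f' x\<bar> \<le> D" "\<And>x. \<bar>f'' x\<bar> \<le> D" "0 < D"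
    using C2_boundedE[OF assms(1)] by metis
  obtain g' g'' E where g: "\<And>x. (g has_real_derivative g' x) (at x)"
    "\<And>x. (g' has_real_derivative g'' x) (at x)" "continuous_on UNIV g''"
    "\<And>x. \<bar>g x\<bar> \<le> E" "\<And>x. \<bar>g' x\<bar> \<le> E" "\<And>x. \<bar>g'' x\<bar> \<le> E" "0 < E"
    using C2_boundedE[OF assms(2)] by metis
  show ?thesis
    by (rule C2_boundedI[where f' = "\<lambda>x. f' x + g' x" and f'' = "\<lambda>x. f'' x + g'' x"
          and ?D0.0 = "D + E" and ?D1.0 = "D + E" and ?D2.0 = "D + E"])
       (auto intro!: DERIV_add f g continuous_intros order_trans[OF abs_triangle_ineq] add_mono)
qed

lemma C2_bounded_levy:
  assumes "C2_bounded f" "0 < \<alpha>" "\<alpha> < 2"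
  obtains D where "0 < D" "\<And>x. \<bar>frac_lap \<alpha> f x\<bar> \<le> D"
proof -
  obtain c where c: "levy_bound \<alpha> c 2 f" using C2_bounded_levy_bound[OF assms] by blast
  let ?D = "levy_const \<alpha> * (c * (\<integral>z. min (z powr 2) 1 * levy_kernel \<alpha> z \<partial>lborel))"
  have "\<bar>frac_lap \<alpha> f x\<bar> \<le> ?D" for x
    using slevy_bounded[OF c, of x] levy_const_pos[OF assms(2,3)]
    by (simp add: frac_lap_eq_slevy[OF assms] abs_mult)
  hence "\<bar>frac_lap \<alpha> f x\<bar> \<le> max 1 ?D" for x by (simp add: le_max_iff_disj)
  thus ?thesis using that[of "max 1 ?D"] by auto
qed

lemma frac_lap_add:
  assumes "C2_bounded f" "C2_bounded g" "0 < \<alpha>" "\<alpha> < 2"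
  shows "frac_lap \<alpha> (\<lambda>x. f x + g x) x = frac_lap \<alpha> f x + frac_lap \<alpha> g x"
proof -
  obtain c d where "levy_bound \<alpha> c 2 f" "levy_bound \<alpha> d 2 g"
    using C2_bounded_levy_bound assms by meson
  thus ?thesis
    using assms by (simp add: frac_lap_eq_slevy C2_bounded_add slevy_add algebra_simps)
qed

lemma frac_lap_affine_arg:
  assumes "C2_bounded f" "0 < \<alpha>" "\<alpha> < 2" "m \<noteq> 0"
  shows "frac_lap \<alpha> (\<lambda>x. a * f (m * x + n) + b) x = a * (\<bar>m\<bar> powr \<alpha> * frac_lap \<alpha> f (m * x + n))"
  unfolding frac_lap_eq_slevy[OF C2_bounded_affine_arg[OF assms(1)] assms(2,3)]
    frac_lap_eq_slevy[OF assms(1-3)]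
    slevy_affine[of \<alpha> a "\<lambda>x. f (m * x + n)" b x] slevy_scale[OF assms(4)] by simp

section \<open>Comparison with smooth barriers\<close>

text \<open>The test-function clause of \<open>viscosity_subsolution\<close> alone, so that it can
  be stated for u directly; continuity and boundedness are joined to it in
  \<open>subsol\<close>.\<close>

definition test_sub :: "real \<Rightarrow> (real \<times> real \<Rightarrow> real) \<Rightarrow> bool" where
  "test_sub \<alpha> u \<longleftrightarrow> (\<forall>x0 t0 \<tau> \<phi>. 0 < t0 \<longrightarrow> 0 < \<tau> \<longrightarrow> \<tau> < t0 \<longrightarrow>
        C2_on open_half \<phi> \<longrightarrow> bounded (\<phi> ` open_half) \<longrightarrow>
        (\<forall>x. \<forall>t\<in>{t0 - \<tau><..<t0 + \<tau>}. u (x, t) - \<phi> (x, t) \<le> u (x0, t0) - \<phi> (x0, t0)) \<longrightarrow>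
        visc_lhs \<alpha> \<phi> x0 t0 \<le> 0)"

text \<open>The uniform bound D on slope and fractional Laplacian keeps the error caused by a
  penalty small independently of the point. Smoothness and boundedness are asked on the whole open
  half-plane because test functions must have them there; the set \<open>UNIV \<times> {T..}\<close>
  adds the initial line when T is 0.\<close>

definition barrier :: "real \<Rightarrow> real \<Rightarrow> (real \<times> real \<Rightarrow> real) \<Rightarrow> bool" where
  "barrier \<alpha> T \<phi> \<longleftrightarrow> C2_on open_half \<phi> \<and> bounded (\<phi> ` (open_half \<union> UNIV \<times> {T..})) \<and>
     continuous_on (UNIV \<times> {T..}) \<phi> \<and> (\<forall>t>T. C2_bounded (\<lambda>x. \<phi> (x, t))) \<and>
     (\<exists>D. \<forall>x. \<forall>t>T. \<bar>deriv (\<lambda>x. \<phi> (x, t)) x\<bar> \<le> D \<and> \<bar>frac_lap \<alpha> (\<lambda>x. \<phi> (x, t)) x\<bar> \<le> D)"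

text \<open>Bounded, as test functions must be, and at least 1/2 outside the unit interval, so that
  a large multiple of it still pushes a maximum into a compact set.\<close>

definition penalty :: "real \<Rightarrow> real" where
  "penalty y = y\<^sup>2 / (1 + y\<^sup>2)"

lemma penalty_bounds: "0 \<le> penalty y" "penalty y \<le> 1" "penalty 0 = 0" "1 \<le> \<bar>y\<bar> \<Longrightarrow> 1 / 2 \<le> penalty y"
proof -
  have "0 < 1 + y\<^sup>2" by (simp add: add_pos_nonneg)
  thus "0 \<le> penalty y" "penalty y \<le> 1" by (simp_all add: penalty_def)
  show "penalty 0 = 0" by (simp add: penalty_def)
  assume "1 \<le> \<bar>y\<bar>"
  hence "1 \<le> y\<^sup>2" using one_le_power[of "\<bar>y\<bar>" 2] by simp
  thus "1 / 2 \<le> penalty y" by (simp add: penalty_def divide_simps)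
qed

lemma penalty_derivs:
  "(penalty has_real_derivative 2 * y / (1 + y\<^sup>2)\<^sup>2) (at y)"
  "((\<lambda>y. 2 * y / (1 + y\<^sup>2)\<^sup>2) has_real_derivative (2 - 6 * y\<^sup>2) / (1 + y\<^sup>2) ^ 3) (at y)"
  "continuous_on A (\<lambda>y::real. (2 - 6 * y\<^sup>2) / (1 + y\<^sup>2) ^ 3)"
proof -
  have nz: "1 + y\<^sup>2 \<noteq> 0" for y :: real by (simp add: add_nonneg_eq_0_iff)
  show "(penalty has_real_derivative 2 * y / (1 + y\<^sup>2)\<^sup>2) (at y)"
    unfolding penalty_def[abs_def] using nz[of y]
    by (auto intro!: derivative_eq_intros simp: divide_simps power2_eq_square algebra_simps)
  have "((\<lambda>y. 2 * y / (1 + y\<^sup>2)\<^sup>2) has_real_derivative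
     (2 * (1 + y\<^sup>2)\<^sup>2 - 2 * y * (2 * (1 + y\<^sup>2) * (2 * y))) / ((1 + y\<^sup>2)\<^sup>2 * (1 + y\<^sup>2)\<^sup>2)) (at y)"
    using nz[of y] by (auto intro!: derivative_eq_intros)
  also have "(2 * (1 + y\<^sup>2)\<^sup>2 - 2 * y * (2 * (1 + y\<^sup>2) * (2 * y))) / ((1 + y\<^sup>2)\<^sup>2 * (1 + y\<^sup>2)\<^sup>2)
     = (2 - 6 * y\<^sup>2) / (1 + y\<^sup>2) ^ 3"
  proof -
    have "(2 * s\<^sup>2 - 2 * y * (2 * s * (2 * y))) / (s\<^sup>2 * s\<^sup>2) = (2 * s - 8 * y\<^sup>2) / s ^ 3" if "s \<noteq> 0" for s :: real
      using that by (simp add: divide_simps power2_eq_square power3_eq_cube) (simp add: algebra_simps)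
    from this[OF nz] show ?thesis by (simp add: algebra_simps)
  qed
  finally show "((\<lambda>y. 2 * y / (1 + y\<^sup>2)\<^sup>2) has_real_derivative (2 - 6 * y\<^sup>2) / (1 + y\<^sup>2) ^ 3) (at y)" .
  show "continuous_on A (\<lambda>y::real. (2 - 6 * y\<^sup>2) / (1 + y\<^sup>2) ^ 3)"
    using nz by (intro continuous_intros) auto
qed

lemma penalty_deriv_le: "\<bar>2 * y / (1 + y\<^sup>2)\<^sup>2\<bar> \<le> 1" for y :: real
proof -
  have p: "0 < 1 + y\<^sup>2" by (simp add: add_pos_nonneg)
  have "0 \<le> (1 - \<bar>y\<bar>)\<^sup>2" by simp
  hence "2 * \<bar>y\<bar> \<le> 1 + y\<^sup>2" by (simp add: power2_eq_square algebra_simps)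
  also have "\<dots> \<le> (1 + y\<^sup>2)\<^sup>2" by (rule self_le_power) auto
  finally show ?thesis using p by (simp add: abs_mult)
qed

lemma penalty_C2_bounded: "C2_bounded penalty"
proof (rule C2_boundedI[OF penalty_derivs])
  show "\<bar>penalty y\<bar> \<le> 1" for y using penalty_bounds(1,2)[of y] by simp
  show "\<bar>(2 - 6 * y\<^sup>2) / (1 + y\<^sup>2) ^ 3\<bar> \<le> 6" for y :: real
  proof -
    have p: "1 \<le> 1 + y\<^sup>2" by simp
    have "\<bar>2 - 6 * y\<^sup>2\<bar> \<le> 6 * (1 + y\<^sup>2)" by (simp add: abs_le_iff)
    also have "\<dots> \<le> 6 * (1 + y\<^sup>2) ^ 3" using power_increasing[of 1 3 "1 + y\<^sup>2"] by simp
    finally have le: "\<bar>2 - 6 * y\<^sup>2\<bar> \<le> 6 * (1 + y\<^sup>2) ^ 3" .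
    have c: "0 < (1 + y\<^sup>2) ^ 3" using p by (intro zero_less_power) linarith
    have "\<bar>(2 - 6 * y\<^sup>2) / (1 + y\<^sup>2) ^ 3\<bar> = \<bar>2 - 6 * y\<^sup>2\<bar> / (1 + y\<^sup>2) ^ 3"
      unfolding abs_divide using c by simp
    thus ?thesis using le pos_divide_le_eq[OF c] by simp
  qed
qed (rule penalty_deriv_le)

text \<open>The penalty in x disturbs both factors of the product of slope and fractional Laplacian.
  Each of the three cross terms carries a factor \<kappa> or \<kappa>^\<alpha>, while the penalty in
  t contributes a positive time derivative free of \<kappa>.\<close>

lemma visc_lhs_perturb_ge:
  fixes \<kappa> B \<iota> :: real
  assumes \<alpha>: "0 < \<alpha>" "\<alpha> < 2" and T: "0 \<le> T" and \<phi>: "barrier \<alpha> T \<phi>" and t: "T < t"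
    and D: "\<bar>deriv (\<lambda>x. \<phi> (x, t)) x\<bar> \<le> D" "\<bar>frac_lap \<alpha> (\<lambda>x. \<phi> (x, t)) x\<bar> \<le> D"
    and E: "\<bar>frac_lap \<alpha> penalty (\<kappa> * x)\<bar> \<le> E"
    and pos: "0 < \<kappa>" "0 < B" "0 < \<iota>"
  shows "visc_lhs \<alpha> (\<lambda>p. \<phi> p + (B * penalty (\<kappa> * fst p) + B * (1 - 1 / (1 + \<iota> * snd p)))) x t
    \<ge> visc_lhs \<alpha> \<phi> x t + B * \<iota> / (1 + \<iota> * t)\<^sup>2
      - (B * \<kappa> * D + D * (B * \<kappa> powr \<alpha> * E) + B * \<kappa> * (B * \<kappa> powr \<alpha> * E))"
proof -
  have t0: "0 < t" using T t by simp
  have C: "C2_bounded (\<lambda>x. \<phi> (x, t))" and C2: "C2_on open_half \<phi>"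
    using \<phi> t by (auto simp: barrier_def)
  define a where "a = deriv (\<lambda>x. \<phi> (x, t)) x"
  define l where "l = frac_lap \<alpha> (\<lambda>x. \<phi> (x, t)) x"
  define a' where "a' = B * (\<kappa> * (2 * (\<kappa> * x) / (1 + (\<kappa> * x)\<^sup>2)\<^sup>2))"
  define l' where "l' = B * (\<kappa> powr \<alpha> * frac_lap \<alpha> penalty (\<kappa> * x))"
  have nz: "1 + \<iota> * t \<noteq> 0" using pos t0 by (simp add: add_pos_pos less_imp_neq[symmetric])
  have dt: "deriv (\<lambda>t. \<phi> (x, t) + (B * penalty (\<kappa> * x) + B * (1 - 1 / (1 + \<iota> * t)))) t
      = deriv (\<lambda>t. \<phi> (x, t)) t + B * \<iota> / (1 + \<iota> * t)\<^sup>2"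
  proof (rule DERIV_imp_deriv)
    have "((\<lambda>t. \<phi> (x, t)) has_real_derivative deriv (\<lambda>t. \<phi> (x, t)) t) (at t)"
      using C2_on_partial_t[OF C2 t0] by (simp add: DERIV_deriv_iff_real_differentiable)
    moreover have "((\<lambda>t. B * penalty (\<kappa> * x) + B * (1 - 1 / (1 + \<iota> * t))) has_real_derivative B * \<iota> / (1 + \<iota> * t)\<^sup>2) (at t)"
      using nz by (auto intro!: derivative_eq_intros simp: power2_eq_square field_simps)
    ultimately show "((\<lambda>t. \<phi> (x, t) + (B * penalty (\<kappa> * x) + B * (1 - 1 / (1 + \<iota> * t)))) has_real_derivative
       deriv (\<lambda>t. \<phi> (x, t)) t + B * \<iota> / (1 + \<iota> * t)\<^sup>2) (at t)" by (rule DERIV_add)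
  qed
  have dx: "deriv (\<lambda>x. \<phi> (x, t) + (B * penalty (\<kappa> * x) + B * (1 - 1 / (1 + \<iota> * t)))) x = a + a'"
  proof (rule DERIV_imp_deriv)
    have "((\<lambda>x. \<phi> (x, t)) has_real_derivative a) (at x)"
      using C2_on_partial_x[OF C2 t0] by (simp add: a_def DERIV_deriv_iff_real_differentiable)
    moreover have "((\<lambda>x. B * penalty (\<kappa> * x) + B * (1 - 1 / (1 + \<iota> * t))) has_real_derivative a') (at x)"
      unfolding a'_def by (auto intro!: derivative_eq_intros DERIV_chain2[OF penalty_derivs(1)])
    ultimately show "((\<lambda>x. \<phi> (x, t) + (B * penalty (\<kappa> * x) + B * (1 - 1 / (1 + \<iota> * t)))) has_real_derivative a + a') (at x)"
      by (rule DERIV_add)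
  qed
  have fl: "frac_lap \<alpha> (\<lambda>x. \<phi> (x, t) + (B * penalty (\<kappa> * x) + B * (1 - 1 / (1 + \<iota> * t)))) x = l + l'"
  proof -
    have C': "C2_bounded (\<lambda>x. B * penalty (\<kappa> * x) + B * (1 - 1 / (1 + \<iota> * t)))"
      using C2_bounded_affine_arg[OF penalty_C2_bounded, of B \<kappa> 0] by simp
    have "frac_lap \<alpha> (\<lambda>x. B * penalty (\<kappa> * x) + B * (1 - 1 / (1 + \<iota> * t))) x = l'"
      using frac_lap_affine_arg[OF penalty_C2_bounded \<alpha>, of \<kappa> B 0 "B * (1 - 1 / (1 + \<iota> * t))" x] pos
      by (simp add: l'_def)
    thus ?thesis using frac_lap_add[OF C C' \<alpha>, of x] by (simp add: l_def)
  qed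
  have "a' = B * \<kappa> * (2 * (\<kappa> * x) / (1 + (\<kappa> * x)\<^sup>2)\<^sup>2)" by (simp add: a'_def)
  hence "\<bar>a'\<bar> = B * \<kappa> * \<bar>2 * (\<kappa> * x) / (1 + (\<kappa> * x)\<^sup>2)\<^sup>2\<bar>" using pos by (simp add: abs_mult)
  also have "\<dots> \<le> B * \<kappa> * 1" using pos by (intro mult_left_mono penalty_deriv_le) auto
  finally have a'_le: "\<bar>a'\<bar> \<le> B * \<kappa>" by simp
  have l'_le: "\<bar>l'\<bar> \<le> B * \<kappa> powr \<alpha> * E"
    using E pos by (simp add: l'_def abs_mult mult_left_mono)
  have E0: "0 \<le> E" "0 \<le> D" using E D by linarith+
  have 1: "\<bar>a + a'\<bar> * l \<ge> \<bar>a\<bar> * l - \<bar>a'\<bar> * \<bar>l\<bar>"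
  proof -
    have "\<bar>\<bar>a + a'\<bar> - \<bar>a\<bar>\<bar> * \<bar>l\<bar> \<le> \<bar>a'\<bar> * \<bar>l\<bar>" by (intro mult_right_mono) auto
    hence "\<bar>(\<bar>a + a'\<bar> - \<bar>a\<bar>) * l\<bar> \<le> \<bar>a'\<bar> * \<bar>l\<bar>" by (simp add: abs_mult)
    thus ?thesis by (simp add: left_diff_distrib abs_le_iff)
  qed
  have 2: "\<bar>a + a'\<bar> * l' \<ge> - ((\<bar>a\<bar> + \<bar>a'\<bar>) * \<bar>l'\<bar>)"
  proof -
    have "\<bar>\<bar>a + a'\<bar> * l'\<bar> \<le> (\<bar>a\<bar> + \<bar>a'\<bar>) * \<bar>l'\<bar>"
      unfolding abs_mult by (intro mult_right_mono) auto
    thus ?thesis by (simp add: abs_le_iff)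
  qed
  have 3: "\<bar>a'\<bar> * \<bar>l\<bar> \<le> B * \<kappa> * D"
    using a'_le D pos by (intro mult_mono) (auto simp: l_def)
  have 4: "\<bar>a\<bar> * \<bar>l'\<bar> \<le> D * (B * \<kappa> powr \<alpha> * E)"
    using l'_le D E0 by (intro mult_mono) (auto simp: a_def)
  have 5: "\<bar>a'\<bar> * \<bar>l'\<bar> \<le> B * \<kappa> * (B * \<kappa> powr \<alpha> * E)"
    using l'_le a'_le pos by (intro mult_mono) auto
  have "\<bar>a + a'\<bar> * (l + l') \<ge> \<bar>a\<bar> * l - (B * \<kappa> * D + D * (B * \<kappa> powr \<alpha> * E) + B * \<kappa> * (B * \<kappa> powr \<alpha> * E))"
    using 1 2 3 4 5 unfolding distrib_left distrib_right by linarith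
  thus ?thesis
    unfolding visc_lhs_def fst_conv snd_conv dt dx fl a_def[symmetric] l_def[symmetric] by linarith
qed

text \<open>The barrier is itself a test function, so no doubling of variables is needed. The penalty in \<open>x\<close>
  makes the maximum of the difference attained; the one in \<open>t\<close> keeps it away from late times and makes
  the differential inequality strict. Each of the two barriers has to be a supersolution only where it
  is the smaller one.\<close>

theorem comparison:
  assumes \<alpha>: "0 < \<alpha>" "\<alpha> < 2" and u: "test_sub \<alpha> u" "continuous_on closed_half u" "bounded (u ` closed_half)"
    and T: "0 \<le> T" and \<phi>: "barrier \<alpha> T \<phi>" and \<psi>: "barrier \<alpha> T \<psi>"
    and super_\<phi>: "\<And>x t. T < t \<Longrightarrow> \<phi> (x, t) \<le> \<psi> (x, t) \<Longrightarrow> 0 \<le> visc_lhs \<alpha> \<phi> x t"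
    and super_\<psi>: "\<And>x t. T < t \<Longrightarrow> \<psi> (x, t) \<le> \<phi> (x, t) \<Longrightarrow> 0 \<le> visc_lhs \<alpha> \<psi> x t"
    and init: "\<And>x. u (x, T) \<le> min (\<phi> (x, T)) (\<psi> (x, T))"
    and t1: "T \<le> t1"
  shows "u (x1, t1) \<le> min (\<phi> (x1, t1)) (\<psi> (x1, t1))"
proof (rule ccontr)
  assume neg: "\<not> u (x1, t1) \<le> min (\<phi> (x1, t1)) (\<psi> (x1, t1))"
  define m where "m p = min (\<phi> p) (\<psi> p)" for p
  define gap where "gap = u (x1, t1) - m (x1, t1)"
  have gap: "0 < gap" using neg unfolding gap_def m_def by linarith
  obtain D1 where D1: "\<And>x t. T < t \<Longrightarrow> \<bar>deriv (\<lambda>x. \<phi> (x, t)) x\<bar> \<le> D1 \<and> \<bar>frac_lap \<alpha> (\<lambda>x. \<phi> (x, t)) x\<bar> \<le> D1"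
    using \<phi> unfolding barrier_def by blast
  obtain D2 where D2: "\<And>x t. T < t \<Longrightarrow> \<bar>deriv (\<lambda>x. \<psi> (x, t)) x\<bar> \<le> D2 \<and> \<bar>frac_lap \<alpha> (\<lambda>x. \<psi> (x, t)) x\<bar> \<le> D2"
    using \<psi> unfolding barrier_def by blast
  define D where "D = max D1 D2"
  obtain E where E: "0 < E" "\<And>x. \<bar>frac_lap \<alpha> penalty x\<bar> \<le> E"
    using C2_bounded_levy[OF penalty_C2_bounded \<alpha>] by blast
  obtain B0 B1 B2 where B012: "\<forall>p\<in>closed_half. \<bar>u p\<bar> \<le> B0" "\<forall>p\<in>open_half \<union> UNIV \<times> {T..}. \<bar>\<phi> p\<bar> \<le> B1"
     "\<forall>p\<in>open_half \<union> UNIV \<times> {T..}. \<bar>\<psi> p\<bar> \<le> B2"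
    using u(3) \<phi> \<psi> unfolding barrier_def bounded_iff by force
  \<comment> \<open>Doubled because the penalties reach only B / 2 where they are to win: at
    |\<kappa> x| = 1 and at \<iota> t = 1.\<close>
  define B where "B = 2 * (\<bar>B0\<bar> + \<bar>B1\<bar> + \<bar>B2\<bar> + 1)"
  have B: "0 < B" by (simp add: B_def)
  have um: "u (x, t) - m (x, t) < B / 2" if "T \<le> t" for x t
    using B012(1)[rule_format, of "(x, t)"] B012(2)[rule_format, of "(x, t)"] B012(3)[rule_format, of "(x, t)"] that T
    by (auto simp: B_def m_def min_def)
  \<comment> \<open>Chosen so that the penalty in t costs at most a quarter of the gap at the
    violating point; t1 + 1 stays positive even for t1 = 0.\<close>
  define \<iota> where "\<iota> = min 1 (gap / (4 * B * (t1 + 1)))"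
  have \<iota>: "0 < \<iota>" using gap B t1 T by (simp add: \<iota>_def)
  have mt: "0 \<le> B * (1 - 1 / (1 + \<iota> * t))" "B * (1 - 1 / (1 + \<iota> * t)) \<le> B * (\<iota> * t)" "B * (1 - 1 / (1 + \<iota> * t)) \<le> B" if "0 \<le> t" for t
  proof -
    have p: "0 < 1 + \<iota> * t" using \<iota> that by (simp add: add_pos_nonneg)
    have "1 / (1 + \<iota> * t) \<le> 1" using \<iota> that p by simp
    thus "0 \<le> B * (1 - 1 / (1 + \<iota> * t))" using B by simp
    have "1 - 1 / (1 + \<iota> * t) = \<iota> * t / (1 + \<iota> * t)" using p by (simp add: field_simps)
    also have "\<dots> \<le> \<iota> * t / 1" using \<iota> that p by (intro divide_left_mono) auto
    finally show "B * (1 - 1 / (1 + \<iota> * t)) \<le> B * (\<iota> * t)" using B by simp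
    show "B * (1 - 1 / (1 + \<iota> * t)) \<le> B" using B p by simp
  qed
  have mt1: "B * (1 - 1 / (1 + \<iota> * t1)) \<le> gap / 4"
  proof -
    have "\<iota> * t1 \<le> gap / (4 * B * (t1 + 1)) * (t1 + 1)"
      using t1 T gap B by (intro mult_mono) (auto simp: \<iota>_def)
    also have "\<dots> = gap / (4 * B)" using t1 T B by simp
    finally have "B * (\<iota> * t1) \<le> gap / 4" using B by (simp add: field_simps)
    thus ?thesis using mt(2)[of t1] t1 T by linarith
  qed
  \<comment> \<open>The cross terms of \<open>visc_lhs_perturb_ge\<close>. The parameter \<kappa> is
    fixed after \<iota>, since these terms must be smaller than B \<iota> / 4.\<close>
  define err where "err \<kappa> = B * \<kappa> * D + D * (B * \<kappa> powr \<alpha> * E) + B * \<kappa> * (B * \<kappa> powr \<alpha> * E)" for \<kappa>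
  have pw0: "((\<lambda>\<kappa>. \<kappa> powr \<alpha>) \<longlongrightarrow> 0) (at_right 0)"
  proof -
    have "((\<lambda>\<kappa>. \<kappa> powr \<alpha>) \<longlongrightarrow> 0 powr \<alpha>) (at_right 0)"
      using \<alpha> by (intro tendsto_powr') (auto simp: eventually_at_filter intro!: tendsto_intros)
    thus ?thesis using \<alpha> by simp
  qed
  have id0: "((\<lambda>\<kappa>::real. \<kappa>) \<longlongrightarrow> 0) (at_right 0)" by (intro tendsto_intros)
  have "(err \<longlongrightarrow> B * 0 * D + D * (B * 0 * E) + B * 0 * (B * 0 * E)) (at_right 0)"
    unfolding err_def by (intro tendsto_add tendsto_mult tendsto_const pw0 id0)
  hence "(err \<longlongrightarrow> 0) (at_right 0)" by simp
  hence ev1: "eventually (\<lambda>\<kappa>. err \<kappa> < B * \<iota> / 4) (at_right 0)"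
    by (rule order_tendstoD) (use B \<iota> in simp)
  have "isCont penalty 0" using penalty_derivs(1) by (rule DERIV_isCont)
  moreover have "((\<lambda>\<kappa>. \<kappa> * x1) \<longlongrightarrow> 0) (at_right 0)" by (rule tendsto_mult_left_zero[OF id0])
  ultimately have "((\<lambda>\<kappa>. penalty (\<kappa> * x1)) \<longlongrightarrow> penalty 0) (at_right 0)" by (rule isCont_tendsto_compose)
  hence "((\<lambda>\<kappa>. B * penalty (\<kappa> * x1)) \<longlongrightarrow> B * penalty 0) (at_right 0)" by (rule tendsto_mult_left)
  hence ev2: "eventually (\<lambda>\<kappa>. B * penalty (\<kappa> * x1) < gap / 4) (at_right 0)"
    by (rule order_tendstoD) (use gap in \<open>simp add: penalty_bounds\<close>)
  have "eventually (\<lambda>\<kappa>::real. 0 < \<kappa>) (at_right 0)" by (simp add: eventually_at_filter)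
  with ev1 ev2 have "eventually (\<lambda>\<kappa>. err \<kappa> < B * \<iota> / 4 \<and> B * penalty (\<kappa> * x1) < gap / 4 \<and> 0 < \<kappa>) (at_right 0)"
    by eventually_elim simp
  then obtain \<kappa> where \<kappa>: "err \<kappa> < B * \<iota> / 4" "B * penalty (\<kappa> * x1) < gap / 4" "0 < \<kappa>"
    using eventually_happens'[OF trivial_limit_at_right_real] by blast
  define q where "q p = B * penalty (\<kappa> * fst p) + B * (1 - 1 / (1 + \<iota> * snd p))" for p :: "real \<times> real"
  define G where "G p = u p - m p - q p" for p
  have q_nonneg: "0 \<le> q (x, t)" if "0 \<le> t" for x t
    using mt(1)[OF that] B penalty_bounds(1)[of "\<kappa> * x"] by (simp add: q_def)
  have G1: "gap / 2 < G (x1, t1)"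
    using \<kappa>(2) mt1 gap by (simp add: G_def q_def gap_def)
  have far_x: "G (x, t) < 0" if "T \<le> t" "1 / \<kappa> \<le> \<bar>x\<bar>" for x t
  proof -
    have "1 \<le> \<bar>\<kappa> * x\<bar>" using that \<kappa>(3) by (simp add: abs_mult field_simps)
    hence "B * (1 / 2) \<le> B * penalty (\<kappa> * x)" using B penalty_bounds(4) by (intro mult_left_mono) auto
    thus ?thesis using um[OF that(1), of x] mt(1)[of t] that T by (simp add: G_def q_def)
  qed
  have far_t: "G (x, t) < 0" if "T \<le> t" "1 / \<iota> \<le> t" for x t
  proof -
    have p: "1 \<le> \<iota> * t" using that \<iota> by (simp add: field_simps)
    hence "1 / (1 + \<iota> * t) \<le> 1 / 2" by (simp add: field_simps)
    hence "B * (1 / 2) \<le> B * (1 - 1 / (1 + \<iota> * t))" using B by (intro mult_left_mono) auto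
    moreover have "0 \<le> B * penalty (\<kappa> * x)" using B penalty_bounds(1)[of "\<kappa> * x"] by simp
    ultimately show ?thesis using um[OF that(1), of x] unfolding G_def q_def fst_conv snd_conv by linarith
  qed
  define Q where "Q = {- (1 / \<kappa>)..1 / \<kappa>} \<times> {T..1 / \<iota>}"
  have inQ: "(x, t) \<in> Q" if "T \<le> t" "0 \<le> G (x, t)" for x t
    using far_x[OF that(1), of x] far_t[OF that(1), of x] that by (force simp: Q_def abs_le_iff)
  have "compact Q" unfolding Q_def by (intro compact_Times compact_Icc)
  have "continuous_on Q G"
  proof -
    have "continuous_on Q u" by (rule continuous_on_subset[OF u(2)]) (use T in \<open>auto simp: Q_def\<close>)
    moreover have "continuous_on Q m" unfolding m_def
      using \<phi> \<psi> by (intro continuous_on_min) (auto simp: barrier_def Q_def intro: continuous_on_subset)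
    moreover have "continuous_on Q q"
    proof -
      have "1 + \<iota> * snd p \<noteq> 0" if "p \<in> Q" for p
        using that \<iota> T by (auto simp: Q_def add_nonneg_eq_0_iff)
      hence c1: "continuous_on Q (\<lambda>p. B * (1 - 1 / (1 + \<iota> * snd p)))"
        by (intro continuous_intros) auto
      have "continuous_on UNIV penalty"
        using penalty_derivs(1) by (meson DERIV_isCont continuous_at_imp_continuous_on)
      hence c2: "continuous_on Q (\<lambda>p. penalty (\<kappa> * fst p))"
        by (rule continuous_on_compose2) (auto intro!: continuous_intros)
      show ?thesis unfolding q_def
        by (rule continuous_on_add[OF continuous_on_mult_left[OF c2] c1])
    qed
    ultimately show ?thesis unfolding G_def by (intro continuous_intros)
  qed
  moreover have "(x1, t1) \<in> Q" using G1 gap by (intro inQ t1) auto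
  ultimately obtain p0 where p0: "p0 \<in> Q" "\<And>p. p \<in> Q \<Longrightarrow> G p \<le> G p0"
    using continuous_attains_sup[OF \<open>compact Q\<close>] by blast
  obtain x0 t0 where p0_eq: "p0 = (x0, t0)" by (cases p0)
  have G0: "0 < G (x0, t0)" using p0(2)[OF \<open>(x1, t1) \<in> Q\<close>] G1 gap by (simp add: p0_eq)
  have maxG: "G (x, t) \<le> G (x0, t0)" if "T \<le> t" for x t
    using p0(2)[of "(x, t)"] inQ[OF that, of x] G0 unfolding p0_eq by (cases "0 \<le> G (x, t)") auto
  have t0: "T \<le> t0" "t0 \<le> 1 / \<iota>" using p0(1) by (auto simp: p0_eq Q_def)
  have "t0 \<noteq> T"
  proof
    assume "t0 = T"
    hence "G (x0, t0) \<le> 0" using init[of x0] q_nonneg[of T x0] T unfolding G_def m_def by simp linarith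
    thus False using G0 by simp
  qed
  hence t0T: "T < t0" using t0 by simp
  \<comment> \<open>Here \<theta> is whichever barrier attains the minimum at the maximum point. It
    lies above the minimum everywhere and agrees with it there, so u - \<theta> - q attains its
    maximum at the same point.\<close>
  have key: "False" if b: "barrier \<alpha> T \<theta>" and le: "\<And>x t. m (x, t) \<le> \<theta> (x, t)"
    and eq: "m (x0, t0) = \<theta> (x0, t0)" and super: "0 \<le> visc_lhs \<alpha> \<theta> x0 t0"
    and d: "\<bar>deriv (\<lambda>x. \<theta> (x, t0)) x0\<bar> \<le> D" "\<bar>frac_lap \<alpha> (\<lambda>x. \<theta> (x, t0)) x0\<bar> \<le> D" for \<theta>
  proof -
    have C2: "C2_on open_half (\<lambda>p. \<theta> p + q p)"
    proof -
      have "C2_on open_half (\<lambda>p::real \<times> real. \<kappa> * fst p)"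
        by (intro C2_on_cmult C2_on_linear bounded_linear_fst)
      hence 1: "C2_on open_half (\<lambda>p::real \<times> real. B * penalty (\<kappa> * fst p))"
        by (intro C2_on_cmult[OF C2_on_compose[where g = penalty and g' = "\<lambda>y. 2 * y / (1 + y\<^sup>2)\<^sup>2"
              and g'' = "\<lambda>y. (2 - 6 * y\<^sup>2) / (1 + y\<^sup>2) ^ 3"]] penalty_derivs)
      have 2: "C2_on open_half (\<lambda>p::real \<times> real. B * (1 - 1 / (1 + \<iota> * snd p)))"
      proof (intro C2_on_cmult C2_on_compose[where g = "\<lambda>t. 1 - 1 / (1 + \<iota> * t)"])
        show "C2_on open_half (snd :: real \<times> real \<Rightarrow> real)"
          by (rule C2_on_linear[OF bounded_linear_snd])
        have nz: "1 + \<iota> * snd p \<noteq> 0" if "p \<in> open_half" for p :: "real \<times> real"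
          using that \<iota> by (auto simp: add_nonneg_eq_0_iff)
        show "((\<lambda>t. 1 - 1 / (1 + \<iota> * t)) has_real_derivative \<iota> / (1 + \<iota> * snd p)\<^sup>2) (at (snd p))"
          if "p \<in> open_half" for p :: "real \<times> real"
          using nz[OF that] by (auto intro!: derivative_eq_intros simp: power2_eq_square field_simps)
        show "((\<lambda>t. \<iota> / (1 + \<iota> * t)\<^sup>2) has_real_derivative - 2 * \<iota>\<^sup>2 / (1 + \<iota> * snd p) ^ 3) (at (snd p))"
          if "p \<in> open_half" for p :: "real \<times> real"
          using nz[OF that]
          by (auto intro!: derivative_eq_intros simp: power2_eq_square power3_eq_cube divide_simps)
        show "continuous_on (snd ` open_half) (\<lambda>t. - 2 * \<iota>\<^sup>2 / (1 + \<iota> * t) ^ 3)"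
          using nz by (intro continuous_intros) auto
      qed
      show ?thesis using b unfolding q_def barrier_def by (intro C2_on_add 1 2) auto
    qed
    have bdd: "bounded ((\<lambda>p. \<theta> p + q p) ` open_half)"
    proof -
      obtain b where bb: "\<forall>p\<in>open_half \<union> UNIV \<times> {T..}. \<bar>\<theta> p\<bar> \<le> b"
        using b unfolding barrier_def bounded_iff by force
      have "\<bar>\<theta> p + q p\<bar> \<le> b + (B + B)" if "p \<in> open_half" for p
      proof -
        obtain x t where p: "p = (x, t)" "0 < t" using \<open>p \<in> open_half\<close> by auto
        have "\<bar>q p\<bar> \<le> B + B"
        proof -
          have "0 \<le> B * penalty (\<kappa> * x)" "B * penalty (\<kappa> * x) \<le> B * 1"
            using B penalty_bounds(1,2)[of "\<kappa> * x"] by (auto intro: mult_left_mono)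
          thus ?thesis using mt(1,3)[of t] p(2) unfolding q_def p(1) fst_conv snd_conv by linarith
        qed
        thus ?thesis using bb that by (intro order_trans[OF abs_triangle_ineq] add_mono) auto
      qed
      thus ?thesis unfolding bounded_iff by (intro exI[of _ "b + (B + B)"]) auto
    qed
    \<comment> \<open>The radius (t0 - T) / 2 keeps the time window above T, where the maximum of G
      is known to be global.\<close>
    have touch: "\<forall>x. \<forall>t\<in>{t0 - (t0 - T) / 2<..<t0 + (t0 - T) / 2}.
        u (x, t) - (\<theta> (x, t) + q (x, t)) \<le> u (x0, t0) - (\<theta> (x0, t0) + q (x0, t0))"
    proof (intro allI ballI)
      fix x t assume "t \<in> {t0 - (t0 - T) / 2<..<t0 + (t0 - T) / 2}"
      hence "T \<le> t" using t0T by (simp add: field_simps)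
      from maxG[OF this, of x] show "u (x, t) - (\<theta> (x, t) + q (x, t)) \<le> u (x0, t0) - (\<theta> (x0, t0) + q (x0, t0))"
        using le[of x t] eq by (simp add: G_def)
    qed
    have "visc_lhs \<alpha> (\<lambda>p. \<theta> p + q p) x0 t0 \<le> 0"
      using u(1)[unfolded test_sub_def, rule_format, of t0 "(t0 - T) / 2" "\<lambda>p. \<theta> p + q p" x0] C2 bdd touch t0T T
      by auto
    moreover have "visc_lhs \<alpha> (\<lambda>p. \<theta> p + q p) x0 t0 \<ge> visc_lhs \<alpha> \<theta> x0 t0 + B * \<iota> / (1 + \<iota> * t0)\<^sup>2 - err \<kappa>"
      unfolding q_def err_def by (rule visc_lhs_perturb_ge[OF \<alpha> T b t0T d E(2) \<kappa>(3) B \<iota>])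
    \<comment> \<open>The maximum point satisfies t0 \<le> 1 / \<iota>, so the denominator is at
      most 4.\<close>
    moreover have "B * \<iota> / 4 \<le> B * \<iota> / (1 + \<iota> * t0)\<^sup>2"
    proof -
      have "\<iota> * t0 \<le> 1" using t0 \<iota> by (simp add: field_simps)
      moreover have "0 \<le> \<iota> * t0" using t0 T \<iota> by simp
      ultimately have "(1 + \<iota> * t0)\<^sup>2 \<le> 2\<^sup>2" by (intro power_mono) auto
      thus ?thesis using B \<iota> \<open>0 \<le> \<iota> * t0\<close> by (intro divide_left_mono) (auto simp: add_pos_nonneg)
    qed
    ultimately show False using super \<kappa>(1) by linarith
  qed
  show False
  proof (cases "\<phi> (x0, t0) \<le> \<psi> (x0, t0)")
    case True
    show False
      by (rule key[OF \<phi>]) (use True D1[OF t0T, of x0] super_\<phi>[OF t0T True] in \<open>auto simp: m_def D_def le_max_iff_disj\<close>)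
  next
    case False
    hence F: "\<psi> (x0, t0) \<le> \<phi> (x0, t0)" by simp
    show False
      by (rule key[OF \<psi>]) (use F D2[OF t0T, of x0] super_\<psi>[OF t0T F] in \<open>auto simp: m_def D_def le_max_iff_disj\<close>)
  qed
qed

section \<open>Barriers with a moving profile\<close>

text \<open>Regularity is asked at positive times, which admits powers of t that are singular at
  0.\<close>

definition C2_time :: "(real \<Rightarrow> real) \<Rightarrow> bool" where
  "C2_time h \<longleftrightarrow> (\<exists>h' h''. (\<forall>t>0. (h has_real_derivative h' t) (at t)) \<and>
     (\<forall>t>0. (h' has_real_derivative h'' t) (at t)) \<and> continuous_on {0<..} h'')"

text \<open>The common form of all barriers: base level c, height h, inverse width m, and n the
  displacement measured in the profile variable.\<close>

definition moving_profile ::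
  "real \<Rightarrow> (real \<Rightarrow> real) \<Rightarrow> (real \<Rightarrow> real) \<Rightarrow> (real \<Rightarrow> real) \<Rightarrow> (real \<Rightarrow> real) \<Rightarrow> real \<times> real \<Rightarrow> real" where
  "moving_profile c h f m n p = c + h (snd p) * f (m (snd p) * fst p + n (snd p))"

lemma C2_time_const: "C2_time (\<lambda>_. c)"
  unfolding C2_time_def by (intro exI[of _ "\<lambda>_. 0"]) auto

lemma C2_time_linear: "C2_time (\<lambda>t. a + b * t)"
  unfolding C2_time_def
  by (intro exI[of _ "\<lambda>_. b"] exI[of _ "\<lambda>_. 0"]) (auto intro!: derivative_eq_intros)

lemma C2_time_powr:
  assumes "0 \<le> b" "0 < d"
  shows "C2_time (\<lambda>t. a * (b + d * t) powr q)"
  unfolding C2_time_def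
proof (intro exI conjI allI impI)
  fix t :: real assume "0 < t"
  hence p: "0 < b + d * t" using assms by (simp add: add_nonneg_pos)
  show "((\<lambda>t. a * (b + d * t) powr q) has_real_derivative (a * q * d) * (b + d * t) powr (q - 1)) (at t)"
    using p by (auto intro!: derivative_eq_intros)
  show "((\<lambda>t. (a * q * d) * (b + d * t) powr (q - 1)) has_real_derivative
     (a * q * d * (q - 1) * d) * (b + d * t) powr (q - 1 - 1)) (at t)"
    using p by (auto intro!: derivative_eq_intros)
next
  have "b + d * t > 0" if "t \<in> {0<..}" for t using that assms by (simp add: add_nonneg_pos)
  hence "\<forall>t\<in>{0<..}. b + d * t \<noteq> 0" by fastforce
  thus "continuous_on {0<..} (\<lambda>t. (a * q * d * (q - 1) * d) * (b + d * t) powr (q - 1 - 1))"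
    by (intro continuous_on_mult continuous_on_const continuous_on_powr continuous_on_add continuous_on_id)
qed

lemma C2_on_time:
  assumes "C2_time h"
  shows "C2_on open_half (\<lambda>p. h (snd p))"
proof -
  obtain h' h'' where h: "\<And>t. 0 < t \<Longrightarrow> (h has_real_derivative h' t) (at t)"
     "\<And>t. 0 < t \<Longrightarrow> (h' has_real_derivative h'' t) (at t)" "continuous_on {0<..} h''"
    using assms unfolding C2_time_def by blast
  show ?thesis
    by (rule C2_on_compose[OF C2_on_linear[OF bounded_linear_snd], of _ h h' h''])
       (auto intro!: h(1,2) continuous_on_subset[OF h(3)])
qed

text \<open>The height is bounded at all times because the barrier itself must be, the inverse width
  only after T, where slope bounds are required; for the self-similar barrier it is t^(-1/(\<alpha>
  + 1)), unbounded near 0.\<close>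

lemma barrier_moving_profile:
  assumes \<alpha>: "0 < \<alpha>" "\<alpha> < 2" and f: "C2_bounded f"
    and C2: "C2_time h" "C2_time m" "C2_time n"
    and cont: "continuous_on {T..} h" "continuous_on {T..} m" "continuous_on {T..} n" and T: "0 \<le> T"
    and m0: "\<And>t. T < t \<Longrightarrow> m t \<noteq> 0" and mb: "\<And>t. T < t \<Longrightarrow> \<bar>m t\<bar> \<le> Mb"
    and hb: "\<And>t. 0 < t \<or> T \<le> t \<Longrightarrow> \<bar>h t\<bar> \<le> H"
  shows "barrier \<alpha> T (moving_profile c h f m n)"
proof -
  obtain f' f'' D where F: "\<And>x. (f has_real_derivative f' x) (at x)"
    "\<And>x. (f' has_real_derivative f'' x) (at x)" "continuous_on UNIV f''"
    "\<And>x. \<bar>f x\<bar> \<le> D" "\<And>x. \<bar>f' x\<bar> \<le> D" "0 < D"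
    using C2_boundedE[OF f] by metis
  obtain E where E: "0 < E" "\<And>x. \<bar>frac_lap \<alpha> f x\<bar> \<le> E" using C2_bounded_levy[OF f \<alpha>] by blast
  have H0: "0 \<le> H" using hb[of 1] by simp
  have "C2_on open_half (\<lambda>p::real \<times> real. m (snd p) * fst p + n (snd p))"
    by (intro C2_on_add C2_on_mult C2_on_time C2 C2_on_linear bounded_linear_fst)
  hence "C2_on open_half (\<lambda>p::real \<times> real. f (m (snd p) * fst p + n (snd p)))"
    by (rule C2_on_compose) (auto intro: F(1,2) continuous_on_subset[OF F(3)])
  hence 1: "C2_on open_half (moving_profile c h f m n)"
    unfolding moving_profile_def[abs_def] by (intro C2_on_add C2_on_const C2_on_mult C2_on_time C2)
  have "\<bar>moving_profile c h f m n p\<bar> \<le> \<bar>c\<bar> + H * D" if "p \<in> open_half \<union> UNIV \<times> {T..}" for p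
    unfolding moving_profile_def using that H0
    by (intro order_trans[OF abs_triangle_ineq] add_mono) (auto simp: abs_mult intro!: mult_mono hb F)
  hence 2: "bounded (moving_profile c h f m n ` (open_half \<union> UNIV \<times> {T..}))"
    unfolding bounded_iff by (intro exI[of _ "\<bar>c\<bar> + H * D"]) auto
  have cs: "continuous_on (UNIV \<times> {T..}) (\<lambda>p::real \<times> real. g (snd p))" if "continuous_on {T..} g" for g :: "real \<Rightarrow> real"
    by (rule continuous_on_compose2[OF that]) (auto intro!: continuous_intros)
  have "continuous_on (UNIV \<times> {T..}) (\<lambda>p::real \<times> real. m (snd p) * fst p + n (snd p))"
    by (intro continuous_on_add continuous_on_mult cs cont continuous_on_fst continuous_on_id)
  moreover have "continuous_on UNIV f"
    using F(1) by (meson DERIV_isCont continuous_at_imp_continuous_on)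
  ultimately have "continuous_on (UNIV \<times> {T..}) (\<lambda>p::real \<times> real. f (m (snd p) * fst p + n (snd p)))"
    using continuous_on_compose2[of UNIV f] by blast
  hence 3: "continuous_on (UNIV \<times> {T..}) (moving_profile c h f m n)"
    unfolding moving_profile_def[abs_def] by (intro continuous_on_add continuous_on_mult continuous_on_const cs cont)
  have slice: "(\<lambda>x. moving_profile c h f m n (x, t)) = (\<lambda>x. h t * f (m t * x + n t) + c)" for t
    by (simp add: moving_profile_def fun_eq_iff)
  have 4: "C2_bounded (\<lambda>x. moving_profile c h f m n (x, t))" for t
    unfolding slice by (rule C2_bounded_affine_arg[OF f])
  have Mb0: "0 \<le> Mb" using mb[of "T + 1"] by simp
  have 5: "\<bar>deriv (\<lambda>x. moving_profile c h f m n (x, t)) x\<bar> \<le> H * (Mb * D) + H * (Mb powr \<alpha> * E) \<and>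
     \<bar>frac_lap \<alpha> (\<lambda>x. moving_profile c h f m n (x, t)) x\<bar> \<le> H * (Mb * D) + H * (Mb powr \<alpha> * E)" if t: "T < t" for x t
  proof -
    have "deriv (\<lambda>x. h t * f (m t * x + n t) + c) x = h t * (m t * f' (m t * x + n t))"
      by (rule DERIV_imp_deriv) (auto intro!: derivative_eq_intros DERIV_chain2[OF F(1)])
    moreover have "\<bar>h t * (m t * f' (m t * x + n t))\<bar> \<le> H * (Mb * D)"
      unfolding abs_mult using t H0 Mb0 by (intro mult_mono mb hb F) auto
    moreover have "\<bar>h t * (\<bar>m t\<bar> powr \<alpha> * frac_lap \<alpha> f (m t * x + n t))\<bar> \<le> H * (Mb powr \<alpha> * E)"
      unfolding abs_mult using t H0 Mb0 \<alpha> by (intro mult_mono hb E) (auto intro!: powr_mono2 mb)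
    moreover have "0 \<le> H * (Mb * D)" "0 \<le> H * (Mb powr \<alpha> * E)" using H0 Mb0 F E by auto
    ultimately show ?thesis unfolding slice frac_lap_affine_arg[OF f \<alpha> m0[OF t]] by linarith
  qed
  show ?thesis unfolding barrier_def using 1 2 3 4 5 by blast
qed

lemma visc_lhs_moving_profile:
  fixes x t :: real
  assumes \<alpha>: "0 < \<alpha>" "\<alpha> < 2" and f: "C2_bounded f" "\<And>x. (f has_real_derivative f' x) (at x)"
    and d: "(h has_real_derivative h') (at t)" "(m has_real_derivative m') (at t)" "(n has_real_derivative n') (at t)"
    and m0: "m t \<noteq> 0"
  defines "Y \<equiv> m t * x + n t"
  shows "visc_lhs \<alpha> (moving_profile c h f m n) x t =
    h' * f Y + h t * (f' Y * (m' * x + n')) + \<bar>h t * (f' Y * m t)\<bar> * (h t * (\<bar>m t\<bar> powr \<alpha> * frac_lap \<alpha> f Y))"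
proof -
  have "((\<lambda>t. m t * x + n t) has_real_derivative m' * x + n') (at t)"
    using d by (auto intro!: derivative_eq_intros)
  from DERIV_chain2[OF f(2) this]
  have "((\<lambda>t. c + h t * f (m t * x + n t)) has_real_derivative h' * f Y + h t * (f' Y * (m' * x + n'))) (at t)"
    unfolding Y_def using d by (auto intro!: derivative_eq_intros)
  hence 1: "deriv (\<lambda>t. moving_profile c h f m n (x, t)) t = h' * f Y + h t * (f' Y * (m' * x + n'))"
    unfolding moving_profile_def fst_conv snd_conv by (rule DERIV_imp_deriv)
  have slice: "(\<lambda>x. moving_profile c h f m n (x, t)) = (\<lambda>x. h t * f (m t * x + n t) + c)"
    by (simp add: moving_profile_def fun_eq_iff)
  have 2: "deriv (\<lambda>x. h t * f (m t * x + n t) + c) x = h t * (f' Y * m t)"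
    unfolding Y_def by (rule DERIV_imp_deriv) (auto intro!: derivative_eq_intros DERIV_chain2[OF f(2)])
  show ?thesis
    unfolding visc_lhs_def 1 slice 2 frac_lap_affine_arg[OF f(1) \<alpha> m0] Y_def ..
qed

definition subsol :: "real \<Rightarrow> (real \<times> real \<Rightarrow> real) \<Rightarrow> bool" where
  "subsol \<alpha> u \<longleftrightarrow> test_sub \<alpha> u \<and> continuous_on closed_half u \<and> bounded (u ` closed_half)"

lemma comparison_single:
  assumes "0 < \<alpha>" "\<alpha> < 2" "subsol \<alpha> u" "0 \<le> T" "barrier \<alpha> T \<phi>"
    "\<And>x t. T < t \<Longrightarrow> 0 \<le> visc_lhs \<alpha> \<phi> x t" "\<And>x. u (x, T) \<le> \<phi> (x, T)" "T \<le> t"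
  shows "u (x, t) \<le> \<phi> (x, t)"
  using comparison[of \<alpha> u T \<phi> \<phi> t x] assms by (simp add: subsol_def)

subsection \<open>Spreading\<close>

text \<open>Rises from 0 to 2 and is at least 1 on the right half-line, so that B times it dominates
  a jump of height B at the origin.\<close>

definition step_profile :: "real \<Rightarrow> real" where
  "step_profile x = 1 + 2 / pi * arctan x"

lemma step_profile_deriv: "(step_profile has_real_derivative 2 / pi * (1 / (1 + x\<^sup>2))) (at x)"
  unfolding step_profile_def[abs_def]
  by (auto intro!: derivative_eq_intros simp: inverse_eq_divide)

lemma step_profile_bounds: "0 \<le> step_profile x" "step_profile x \<le> 2" "0 \<le> x \<Longrightarrow> 1 \<le> step_profile x"
proof -
  have "2 / pi * arctan x \<le> 2 / pi * (pi / 2)"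
    using arctan_ubound[of x] by (intro mult_left_mono) auto
  thus "step_profile x \<le> 2" by (simp add: step_profile_def)
  have "2 / pi * (- (pi / 2)) \<le> 2 / pi * arctan x"
    using arctan_lbound[of x] by (intro mult_left_mono) auto
  thus "0 \<le> step_profile x" by (simp add: step_profile_def)
  show "1 \<le> step_profile x" if "0 \<le> x" using that by (simp add: step_profile_def)
qed

lemma step_profile_at_bot: "(step_profile \<longlongrightarrow> 0) at_bot"
proof -
  have "((\<lambda>x. 1 + 2 / pi * arctan x) \<longlongrightarrow> 1 + 2 / pi * (- (pi / 2))) at_bot"
    by (intro tendsto_intros tendsto_arctan_at_bot)
  thus ?thesis by (simp add: step_profile_def[abs_def])
qed

lemma step_profile_C2_bounded: "C2_bounded step_profile"
proof (rule C2_boundedI[OF step_profile_deriv])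
  have nz: "1 + x\<^sup>2 \<noteq> 0" for x :: real by (simp add: add_nonneg_eq_0_iff)
  show "((\<lambda>x. 2 / pi * (1 / (1 + x\<^sup>2))) has_real_derivative 2 / pi * (- (2 * x / (1 + x\<^sup>2)\<^sup>2))) (at x)" for x
    using nz[of x] by (auto intro!: derivative_eq_intros simp: power2_eq_square)
  have "continuous_on UNIV (\<lambda>x::real. 2 * x / (1 + x\<^sup>2)\<^sup>2)"
    using nz by (intro continuous_intros) auto
  thus "continuous_on UNIV (\<lambda>x. 2 / pi * (- (2 * x / (1 + x\<^sup>2)\<^sup>2)))" by (intro continuous_on_mult_left continuous_on_minus)
  show "\<bar>step_profile x\<bar> \<le> 2" for x using step_profile_bounds(1,2)[of x] by simp
  show "\<bar>2 / pi * (1 / (1 + x\<^sup>2))\<bar> \<le> 2 / pi * 1" for x :: real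
    unfolding abs_mult using nz[of x] by (intro mult_mono) (auto simp: add_pos_nonneg)
  show "\<bar>2 / pi * (- (2 * x / (1 + x\<^sup>2)\<^sup>2))\<bar> \<le> 2 / pi * 1" for x :: real
    unfolding abs_mult abs_minus_cancel using penalty_deriv_le[of x] by (intro mult_mono) auto
qed

text \<open>A bound c that holds initially on one side survives far out on that side: the
  disturbance from the other side advances at a finite speed \<kappa>, up to the algebraic tail of
  the step. The sign \<sigma> selects the side.\<close>

lemma subsol_spread:
  assumes \<alpha>: "0 < \<alpha>" "\<alpha> < 2" and u: "subsol \<alpha> u" and \<sigma>: "\<sigma> = 1 \<or> \<sigma> = -1" and B: "0 \<le> B"
    and init: "\<And>x. u (x, 0) \<le> c + B" "\<And>x. \<sigma> * x < - R \<Longrightarrow> u (x, 0) \<le> c"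
  obtains \<kappa> where "0 \<le> \<kappa>" "\<And>x t. 0 \<le> t \<Longrightarrow> u (x, t) \<le> c + B * step_profile (\<sigma> * x + (R + \<kappa> * t))"
proof -
  obtain D where D: "0 < D" "\<And>x. \<bar>frac_lap \<alpha> step_profile x\<bar> \<le> D"
    using C2_bounded_levy[OF step_profile_C2_bounded \<alpha>] by blast
  \<comment> \<open>The slope factors out of the whole equation, so the speed only has to outweigh
    the worst value of the fractional Laplacian of B times the step.\<close>
  define \<kappa> where "\<kappa> = B * D"
  let ?\<phi> = "moving_profile c (\<lambda>_. B) step_profile (\<lambda>_. \<sigma>) (\<lambda>t. R + \<kappa> * t)"
  have bar: "barrier \<alpha> 0 ?\<phi>"
    by (rule barrier_moving_profile[OF \<alpha> step_profile_C2_bounded, where H = B and Mb = 1])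
       (use \<sigma> B in \<open>auto intro!: C2_time_const C2_time_linear continuous_intros\<close>)
  have "u (x, t) \<le> ?\<phi> (x, t)" if "0 \<le> t" for x t
  proof (rule comparison_single[OF \<alpha> u order_refl bar _ _ that])
    fix x t :: real assume t: "0 < t"
    define Y where "Y = \<sigma> * x + (R + \<kappa> * t)"
    define g where "g = 2 / pi * (1 / (1 + Y\<^sup>2))"
    have g: "0 \<le> g" by (simp add: g_def add_nonneg_nonneg)
    have "visc_lhs \<alpha> ?\<phi> x t = 0 * step_profile Y + B * (g * (0 * x + \<kappa>)) + \<bar>B * (g * \<sigma>)\<bar> * (B * (\<bar>\<sigma>\<bar> powr \<alpha> * frac_lap \<alpha> step_profile Y))"
      unfolding g_def Y_def using \<sigma>
      by (intro visc_lhs_moving_profile[OF \<alpha> step_profile_C2_bounded step_profile_deriv])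
         (auto intro!: derivative_eq_intros)
    also have "\<dots> = B * g * (\<kappa> + B * frac_lap \<alpha> step_profile Y)"
      using \<sigma> B g by (auto simp: abs_mult algebra_simps)
    also have "\<dots> \<ge> 0"
    proof -
      have "B * - D \<le> B * frac_lap \<alpha> step_profile Y"
        using D(2)[of Y] B by (intro mult_left_mono) (auto simp: abs_le_iff)
      thus ?thesis using B g by (auto simp: \<kappa>_def)
    qed
    finally show "0 \<le> visc_lhs \<alpha> ?\<phi> x t" .
  next
    fix x :: real
    show "u (x, 0) \<le> ?\<phi> (x, 0)"
    proof (cases "\<sigma> * x < - R")
      case True
      thus ?thesis using init(2)[OF True] B step_profile_bounds(1)[of "\<sigma> * x + R"]
        by (simp add: moving_profile_def add_increasing2)
    next
      case False
      hence "1 \<le> step_profile (\<sigma> * x + R)" by (intro step_profile_bounds(3)) simp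
      hence "B * 1 \<le> B * step_profile (\<sigma> * x + R)" using B by (intro mult_left_mono) auto
      thus ?thesis using init(1)[of x] by (simp add: moving_profile_def)
    qed
  qed
  thus ?thesis using that[of \<kappa>] B D by (simp add: moving_profile_def \<kappa>_def)
qed

subsection \<open>Collapse of a bump\<close>

text \<open>The third power is the smallest integer power of the positive part that gives a C^2
  function, and the compact support makes the equation trivial outside.\<close>

definition bump :: "real \<Rightarrow> real" where
  "bump z = (max 0 (1 - z\<^sup>2)) ^ 3"

definition bump' :: "real \<Rightarrow> real" where
  "bump' z = - 6 * z * (max 0 (1 - z\<^sup>2))\<^sup>2"

lemma pos_part_power_deriv:
  fixes y :: real
  shows "((\<lambda>y. (max 0 y) ^ Suc (Suc k)) has_real_derivative real (Suc (Suc k)) * (max 0 y) ^ Suc k) (at y)"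
proof -
  consider "y < 0" | "y > 0" | "y = 0" by linarith
  thus ?thesis
  proof cases
    case 1
    have "((\<lambda>_. 0) has_real_derivative real (Suc (Suc k)) * (max 0 y) ^ Suc k) (at y)"
      using 1 by simp
    thus ?thesis
      by (rule has_field_derivative_transform_within_open[of _ _ _ "{..<0}"]) (use 1 in auto)
  next
    case 2
    have "((\<lambda>y. y ^ Suc (Suc k)) has_real_derivative real (Suc (Suc k)) * (max 0 y) ^ Suc k) (at y)"
      using 2 DERIV_pow[of "Suc (Suc k)" y] by simp
    thus ?thesis
      by (rule has_field_derivative_transform_within_open[of _ _ _ "{0<..}"]) (use 2 in auto)
  next
    case 3
    have "((\<lambda>h::real. ((max 0 (0 + h)) ^ Suc (Suc k) - (max 0 0) ^ Suc (Suc k)) / h) \<longlongrightarrow> 0) (at 0)"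
    proof (rule Lim_null_comparison)
      show "\<forall>\<^sub>F h::real in at 0. norm (((max 0 (0 + h)) ^ Suc (Suc k) - (max 0 0) ^ Suc (Suc k)) / h) \<le> \<bar>h\<bar> ^ Suc k"
      proof (rule always_eventually, rule allI)
        fix h :: real
        show "norm (((max 0 (0 + h)) ^ Suc (Suc k) - (max 0 0) ^ Suc (Suc k)) / h) \<le> \<bar>h\<bar> ^ Suc k"
        proof (cases "0 < h")
          case False
          hence "max 0 (0 + h) = 0" by simp
          hence "norm (((max 0 (0 + h)) ^ Suc (Suc k) - (max 0 0) ^ Suc (Suc k)) / h) = 0" by simp
          also have "0 \<le> \<bar>h\<bar> ^ Suc k" by (intro zero_le_power) simp
          finally show ?thesis .
        qed simp
      qed
      have "((\<lambda>h::real. \<bar>h\<bar> ^ Suc k) \<longlongrightarrow> \<bar>0\<bar> ^ Suc k) (at 0)" by (intro tendsto_intros)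
      thus "((\<lambda>h::real. \<bar>h\<bar> ^ Suc k) \<longlongrightarrow> 0) (at 0)" by simp
    qed
    thus ?thesis using 3 by (simp add: DERIV_def)
  qed
qed

lemma bump_deriv: "(bump has_real_derivative bump' z) (at z)"
proof -
  have "((\<lambda>y. (max 0 y) ^ 3) has_real_derivative 3 * (max 0 y)\<^sup>2) (at y)" for y :: real
    using pos_part_power_deriv[of 1 y] by (simp add: numeral_3_eq_3 numeral_2_eq_2)
  moreover have "((\<lambda>z. 1 - z\<^sup>2) has_real_derivative - 2 * z) (at z)"
    by (auto intro!: derivative_eq_intros)
  ultimately have "((\<lambda>z. (max 0 (1 - z\<^sup>2)) ^ 3) has_real_derivative 3 * (max 0 (1 - z\<^sup>2))\<^sup>2 * (- 2 * z)) (at z)"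
    by (rule DERIV_chain2)
  moreover have "3 * (max 0 (1 - z\<^sup>2))\<^sup>2 * (- 2 * z) = bump' z" by (simp add: bump'_def)
  ultimately show ?thesis by (simp only: bump_def[abs_def])
qed

lemma bump_C2_bounded: "C2_bounded bump"
proof -
  have d: "((\<lambda>y. (max 0 y)\<^sup>2) has_real_derivative 2 * max 0 y) (at y)" for y :: real
    using pos_part_power_deriv[of 0 y] by (simp add: numeral_2_eq_2)
  have le1: "max 0 (1 - z\<^sup>2) \<le> 1" for z :: real by simp
  have z1: "\<bar>z\<bar> \<le> 1" if "max 0 (1 - z\<^sup>2) \<noteq> 0" for z :: real
  proof (rule ccontr)
    assume "\<not> \<bar>z\<bar> \<le> 1"
    hence "1 \<le> z\<^sup>2" using one_le_power[of "\<bar>z\<bar>" 2] by simp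
    thus False using that by simp
  qed
  show ?thesis
  proof (rule C2_boundedI[OF bump_deriv])
    show "(bump' has_real_derivative - 6 * (max 0 (1 - z\<^sup>2))\<^sup>2 + - 6 * z * (2 * max 0 (1 - z\<^sup>2) * (- 2 * z))) (at z)" for z
    proof -
      have 1: "((\<lambda>z. 1 - z\<^sup>2) has_real_derivative - 2 * z) (at z)"
        by (auto intro!: derivative_eq_intros)
      have 2: "((\<lambda>z. - 6 * z) has_real_derivative - 6) (at z)"
        by (auto intro!: derivative_eq_intros)
      show ?thesis unfolding bump'_def[abs_def]
        by (rule DERIV_cong[OF DERIV_mult'[OF 2 DERIV_chain2[OF d 1]]]) simp
    qed
    show "continuous_on UNIV (\<lambda>z::real. - 6 * (max 0 (1 - z\<^sup>2))\<^sup>2 + - 6 * z * (2 * max 0 (1 - z\<^sup>2) * (- 2 * z)))"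
      by (intro continuous_intros)
    show "\<bar>bump z\<bar> \<le> 1" for z
      using power_le_one[of "max 0 (1 - z\<^sup>2)" 3] le1[of z] by (simp add: bump_def)
    show "\<bar>bump' z\<bar> \<le> 6" for z
    proof (cases "max 0 (1 - z\<^sup>2) = 0")
      case False
      have "\<bar>bump' z\<bar> = 6 * \<bar>z\<bar> * (max 0 (1 - z\<^sup>2))\<^sup>2" by (simp add: bump'_def abs_mult)
      also have "\<dots> \<le> 6 * 1 * 1\<^sup>2" using z1[OF False] le1[of z] by (intro mult_mono power_mono) auto
      finally show ?thesis by simp
    qed (simp add: bump'_def)
    show "\<bar>- 6 * (max 0 (1 - z\<^sup>2))\<^sup>2 + - 6 * z * (2 * max 0 (1 - z\<^sup>2) * (- 2 * z))\<bar> \<le> 6 + 24" for z :: real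
    proof (cases "max 0 (1 - z\<^sup>2) = 0")
      case False
      have "(max 0 (1 - z\<^sup>2))\<^sup>2 \<le> 1" using power_le_one[of "max 0 (1 - z\<^sup>2)" 2] le1[of z] by simp
      moreover have "- 6 * z * (2 * max 0 (1 - z\<^sup>2) * (- 2 * z)) = 24 * (z\<^sup>2 * max 0 (1 - z\<^sup>2))"
        by (simp add: power2_eq_square)
      moreover have "z\<^sup>2 * max 0 (1 - z\<^sup>2) \<le> 1 * 1"
        using z1[OF False] le1[of z] by (intro mult_mono) (auto simp: abs_square_le_1)
      moreover have "0 \<le> z\<^sup>2 * max 0 (1 - z\<^sup>2)" by simp
      moreover have "0 \<le> (max 0 (1 - z\<^sup>2))\<^sup>2" by simp
      ultimately show ?thesis unfolding abs_le_iff by linarith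
    qed simp
  qed
qed

lemma bump_bounds: "0 \<le> bump z" "bump z \<le> 1"
  using power_le_one[of "max 0 (1 - z\<^sup>2)" 3] by (simp_all add: bump_def)

lemma bump_outside: "1 \<le> \<bar>z\<bar> \<Longrightarrow> bump z = 0" "1 \<le> \<bar>z\<bar> \<Longrightarrow> bump' z = 0"
  using one_le_power[of "\<bar>z\<bar>" 2] by (auto simp: bump_def bump'_def)

lemma bump_strict_anti: "\<bar>y\<bar> < \<bar>z\<bar> \<Longrightarrow> \<bar>y\<bar> < 1 \<Longrightarrow> bump z < bump y"
proof -
  assume a: "\<bar>y\<bar> < \<bar>z\<bar>" "\<bar>y\<bar> < 1"
  have "y\<^sup>2 < z\<^sup>2" "y\<^sup>2 < 1"
    using a power_strict_mono[of "\<bar>y\<bar>" "\<bar>z\<bar>" 2] by (auto simp: abs_square_less_1)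
  thus ?thesis unfolding bump_def by (intro power_strict_mono) auto
qed

text \<open>Away from the top the slope dominates the height, because the third power of a number in
  [0, 1] is at most its square. This is how a decrease in height is paid for by slope terms.\<close>

lemma bump'_ge: "0 \<le> s \<Longrightarrow> s \<le> z \<Longrightarrow> 6 * s * bump z \<le> - bump' z"
proof -
  assume s: "0 \<le> s" "s \<le> z"
  define w where "w = max 0 (1 - z\<^sup>2)"
  have w: "0 \<le> w" "w \<le> 1" by (auto simp: w_def)
  have "6 * s * w ^ 3 \<le> 6 * z * w\<^sup>2"
    using s w power_decreasing[of 2 3 w] by (intro mult_mono) auto
  thus ?thesis by (simp add: bump_def bump'_def w_def)
qed

text \<open>The origin is a global maximum, so all second differences there are nonpositive, and
  they equal -2 for z between 1 and 2.\<close>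

lemma frac_lap_bump_pos:
  assumes "0 < \<alpha>" "\<alpha> < 2"
  shows "0 < frac_lap \<alpha> bump 0"
proof -
  obtain c where c: "levy_bound \<alpha> c 2 bump" using C2_bounded_levy_bound[OF bump_C2_bounded assms] by blast
  note i = slevy_integrable[OF c, of 0]
  have le: "second_diff bump 0 z * levy_kernel \<alpha> z \<le> 0" for z
    using bump_bounds(2)[of z] bump_bounds(2)[of "-z"] levy_kernel_nonneg[of \<alpha> z]
    by (intro mult_nonpos_nonneg) (auto simp: second_diff_def bump_def)
  have "0 \<le> (\<integral>z. - (second_diff bump 0 z * levy_kernel \<alpha> z) \<partial>lborel)"
    by (intro integral_nonneg_AE AE_I2) (use le in simp)
  hence "slevy \<alpha> bump 0 \<le> 0" by (simp add: slevy_def)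
  moreover have "slevy \<alpha> bump 0 \<noteq> 0"
  proof
    assume "slevy \<alpha> bump 0 = 0"
    hence "(\<integral>z. - (second_diff bump 0 z * levy_kernel \<alpha> z) \<partial>lborel) = 0" by (simp add: slevy_def)
    hence "AE z in lborel. - (second_diff bump 0 z * levy_kernel \<alpha> z) = 0"
      using i le by (subst (asm) integral_nonneg_eq_0_iff_AE) auto
    hence "AE z in lborel. z \<notin> {1<..<(2::real)}"
      by eventually_elim (auto simp: second_diff_def bump_outside levy_kernel_def bump_def)
    hence "emeasure lborel {1<..<(2::real)} = 0"
      by (subst (asm) AE_iff_measurable[where N="{1<..<(2::real)}"]) auto
    thus False by simp
  qed
  ultimately have "slevy \<alpha> bump 0 < 0" by linarith
  thus ?thesis using levy_const_pos[OF assms]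
    by (simp add: frac_lap_eq_slevy[OF bump_C2_bounded assms] mult_pos_neg)
qed

lemma frac_lap_continuous:
  assumes "C2_bounded f" "0 < \<alpha>" "\<alpha> < 2"
  shows "continuous_on UNIV (frac_lap \<alpha> f)"
proof -
  obtain c where c: "levy_bound \<alpha> c 2 f" using C2_bounded_levy_bound[OF assms] by blast
  have "frac_lap \<alpha> f = (\<lambda>x. - (levy_const \<alpha> * slevy \<alpha> f x))"
    by (simp add: fun_eq_iff frac_lap_eq_slevy[OF assms])
  thus ?thesis using slevy_continuous[OF c] by (auto intro!: continuous_intros)
qed

text \<open>A smooth supersolution cannot decrease at its maximum. The minimum of two shifted bumps has a
  concave kink at the origin instead, and each bump only has to be a supersolution on the
  side where its slope is bounded away from zero. Height and width follow the power laws for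
  which all terms of the equation scale like the inverse of time.\<close>

lemma subsol_collapse:
  assumes \<alpha>: "0 < \<alpha>" "\<alpha> < 2" and u: "subsol \<alpha> u" and B: "0 < B" and R: "0 < R" and \<epsilon>: "0 < \<epsilon>"
    and init: "\<And>x. u (x, 0) \<le> c + B" "\<And>x. R \<le> \<bar>x\<bar> \<Longrightarrow> u (x, 0) \<le> c"
  obtains T where "0 < T" "\<And>x. u (x, T) \<le> c + \<epsilon>"
proof -
  let ?L = "frac_lap \<alpha> bump"
  have "isCont ?L 0"
    using frac_lap_continuous[OF bump_C2_bounded \<alpha>] by (simp add: continuous_on_eq_continuous_at)
  hence "(?L \<longlongrightarrow> ?L 0) (nhds 0)" by (simp add: isCont_def tendsto_at_iff_tendsto_nhds)
  moreover have "?L 0 / 2 < ?L 0" using frac_lap_bump_pos[OF \<alpha>] by simp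
  ultimately have "eventually (\<lambda>z. ?L 0 / 2 < ?L z) (nhds 0)"
    by (rule order_tendstoD(1))
  then obtain d where d: "0 < d" "\<And>z. \<bar>z\<bar> < d \<Longrightarrow> ?L 0 / 2 < ?L z"
    by (auto simp: eventually_nhds_metric dist_real_def)
  \<comment> \<open>Near its top the bump has fractional Laplacian at least k; s keeps [0, 2 s]
    within that neighbourhood, and s \<le> 1/4 serves the initial comparison.\<close>
  define k s where "k = ?L 0 / 2" and "s = min (1 / 4) (d / 4)"
  have k: "0 < k" using frac_lap_bump_pos[OF \<alpha>] by (simp add: k_def)
  have s: "0 < s" "s \<le> 1 / 4" using d by (auto simp: s_def)
  have Lk: "k \<le> ?L z" if "0 \<le> z" "z \<le> 2 * s" for z
    using d(2)[of z] d(1) that by (auto simp: k_def s_def min_def split: if_splits)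
  obtain D where D: "0 < D" "\<And>z. \<bar>?L z\<bar> \<le> D" using C2_bounded_levy[OF bump_C2_bounded \<alpha>] by blast
  \<comment> \<open>Farther out than 2 s the widening yields at least s/6 times the slope. N makes
    the fractional Laplacian cost at most s/12 of it and leaves s/12 for the loss of height.\<close>
  define N where "N = s / (12 * D)"
  have N: "0 < N" "N * D = s / 12" using s D by (auto simp: N_def)
  \<comment> \<open>The rate of decay in height: at most 6 s N k for the region near the top, at
    most s^2 / 2 for the outer region, and at most 1/2 so that a is at least 1/6. The relation e + a
    (1 + \<alpha>) = 1 then fixes the rate of widening.\<close>
  define e where "e = min (1 / 2) (min (6 * s * N * k) (s\<^sup>2 / 2))"
  have e: "0 < e" "e \<le> 1 / 2" "e \<le> 6 * s * N * k" "e \<le> s\<^sup>2 / 2" using s N k by (auto simp: e_def)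
  define a where "a = (1 - e) / (1 + \<alpha>)"
  have a: "1 / 6 \<le> a" using e \<alpha> by (simp add: a_def field_simps)
  \<comment> \<open>The equation divided by its common factor. Near the top the positive fractional
    Laplacian pays for the loss of height; beyond 2 s the widening does.\<close>
  have bracket: "0 \<le> - e * bump Y + a * (Y - s) * - bump' Y + N * - bump' Y * ?L Y" if Y: "s \<le> Y" for Y
  proof -
    define g where "g = - bump' Y"
    have g: "6 * s * bump Y \<le> g" using bump'_ge[of s Y] s Y by (simp add: g_def)
    have b0: "0 \<le> bump Y" by (rule bump_bounds)
    have g0: "0 \<le> g" using g b0 s by (smt (verit) mult_nonneg_nonneg)
    show ?thesis
    proof (cases "Y \<le> 2 * s")
      case True
      have "e * bump Y \<le> 6 * s * N * k * bump Y" using e b0 by (intro mult_right_mono) auto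
      also have "\<dots> = N * (6 * s * bump Y) * k" by simp
      also have "\<dots> \<le> N * g * ?L Y"
      proof -
        have "0 \<le> 6 * s * bump Y" using s b0 by simp
        thus ?thesis using g g0 N(1) k Lk[of Y] True Y s(1) by (intro mult_mono) auto
      qed
      finally have "e * bump Y \<le> N * g * ?L Y" .
      moreover have "0 \<le> a * (Y - s) * g" using a Y g0 by auto
      ultimately show ?thesis by (simp add: g_def)
    next
      case False
      have "e * bump Y \<le> s\<^sup>2 / 2 * bump Y" using e b0 by (intro mult_right_mono) auto
      also have "\<dots> = s / 12 * (6 * s * bump Y)" by (simp add: power2_eq_square)
      also have "\<dots> \<le> s / 12 * g" using g s by (intro mult_left_mono) auto
      finally have 1: "e * bump Y \<le> s / 12 * g" .
      have "1 / 6 * s \<le> a * (Y - s)" using a False s by (intro mult_mono) auto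
      hence 2: "s / 6 * g \<le> a * (Y - s) * g" using g0 by (intro mult_right_mono) auto
      have "N * g * - D \<le> N * g * ?L Y"
        using D(2)[of Y] N g0 by (intro mult_left_mono) (auto simp: abs_le_iff)
      moreover have "N * g * - D = - (s / 12 * g)"
      proof -
        have "N * g * - D = - ((N * D) * g)" by simp
        thus ?thesis unfolding N(2) .
      qed
      ultimately show ?thesis unfolding g_def[symmetric] using 1 2 by linarith
    qed
  qed
  \<comment> \<open>With width R / s, points of the initial bump region have profile variable within
    s of s, hence at most 1/2 in absolute value. There the bump is at least (3/4)^3, so height 4 B
    covers B.\<close>
  define r0 h0 where "r0 = R / s" and "h0 = 4 * B"
  have r0: "0 < r0" and h0: "0 < h0" using R s B by (auto simp: r0_def h0_def)
  \<comment> \<open>The time unit for which the coefficient of the nonlocal term comes out as N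
    relative to the other terms; see \<open>hm\<close> below.\<close>
  define t0 where "t0 = N * r0 powr (1 + \<alpha>) / h0"
  have t0: "0 < t0" using N r0 h0 by (simp add: t0_def)
  define \<theta> where "\<theta> t = 1 + (1 / t0) * t" for t
  have \<theta>: "1 \<le> \<theta> t" if "0 \<le> t" for t using that t0 by (simp add: \<theta>_def)
  define h where "h t = h0 * (1 + (1 / t0) * t) powr (- e)" for t
  define m where "m \<sigma> t = \<sigma> / r0 * (1 + (1 / t0) * t) powr (- a)" for \<sigma> t
  define \<phi> where "\<phi> \<sigma> = moving_profile c h bump (m \<sigma>) (\<lambda>_. s)" for \<sigma>
  have nz: "\<forall>t\<in>{0..}. 1 + (1 / t0) * t \<noteq> 0" using t0 by (auto simp: add_nonneg_eq_0_iff)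
  have bar: "barrier \<alpha> 0 (\<phi> \<sigma>)" if \<sigma>: "\<sigma> = 1 \<or> \<sigma> = -1" for \<sigma>
    unfolding \<phi>_def
  proof (rule barrier_moving_profile[OF \<alpha> bump_C2_bounded, where H = h0 and Mb = "1 / r0"])
    show "C2_time h" unfolding h_def[abs_def] using t0 by (intro C2_time_powr) auto
    show "C2_time (m \<sigma>)" unfolding m_def[abs_def] using t0 by (intro C2_time_powr) auto
    have "continuous_on {0..} (\<lambda>t. (1 + (1 / t0) * t) powr q)" for q
      using nz by (intro continuous_on_powr continuous_on_const continuous_on_add continuous_on_mult continuous_on_id)
    note pc = continuous_on_mult_left[OF this]
    show "continuous_on {0..} h" unfolding h_def[abs_def] by (rule pc)
    show "continuous_on {0..} (m \<sigma>)" unfolding m_def[abs_def] by (rule pc)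
    show "\<bar>h t\<bar> \<le> h0" if "0 < t \<or> 0 \<le> t" for t
    proof -
      have "(1 + (1 / t0) * t) powr (- e) \<le> (1 + (1 / t0) * t) powr 0"
        using \<theta>[of t] that e by (intro powr_mono) (auto simp: \<theta>_def)
      also have "\<dots> \<le> 1" by simp
      finally show ?thesis using h0 by (simp add: h_def abs_mult)
    qed
    show "\<bar>m \<sigma> t\<bar> \<le> 1 / r0" if "0 < t" for t
    proof -
      have "(1 + (1 / t0) * t) powr (- a) \<le> (1 + (1 / t0) * t) powr 0"
        using \<theta>[of t] that a by (intro powr_mono) (auto simp: \<theta>_def)
      also have "\<dots> \<le> 1" by simp
      finally show ?thesis using r0 \<sigma> by (auto simp: m_def abs_mult divide_right_mono)
    qed
    show "m \<sigma> t \<noteq> 0" if "0 < t" for t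
      using nz that \<sigma> r0 by (auto simp: m_def)
  qed (auto intro: C2_time_const)
  have super: "0 \<le> visc_lhs \<alpha> (\<phi> \<sigma>) x t" if \<sigma>: "\<sigma> = 1 \<or> \<sigma> = -1" and t: "0 < t" and le: "\<phi> \<sigma> (x, t) \<le> \<phi> (- \<sigma>) (x, t)" for \<sigma> x t
  proof -
    have \<theta>t: "1 \<le> \<theta> t" using \<theta>[of t] t by simp
    have ht: "h t = h0 * \<theta> t powr (- e)" and mt: "m \<sigma> t = \<sigma> / r0 * \<theta> t powr (- a)"
      by (simp_all add: h_def m_def \<theta>_def)
    have h_pos: "0 < h t" using h0 \<theta>t by (simp add: ht)
    have m0: "m \<sigma> t \<noteq> 0" using \<theta>t \<sigma> r0 by (auto simp: mt)
    define Y where "Y = m \<sigma> t * x + s"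
    have base: "((\<lambda>t. (1 + (1 / t0) * t) powr q) has_real_derivative q * \<theta> t powr (q - 1) * (1 / t0)) (at t)" for q
      using \<theta>t t0 by (auto intro!: derivative_eq_intros simp: \<theta>_def)
    have dh: "(h has_real_derivative - e * h t / (t0 * \<theta> t)) (at t)"
    proof -
      have "(h has_real_derivative h0 * (- e * \<theta> t powr (- e - 1) * (1 / t0))) (at t)"
        unfolding h_def[abs_def] by (rule DERIV_cmult[OF base])
      also have "h0 * (- e * \<theta> t powr (- e - 1) * (1 / t0)) = - e * h t / (t0 * \<theta> t)"
        using \<theta>t t0 by (simp add: ht powr_diff field_simps)
      finally show ?thesis .
    qed
    have dm: "(m \<sigma> has_real_derivative - a * m \<sigma> t / (t0 * \<theta> t)) (at t)"
    proof -
      have "(m \<sigma> has_real_derivative \<sigma> / r0 * (- a * \<theta> t powr (- a - 1) * (1 / t0))) (at t)"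
        unfolding m_def[abs_def] by (rule DERIV_cmult[OF base])
      also have "\<sigma> / r0 * (- a * \<theta> t powr (- a - 1) * (1 / t0)) = - a * m \<sigma> t / (t0 * \<theta> t)"
        using \<theta>t t0 by (simp add: mt powr_diff field_simps)
      finally show ?thesis .
    qed
    have V: "visc_lhs \<alpha> (\<phi> \<sigma>) x t = (- e * h t / (t0 * \<theta> t)) * bump Y + h t * (bump' Y * ((- a * m \<sigma> t / (t0 * \<theta> t)) * x + 0))
       + \<bar>h t * (bump' Y * m \<sigma> t)\<bar> * (h t * (\<bar>m \<sigma> t\<bar> powr \<alpha> * ?L Y))"
      unfolding \<phi>_def Y_def
      by (rule visc_lhs_moving_profile[OF \<alpha> bump_C2_bounded bump_deriv dh dm _ m0]) simp
    show ?thesis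
    proof (cases "1 \<le> \<bar>Y\<bar>")
      case True
      thus ?thesis by (simp add: V bump_outside)
    next
      case False
      \<comment> \<open>The other bump has the argument 2 s - Y. For Y < s this is larger in
        absolute value than Y, so the other barrier would be strictly smaller, against
        \<open>le\<close>.\<close>
      have "s \<le> Y"
      proof (rule ccontr)
        assume "\<not> s \<le> Y"
        hence "m \<sigma> t * x < 0" by (simp add: Y_def)
        hence "\<bar>Y\<bar> < \<bar>m (- \<sigma>) t * x + s\<bar>" using s by (auto simp: Y_def m_def abs_if)
        hence "bump (m (- \<sigma>) t * x + s) < bump Y" using False by (intro bump_strict_anti) auto
        hence "\<phi> (- \<sigma>) (x, t) < \<phi> \<sigma> (x, t)" using h_pos by (simp add: \<phi>_def moving_profile_def Y_def)
        thus False using le by simp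
      qed
      hence g: "0 \<le> - bump' Y" using bump'_ge[of s Y] bump_bounds(1)[of Y] s by (smt (verit) mult_nonneg_nonneg)
      have hm: "h t * (\<bar>m \<sigma> t\<bar> * \<bar>m \<sigma> t\<bar> powr \<alpha>) = N / (t0 * \<theta> t)"
      proof -
        have am: "\<bar>m \<sigma> t\<bar> = \<theta> t powr (- a) / r0" using \<sigma> r0 \<theta>t by (auto simp: mt abs_mult)
        have "\<bar>m \<sigma> t\<bar> * \<bar>m \<sigma> t\<bar> powr \<alpha> = \<bar>m \<sigma> t\<bar> powr (1 + \<alpha>)" using m0 by (simp add: powr_add)
        also have "\<dots> = \<theta> t powr (- a * (1 + \<alpha>)) / r0 powr (1 + \<alpha>)"
          unfolding am using r0 \<theta>t by (simp add: powr_divide powr_powr)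
        also have "- a * (1 + \<alpha>) = e - 1" using \<alpha> by (simp add: a_def field_simps)
        finally have "h t * (\<bar>m \<sigma> t\<bar> * \<bar>m \<sigma> t\<bar> powr \<alpha>) = h0 / r0 powr (1 + \<alpha>) * (\<theta> t powr (- e) * \<theta> t powr (e - 1))"
          by (simp add: ht)
        also have "\<theta> t powr (- e) * \<theta> t powr (e - 1) = \<theta> t powr (- e + (e - 1))"
          by (rule powr_add[symmetric])
        also have "- e + (e - 1) = -1" by simp
        also have "\<theta> t powr -1 = 1 / \<theta> t" using \<theta>t by (simp add: powr_minus_divide)
        also have "h0 / r0 powr (1 + \<alpha>) * (1 / \<theta> t) = N / (t0 * \<theta> t)"
          using h0 r0 N \<theta>t by (simp add: t0_def field_simps)
        finally show ?thesis .
      qed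
      have "visc_lhs \<alpha> (\<phi> \<sigma>) x t = (- e * h t / (t0 * \<theta> t)) * bump Y + h t * (bump' Y * (- a * (Y - s) / (t0 * \<theta> t)))
         + h t * - bump' Y * ?L Y * (h t * (\<bar>m \<sigma> t\<bar> * \<bar>m \<sigma> t\<bar> powr \<alpha>))"
      proof -
        have 1: "\<bar>h t * (bump' Y * m \<sigma> t)\<bar> = h t * (- bump' Y * \<bar>m \<sigma> t\<bar>)"
          using h_pos g by (simp add: abs_mult)
        have 2: "(- a * m \<sigma> t / (t0 * \<theta> t)) * x + 0 = - a * (Y - s) / (t0 * \<theta> t)" by (simp add: Y_def)
        show ?thesis unfolding V 1 2 by (simp only: mult_ac)
      qed
      also have "\<dots> = h t / (t0 * \<theta> t) * (- e * bump Y + a * (Y - s) * - bump' Y + N * - bump' Y * ?L Y)"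
        unfolding hm using t0 \<theta>t by (simp add: field_simps)
      also have "\<dots> \<ge> 0"
        using bracket[OF \<open>s \<le> Y\<close>] h_pos t0 \<theta>t by (intro mult_nonneg_nonneg) auto
      finally show ?thesis .
    qed
  qed
  have init': "u (x, 0) \<le> \<phi> \<sigma> (x, 0)" if \<sigma>: "\<sigma> = 1 \<or> \<sigma> = -1" for \<sigma> x
  proof (cases "R \<le> \<bar>x\<bar>")
    case True
    thus ?thesis using init(2)[OF True] h0 bump_bounds(1)[of "m \<sigma> 0 * x + s"]
      by (simp add: \<phi>_def moving_profile_def h_def add_increasing2)
  next
    case False
    define z where "z = m \<sigma> 0 * x + s"
    have "\<bar>m \<sigma> 0 * x\<bar> = s * (\<bar>x\<bar> / R)" using \<sigma> R s by (auto simp: m_def r0_def abs_mult)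
    also have "\<dots> \<le> s * 1" using False R s by (intro mult_left_mono) auto
    finally have "\<bar>z\<bar> \<le> 1 / 2" using s by (simp add: z_def)
    hence "z\<^sup>2 \<le> (1 / 2)\<^sup>2" using power_mono[of "\<bar>z\<bar>" "1 / 2" 2] by simp
    hence "1 / 2 \<le> max 0 (1 - z\<^sup>2) \<and> 3 / 4 \<le> max 0 (1 - z\<^sup>2)" by (simp add: power2_eq_square)
    hence "(3 / 4) ^ 3 \<le> bump z" unfolding bump_def by (intro power_mono) auto
    hence "1 / 4 \<le> bump z" by (simp add: power3_eq_cube)
    hence "h0 * (1 / 4) \<le> h0 * bump z" using h0 by (intro mult_left_mono) auto
    thus ?thesis using init(1)[of x] by (simp add: \<phi>_def moving_profile_def h_def z_def h0_def)
  qed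
  have cmp: "u (x, t) \<le> min (\<phi> 1 (x, t)) (\<phi> (-1) (x, t))" if "0 \<le> t" for x t
  proof (rule comparison[OF \<alpha> _ _ _ order_refl bar bar _ _ _ that])
    show "test_sub \<alpha> u" "continuous_on closed_half u" "bounded (u ` closed_half)"
      using u by (simp_all add: subsol_def)
    show "0 \<le> visc_lhs \<alpha> (\<phi> 1) x t" if "0 < t" "\<phi> 1 (x, t) \<le> \<phi> (-1) (x, t)" for x t
      using super[of 1 t x] that by simp
    show "0 \<le> visc_lhs \<alpha> (\<phi> (-1)) x t" if "0 < t" "\<phi> (-1) (x, t) \<le> \<phi> 1 (x, t)" for x t
      using super[of "-1" t x] that by simp
    show "u (x, 0) \<le> min (\<phi> 1 (x, 0)) (\<phi> (-1) (x, 0))" for x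
      using init'[of 1 x] init'[of "-1" x] by simp
  qed auto
  have bound: "u (x, t) \<le> c + h t" if "0 \<le> t" for x t
  proof -
    have "0 \<le> h t" using h0 by (simp add: h_def)
    hence "h t * bump (m 1 t * x + s) \<le> h t * 1" using bump_bounds(2) by (intro mult_left_mono)
    thus ?thesis using cmp[OF that, of x] by (simp add: \<phi>_def moving_profile_def)
  qed
  have "((\<lambda>t. h0 * (1 + (1 / t0) * t) powr (- e)) \<longlongrightarrow> h0 * 0) at_top"
  proof (intro tendsto_mult_left tendsto_neg_powr)
    show "filterlim (\<lambda>t. 1 + 1 / t0 * t) at_top at_top"
      using t0 by (intro filterlim_tendsto_add_at_top[OF tendsto_const]
          filterlim_tendsto_pos_mult_at_top[OF tendsto_const] filterlim_ident) auto
  qed (use e in simp)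
  hence "(h \<longlongrightarrow> 0) at_top" by (simp add: h_def[abs_def])
  hence "eventually (\<lambda>t. h t < \<epsilon>) at_top" using \<epsilon> by (rule order_tendstoD(2))
  hence "eventually (\<lambda>t. h t < \<epsilon> \<and> 0 < t) at_top" using eventually_gt_at_top[of 0] by eventually_elim simp
  then obtain T where "h T < \<epsilon>" "0 < T" using eventually_happens'[OF trivial_limit_at_top_linorder] by blast
  thus ?thesis using that[of T] bound[of T] by (meson add_left_mono less_imp_le order_trans)
qed

subsection \<open>Smoothed self-similar profiles\<close>

lemma profile_y_pos: "0 < \<alpha> \<Longrightarrow> 0 < profile_y \<alpha>"
  using profile_M_pos[of \<alpha>] by (simp add: profile_y_def)

lemma profile_y_powr:
  assumes "0 < \<alpha>"
  shows "profile_y \<alpha> powr (\<alpha> + 1) = (\<alpha> + 1) / (2 * profile_M \<alpha>)"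
  using assms profile_M_pos[OF assms] by (simp add: profile_y_def powr_powr)



lemma box_avg_const: "0 < \<delta> \<Longrightarrow> box_avg \<delta> (\<lambda>_. b) x = b"
  using box_avg_affine[of \<delta> 0 b x] by simp

lemma box_avg_U_C2_bounded:
  assumes \<alpha>: "0 < \<alpha>" "\<alpha> < 2" and \<delta>: "0 < \<delta>"
  shows "C2_bounded (box_avg \<delta> (profile_U \<alpha>))"
proof (rule C2_boundedI[OF box_avg_deriv[OF profile_U_continuous[OF \<alpha>(1)] \<delta>]])
  note M = profile_U_abs_le[OF \<alpha>(1)] and C = profile_U_continuous[OF \<alpha>(1)]
  show "((\<lambda>x. (profile_U \<alpha> (x + \<delta>) - profile_U \<alpha> (x - \<delta>)) / (2 * \<delta>)) has_real_derivative
     (profile_v \<alpha> (x + \<delta>) - profile_v \<alpha> (x - \<delta>)) / (2 * \<delta>)) (at x)" for x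
    using \<alpha> \<delta> by (intro DERIV_cdivide DERIV_diff) (auto intro!: derivative_eq_intros)
  show "continuous_on UNIV (\<lambda>x. (profile_v \<alpha> (x + \<delta>) - profile_v \<alpha> (x - \<delta>)) / (2 * \<delta>))"
    using \<delta> by (intro continuous_on_divide continuous_on_diff continuous_on_const
        continuous_on_compose2[OF profile_v_continuous[OF \<alpha>(1), of UNIV]] continuous_on_add continuous_on_id) auto
  show "\<bar>box_avg \<delta> (profile_U \<alpha>) x\<bar> \<le> profile_M \<alpha>" for x
  proof -
    have "box_avg \<delta> (profile_U \<alpha>) x \<le> box_avg \<delta> (\<lambda>_. profile_M \<alpha>) x"
      using M by (intro box_avg_mono C \<delta> continuous_on_const) (auto simp: abs_le_iff)
    moreover have "box_avg \<delta> (\<lambda>_. - profile_M \<alpha>) x \<le> box_avg \<delta> (profile_U \<alpha>) x"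
      using M by (intro box_avg_mono C \<delta> continuous_on_const) (auto simp: abs_le_iff minus_le_iff)
    ultimately show ?thesis by (simp add: box_avg_const[OF \<delta>])
  qed
  show "\<bar>(profile_U \<alpha> (x + \<delta>) - profile_U \<alpha> (x - \<delta>)) / (2 * \<delta>)\<bar> \<le> (profile_M \<alpha> + profile_M \<alpha>) / (2 * \<delta>)" for x
  proof -
    have "\<bar>profile_U \<alpha> (x + \<delta>) - profile_U \<alpha> (x - \<delta>)\<bar> \<le> profile_M \<alpha> + profile_M \<alpha>"
      using M[of "x + \<delta>"] M[of "x - \<delta>"] by linarith
    hence "\<bar>profile_U \<alpha> (x + \<delta>) - profile_U \<alpha> (x - \<delta>)\<bar> / (2 * \<delta>) \<le> (profile_M \<alpha> + profile_M \<alpha>) / (2 * \<delta>)"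
      using \<delta> by (intro divide_right_mono) auto
    thus ?thesis unfolding abs_divide using \<delta> by simp
  qed
  show "\<bar>(profile_v \<alpha> (x + \<delta>) - profile_v \<alpha> (x - \<delta>)) / (2 * \<delta>)\<bar> \<le> (K_const \<alpha> * (4 * \<delta>) powr (\<alpha> / 2)) / (2 * \<delta>)" for x
    unfolding abs_divide using \<delta> profile_v_holder[OF \<alpha>, of "x + \<delta>" "x - \<delta>"] by (simp add: divide_right_mono)
qed

text \<open>Averaging makes the profile smooth but spreads its slope slightly beyond the interval where the
  equation holds; the continuity of its fractional Laplacian at the edges turns this into a small
  error, which a small translation compensates.\<close>

lemma smoothed_profile:
  assumes \<alpha>: "0 < \<alpha>" "\<alpha> < 2" and \<eta>: "0 < \<eta>"
  obtains W W' Y1 where "C2_bounded W" "\<And>y. (W has_real_derivative W' y) (at y)" "\<And>y. 0 \<le> W' y"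
    "\<And>y. 0 \<le> W y" "\<And>y. Y1 \<le> y \<Longrightarrow> W y = 1"
    "\<And>y. 0 \<le> W' y * (frac_lap \<alpha> W y - y / (\<alpha> + 1))" "\<And>y. W y \<le> profile_Phi \<alpha> (y + \<eta>)"
proof -
  define ya M where "ya = profile_y \<alpha>" and "M = profile_M \<alpha>"
  have ya: "0 < ya" and M: "0 < M" using profile_y_pos[OF \<alpha>(1)] profile_M_pos[OF \<alpha>(1)] by (auto simp: ya_def M_def)
  \<comment> \<open>Half of the allowed shift \<eta>, in units of the profile variable: one half is
    spent on the translation, the other on the averaging radius \<delta> \<le> \<sigma>.\<close>
  define \<sigma> where "\<sigma> = \<eta> / (2 * ya)"
  have \<sigma>: "0 < \<sigma>" using \<eta> ya by (simp add: \<sigma>_def)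
  obtain c where c: "levy_bound \<alpha> c (1 + \<alpha> / 2) (profile_U \<alpha>)" using profile_U_levy_bound[OF \<alpha>] by blast
  define l where "l z = - (levy_const \<alpha> * slevy \<alpha> (profile_U \<alpha>) z)" for z
  have l_cont: "continuous_on A l" for A
    unfolding l_def[abs_def]
    by (intro continuous_on_minus continuous_on_mult_left continuous_on_subset[OF slevy_continuous[OF c]]) auto
  have l_in: "l z = z" if "\<bar>z\<bar> < 1" for z
    unfolding l_def by (rule levy_const_slevy_profile_U[OF \<alpha> that])
  have "uniformly_continuous_on {-2..2} (\<lambda>z. l z - z)"
    by (intro compact_uniformly_continuous continuous_on_diff l_cont continuous_on_id) auto
  then obtain d where d: "0 < d" "\<And>z z'. z \<in> {-2..2} \<Longrightarrow> z' \<in> {-2..2} \<Longrightarrow> \<bar>z' - z\<bar> < d \<Longrightarrow> \<bar>(l z' - z') - (l z - z)\<bar> < \<sigma>"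
    using \<sigma> unfolding uniformly_continuous_on_def dist_real_def by metis
  define \<delta> where "\<delta> = min \<sigma> (min (1 / 4) (d / 8))"
  have \<delta>: "0 < \<delta>" "\<delta> \<le> \<sigma>" "\<delta> \<le> 1 / 4" "\<delta> \<le> d / 8" using \<sigma> d by (auto simp: \<delta>_def)
  \<comment> \<open>The range is 1 + 2 \<delta> because the averaged slope lives on |z| \<le> 1 +
    \<delta> and the average looks another \<delta> beyond.\<close>
  have l_ge: "z - \<sigma> \<le> l z" if z: "\<bar>z\<bar> \<le> 1 + 2 * \<delta>" for z
  proof -
    \<comment> \<open>Contraction into the open interval where l is known exactly, moving each point
      by at most 4 \<delta>, hence by less than d.\<close>
    define z' where "z' = z / (1 + 4 * \<delta>)"
    have "\<bar>z'\<bar> = \<bar>z\<bar> / (1 + 4 * \<delta>)" using \<delta> by (simp add: z'_def abs_divide)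
    hence z': "\<bar>z'\<bar> < 1" using z \<delta> by (simp add: pos_divide_less_eq)
    have "z - z' = z' * (4 * \<delta>)" using \<delta> by (simp add: z'_def field_simps)
    hence "\<bar>z - z'\<bar> = \<bar>z'\<bar> * (4 * \<delta>)" using \<delta> by (simp add: abs_mult)
    also have "\<dots> \<le> 1 * (4 * \<delta>)" using z' \<delta> by (intro mult_right_mono) auto
    also have "\<dots> < d" using \<delta> d by linarith
    finally have "\<bar>z - z'\<bar> < d" .
    moreover have "z \<in> {-2..2}" "z' \<in> {-2..2}" using z z' \<delta> by (auto simp: abs_le_iff)
    ultimately have "\<bar>(l z - z) - (l z' - z')\<bar> < \<sigma>" using d(2)[of z' z] by simp
    thus ?thesis using l_in[OF z'] by (simp add: abs_less_iff)
  qed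
  define Ub where "Ub = box_avg \<delta> (profile_U \<alpha>)"
  have Ub_C2: "C2_bounded Ub" unfolding Ub_def by (rule box_avg_U_C2_bounded[OF \<alpha> \<delta>(1)])
  have U_cont: "continuous_on UNIV (profile_U \<alpha>)" by (rule profile_U_continuous[OF \<alpha>(1)])
  define Ub' where "Ub' z = (profile_U \<alpha> (z + \<delta>) - profile_U \<alpha> (z - \<delta>)) / (2 * \<delta>)" for z
  have Ub': "(Ub has_real_derivative Ub' z) (at z)" for z
    unfolding Ub_def Ub'_def by (rule box_avg_deriv[OF U_cont \<delta>(1)])
  have Ub'_nonneg: "0 \<le> Ub' z" for z
    unfolding Ub'_def using \<delta> profile_U_mono[OF \<alpha>(1), of "z - \<delta>" "z + \<delta>"] by simp
  have Ub'_0: "Ub' z = 0" if "1 + \<delta> \<le> \<bar>z\<bar>" for z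
  proof (cases "0 \<le> z")
    case True
    hence "1 \<le> z - \<delta>" "1 \<le> z + \<delta>" using that \<delta> by auto
    thus ?thesis by (simp add: Ub'_def profile_U_ge_1[OF \<alpha>(1)])
  next
    case False
    hence "z - \<delta> \<le> -1" "z + \<delta> \<le> -1" using that \<delta> by auto
    thus ?thesis by (simp add: Ub'_def profile_U_le_minus_1[OF \<alpha>(1)])
  qed
  have fl_Ub: "z - \<sigma> \<le> frac_lap \<alpha> Ub z" if "\<bar>z\<bar> \<le> 1 + \<delta>" for z
  proof -
    have "box_avg \<delta> (\<lambda>y. 1 * y + - \<sigma>) z \<le> box_avg \<delta> l z"
    proof (rule box_avg_mono[OF _ l_cont \<delta>(1)])
      fix h assume "\<bar>h\<bar> \<le> \<delta>"
      thus "1 * (z + h) + - \<sigma> \<le> l (z + h)" using l_ge[of "z + h"] that by simp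
    qed (intro continuous_intros)
    also have "box_avg \<delta> l z = - (levy_const \<alpha> * box_avg \<delta> (slevy \<alpha> (profile_U \<alpha>)) z)"
      by (simp add: box_avg_def l_def mult.left_commute)
    also have "box_avg \<delta> (slevy \<alpha> (profile_U \<alpha>)) z = slevy \<alpha> Ub z"
      unfolding Ub_def by (rule slevy_box_avg[OF c \<delta>(1), symmetric])
    also have "- (levy_const \<alpha> * slevy \<alpha> Ub z) = frac_lap \<alpha> Ub z"
      by (rule frac_lap_eq_slevy[OF Ub_C2 \<alpha>, symmetric])
    finally show ?thesis by (simp only: box_avg_affine[OF \<delta>(1)])
  qed
  \<comment> \<open>Evaluating at y / ya + \<sigma> raises the lower bound z - \<sigma> for the
    fractional Laplacian to exactly y / ya.\<close>
  define W where "W y = 1 / (2 * M) * Ub (1 / ya * y + \<sigma>) + 1 / 2" for y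
  define W' where "W' y = 1 / (2 * M) * (Ub' (1 / ya * y + \<sigma>) * (1 / ya))" for y
  have W_C2: "C2_bounded W" unfolding W_def[abs_def] by (rule C2_bounded_affine_arg[OF Ub_C2])
  have W'_deriv: "(W has_real_derivative W' y) (at y)" for y
  proof -
    have 1: "((\<lambda>y. 1 / ya * y + \<sigma>) has_real_derivative 1 / ya) (at y)"
      using ya by (auto intro!: derivative_eq_intros)
    have "((\<lambda>y. 1 / (2 * M) * Ub (1 / ya * y + \<sigma>) + 1 / 2) has_real_derivative
        1 / (2 * M) * (Ub' (1 / ya * y + \<sigma>) * (1 / ya)) + 0) (at y)"
      by (rule DERIV_add[OF DERIV_cmult[OF DERIV_chain2[OF Ub' 1]] DERIV_const])
    thus ?thesis unfolding W_def[abs_def] W'_def by (simp only: add_0_right)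
  qed
  have W'_nonneg: "0 \<le> W' y" for y using M ya Ub'_nonneg by (simp add: W'_def)
  have Ub_bounds: "- M \<le> Ub z" for z
  proof -
    have "box_avg \<delta> (\<lambda>_. - M) z \<le> Ub z" unfolding Ub_def
      using profile_U_abs_le[OF \<alpha>(1)]
      by (intro box_avg_mono U_cont \<delta> continuous_on_const) (auto simp: abs_le_iff minus_le_iff M_def)
    thus ?thesis by (simp add: box_avg_const[OF \<delta>(1)])
  qed
  have W_nonneg: "0 \<le> W y" for y
    using Ub_bounds[of "1 / ya * y + \<sigma>"] M by (simp add: W_def field_simps)
  have W_1: "W y = 1" if "ya * (1 + \<delta>) \<le> y" for y
  proof -
    have "1 + \<delta> \<le> 1 / ya * y" using that ya by (simp add: field_simps)
    hence ge: "1 + \<delta> \<le> 1 / ya * y + \<sigma>" using \<sigma> by simp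
    have "Ub (1 / ya * y + \<sigma>) = M"
    proof (rule antisym)
      have "box_avg \<delta> (profile_U \<alpha>) (1 / ya * y + \<sigma>) \<le> box_avg \<delta> (\<lambda>_. M) (1 / ya * y + \<sigma>)"
        using profile_U_abs_le[OF \<alpha>(1)]
        by (intro box_avg_mono U_cont \<delta> continuous_on_const) (auto simp: abs_le_iff M_def)
      thus "Ub (1 / ya * y + \<sigma>) \<le> M" by (simp add: box_avg_const[OF \<delta>(1)] Ub_def)
      have "box_avg \<delta> (\<lambda>_. M) (1 / ya * y + \<sigma>) \<le> box_avg \<delta> (profile_U \<alpha>) (1 / ya * y + \<sigma>)"
      proof (rule box_avg_mono[OF continuous_on_const U_cont \<delta>(1)])
        fix h assume "\<bar>h\<bar> \<le> \<delta>"
        hence "1 \<le> 1 / ya * y + \<sigma> + h" using ge by simp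
        thus "M \<le> profile_U \<alpha> (1 / ya * y + \<sigma> + h)" by (simp add: profile_U_ge_1[OF \<alpha>(1)] M_def)
      qed
      thus "M \<le> Ub (1 / ya * y + \<sigma>)" by (simp add: box_avg_const[OF \<delta>(1)] Ub_def)
    qed
    thus ?thesis using M by (simp add: W_def)
  qed
  have W_super: "0 \<le> W' y * (frac_lap \<alpha> W y - y / (\<alpha> + 1))" for y
  proof (cases "1 + \<delta> \<le> \<bar>1 / ya * y + \<sigma>\<bar>")
    case True
    thus ?thesis by (simp add: W'_def Ub'_0)
  next
    case False
    hence "(1 / ya * y + \<sigma>) - \<sigma> \<le> frac_lap \<alpha> Ub (1 / ya * y + \<sigma>)" by (intro fl_Ub) simp
    hence "1 / (2 * M) * (\<bar>1 / ya\<bar> powr \<alpha> * (1 / ya * y)) \<le> 1 / (2 * M) * (\<bar>1 / ya\<bar> powr \<alpha> * frac_lap \<alpha> Ub (1 / ya * y + \<sigma>))"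
      using M by (intro mult_left_mono) auto
    also have "\<dots> = frac_lap \<alpha> W y"
      unfolding W_def[abs_def] using ya by (subst frac_lap_affine_arg[OF Ub_C2 \<alpha>]) auto
    also have "1 / (2 * M) * (\<bar>1 / ya\<bar> powr \<alpha> * (1 / ya * y)) = y / (2 * M * ya powr (\<alpha> + 1))"
      using ya M by (simp add: powr_divide powr_add field_simps)
    \<comment> \<open>The defining property of \<open>profile_y\<close>: it converts slope 1 in the
      unit profile into slope 1 / (\<alpha> + 1).\<close>
    also have "2 * M * ya powr (\<alpha> + 1) = \<alpha> + 1"
      using profile_y_powr[OF \<alpha>(1)] M by (simp add: ya_def M_def)
    finally show ?thesis using W'_nonneg[of y] by simp
  qed
  have W_le: "W y \<le> profile_Phi \<alpha> (y + \<eta>)" for y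
  proof -
    have "Ub (1 / ya * y + \<sigma>) \<le> box_avg \<delta> (\<lambda>_. profile_U \<alpha> (1 / ya * y + \<sigma> + \<delta>)) (1 / ya * y + \<sigma>)"
      unfolding Ub_def
      by (intro box_avg_mono U_cont \<delta> continuous_on_const profile_U_mono \<alpha>) (auto simp: abs_le_iff)
    hence "Ub (1 / ya * y + \<sigma>) \<le> profile_U \<alpha> (1 / ya * y + \<sigma> + \<delta>)" by (simp add: box_avg_const[OF \<delta>(1)])
    also have "\<dots> \<le> profile_U \<alpha> ((y + \<eta>) / ya)"
    proof (rule profile_U_mono[OF \<alpha>(1)])
      have "(y + \<eta>) / ya = 1 / ya * y + 2 * \<sigma>" using ya by (simp add: \<sigma>_def field_simps)
      thus "1 / ya * y + \<sigma> + \<delta> \<le> (y + \<eta>) / ya" using \<delta> by simp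
    qed
    finally have "1 / (2 * M) * Ub (1 / ya * y + \<sigma>) \<le> 1 / (2 * M) * profile_U \<alpha> ((y + \<eta>) / ya)"
      using M by (intro mult_left_mono) auto
    thus ?thesis using M by (simp add: W_def profile_Phi_def ya_def[symmetric] M_def[symmetric] distrib_left)
  qed
  show ?thesis
    by (rule that[of W W' "ya * (1 + \<delta>)"]) (use W_C2 W'_deriv W'_nonneg W_nonneg W_1 W_super W_le in auto)
qed

text \<open>In the similarity variable Y the time derivative is - W' Y / ((\<alpha> + 1) t), and
  slope times fractional Laplacian is W' times that of W over t. So the equation is 1 / t times the
  inequality for W. The level c absorbs the error of the data.\<close>

lemma subsol_self_similar:
  assumes \<alpha>: "0 < \<alpha>" "\<alpha> < 2" and u: "subsol \<alpha> u" and T: "0 < T" and \<eta>: "0 < \<eta>"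
    and init: "\<And>x. u (x, T) \<le> c + 1" "\<And>x. x < - R \<Longrightarrow> u (x, T) \<le> c"
  obtains A where "\<And>x t. T \<le> t \<Longrightarrow> u (x, t) \<le> c + profile_Phi \<alpha> ((x + A) / t powr (1 / (\<alpha> + 1)) + \<eta>)"
proof -
  obtain W W' Y1 where W: "C2_bounded W" "\<And>y. (W has_real_derivative W' y) (at y)" "\<And>y. 0 \<le> W' y"
    "\<And>y. 0 \<le> W y" "\<And>y. Y1 \<le> y \<Longrightarrow> W y = 1"
    "\<And>y. 0 \<le> W' y * (frac_lap \<alpha> W y - y / (\<alpha> + 1))" "\<And>y. W y \<le> profile_Phi \<alpha> (y + \<eta>)"
    using smoothed_profile[OF \<alpha> \<eta>] by metis
  define p where "p = 1 / (\<alpha> + 1)"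
  have p: "0 < p" "p * \<alpha> + p = 1" using \<alpha> by (auto simp: p_def field_simps)
  \<comment> \<open>Places x = -R at Y1 at time T, so that the barrier has already reached c + 1
    wherever u may exceed c.\<close>
  define A where "A = R + Y1 * T powr p"
  let ?m = "\<lambda>t. 1 * (0 + 1 * t) powr (- p)" and ?n = "\<lambda>t. A * (0 + 1 * t) powr (- p)"
  let ?\<phi> = "moving_profile c (\<lambda>_. 1) W ?m ?n"
  have cont: "continuous_on {T..} (\<lambda>t. a * (0 + 1 * t) powr (- p))" for a
    using T by (intro continuous_on_mult continuous_on_const continuous_on_powr continuous_on_add continuous_on_id) auto
  have C2t: "C2_time (\<lambda>t. a * (0 + 1 * t) powr (- p))" for a
    by (rule C2_time_powr) auto
  have bar: "barrier \<alpha> T ?\<phi>"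
  proof (rule barrier_moving_profile[OF \<alpha> W(1) C2_time_const C2t C2t continuous_on_const cont cont less_imp_le[OF T],
        where H = 1 and Mb = "T powr (- p)"])
    show "\<bar>1 * (0 + 1 * t) powr (- p)\<bar> \<le> T powr (- p)" if "T < t" for t
      using that T p by (simp add: powr_mono2')
  qed (use T in auto)
  have "u (x, t) \<le> ?\<phi> (x, t)" if "T \<le> t" for x t
  proof (rule comparison_single[OF \<alpha> u less_imp_le[OF T] bar _ _ that])
    fix x t :: real assume t: "T < t"
    hence t0: "0 < t" using T by simp
    define Y where "Y = ?m t * x + ?n t"
    have Y: "Y = (x + A) * t powr (- p)" by (simp add: Y_def algebra_simps)
    have e: "t powr (- p - 1) = t powr (- p) / t" using t0 by (simp add: powr_diff)
    have "visc_lhs \<alpha> ?\<phi> x t = 0 * W Y + 1 * (W' Y * ((- p * t powr (- p - 1)) * x + A * (- p * t powr (- p - 1))))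
       + \<bar>1 * (W' Y * ?m t)\<bar> * (1 * (\<bar>?m t\<bar> powr \<alpha> * frac_lap \<alpha> W Y))"
      unfolding Y_def using t0
      by (intro visc_lhs_moving_profile[OF \<alpha> W(1,2)]) (auto intro!: derivative_eq_intros)
    also have "\<dots> = W' Y * (- p * Y / t) + W' Y * (t powr (- p) * t powr (- p * \<alpha>)) * frac_lap \<alpha> W Y"
      using t0 W(3)[of Y] unfolding e Y by (simp add: abs_mult powr_powr field_simps)
    also have "t powr (- p) * t powr (- p * \<alpha>) = 1 / t"
    proof -
      have "t powr (- p) * t powr (- p * \<alpha>) = t powr (- p + - p * \<alpha>)" by (rule powr_add[symmetric])
      also have "- p + - p * \<alpha> = -1" using p(2) by simp
      also have "t powr -1 = 1 / t" using t0 by (simp add: powr_minus_divide)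
      finally show ?thesis .
    qed
    also have "W' Y * (- p * Y / t) + W' Y * (1 / t) * frac_lap \<alpha> W Y = (W' Y * (frac_lap \<alpha> W Y - Y / (\<alpha> + 1))) / t"
    proof -
      have "- p * Y / t = - (Y / (\<alpha> + 1)) / t" by (simp add: p_def)
      thus ?thesis by (simp add: right_diff_distrib diff_divide_distrib)
    qed
    also have "\<dots> \<ge> 0" using W(6)[of Y] t0 by simp
    finally show "0 \<le> visc_lhs \<alpha> ?\<phi> x t" .
  next
    fix x :: real
    show "u (x, T) \<le> ?\<phi> (x, T)"
    proof (cases "x < - R")
      case True
      thus ?thesis using init(2)[OF True] W(4) by (simp add: moving_profile_def add_increasing2)
    next
      case False
      have "Y1 = (Y1 * T powr p) * T powr (- p)" using T by (simp add: powr_minus)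
      also have "\<dots> \<le> (x + A) * T powr (- p)" using False by (intro mult_right_mono) (auto simp: A_def)
      also have "\<dots> = ?m T * x + ?n T" by (simp add: algebra_simps)
      finally have "W (?m T * x + ?n T) = 1" by (rule W(5))
      thus ?thesis using init(1)[of x] by (simp add: moving_profile_def)
    qed
  qed
  hence "u (x, t) \<le> c + profile_Phi \<alpha> ((x + A) / t powr p + \<eta>)" if "T \<le> t" for x t
  proof -
    have "?m t * x + ?n t = (x + A) / t powr p" by (simp add: powr_minus divide_inverse algebra_simps)
    hence "?\<phi> (x, t) = c + W ((x + A) / t powr p)" by (simp add: moving_profile_def)
    thus ?thesis using \<open>\<And>x t. T \<le> t \<Longrightarrow> u (x, t) \<le> ?\<phi> (x, t)\<close>[OF that, of x] W(7)[of "(x + A) / t powr p"] by simp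
  qed
  thus ?thesis using that unfolding p_def by blast
qed

section \<open>Long-time asymptotics\<close>

lemma profile_Phi_bounds:
  assumes "0 < \<alpha>"
  shows "0 \<le> profile_Phi \<alpha> y" "profile_Phi \<alpha> y \<le> 1"
  using profile_U_abs_le[OF assms, of "y / profile_y \<alpha>"] profile_M_pos[OF assms]
  by (auto simp: profile_Phi_def abs_le_iff field_simps)

lemma profile_Phi_right:
  assumes "0 < \<alpha>" "profile_y \<alpha> \<le> y"
  shows "profile_Phi \<alpha> y = 1"
proof -
  have "1 \<le> y / profile_y \<alpha>" using assms profile_y_pos[OF assms(1)] by simp
  thus ?thesis using profile_M_pos[OF assms(1)] by (simp add: profile_Phi_def profile_U_ge_1[OF assms(1)])
qed

lemma profile_Phi_reflect:
  assumes "0 < \<alpha>"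
  shows "profile_Phi \<alpha> (- y) = 1 - profile_Phi \<alpha> y"
  using profile_M_pos[OF assms] profile_U_odd[OF assms, of "y / profile_y \<alpha>"]
  by (simp add: profile_Phi_def field_simps)

lemma profile_Phi_left:
  assumes "0 < \<alpha>" "y \<le> - profile_y \<alpha>"
  shows "profile_Phi \<alpha> y = 0"
  using profile_Phi_right[of \<alpha> "- y"] profile_Phi_reflect[of \<alpha> y] assms by simp

lemma profile_Phi_lipschitz:
  assumes "0 < \<alpha>"
  obtains L where "0 < L" "\<And>y z. \<bar>profile_Phi \<alpha> y - profile_Phi \<alpha> z\<bar> \<le> L * \<bar>y - z\<bar>"
proof -
  define L where "L = 1 / (2 * profile_M \<alpha>) * (K_const \<alpha> * (1 / profile_y \<alpha>))"
  note pos = profile_M_pos[OF assms] profile_y_pos[OF assms] K_const_pos[OF assms]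
  have L: "0 < L" using pos by (simp add: L_def)
  have v: "\<bar>profile_v \<alpha> y\<bar> \<le> K_const \<alpha>" for y
  proof -
    have "max 0 (1 - y\<^sup>2) powr (\<alpha> / 2) \<le> 1 powr (\<alpha> / 2)" using assms by (intro powr_mono2) auto
    thus ?thesis using pos by (simp add: profile_v_eq abs_mult)
  qed
  have "\<bar>profile_Phi \<alpha> y - profile_Phi \<alpha> z\<bar> \<le> L * \<bar>y - z\<bar>" for y z
  proof (rule derivative_bound_imp_lipschitz)
    show "(profile_Phi \<alpha> has_real_derivative 1 / (2 * profile_M \<alpha>) * (profile_v \<alpha> (y / profile_y \<alpha>) * (1 / profile_y \<alpha>))) (at y)" for y
      unfolding profile_Phi_def[abs_def] using assms pos by (auto intro!: derivative_eq_intros)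
    show "\<bar>1 / (2 * profile_M \<alpha>) * (profile_v \<alpha> (y / profile_y \<alpha>) * (1 / profile_y \<alpha>))\<bar> \<le> L" for y
      unfolding L_def abs_mult using pos v[of "y / profile_y \<alpha>"] by (intro mult_mono) auto
  qed
  thus ?thesis using that[of L] L by blast
qed

lemma self_similar_reflect:
  assumes "0 < \<alpha>" "(x, t) \<noteq> (0, 0)"
  shows "self_similar \<alpha> (- x, t) = 1 - self_similar \<alpha> (x, t)"
  using assms profile_Phi_reflect[OF assms(1), of "x / t powr (1 / (\<alpha> + 1))"]
  by (auto simp: self_similar_def)

text \<open>The overshoot of the data above 1 + e is confined to a bounded interval, as the collapse
  requires. The time T it takes may be long, but it is fixed, so the waves from both sides cover
  only a bounded region until then.\<close>

lemma subsol_initial_control: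
  assumes \<alpha>: "0 < \<alpha>" "\<alpha> < 2" and u: "subsol \<alpha> u" and init: "\<And>x. u (x, 0) \<le> u0 x"
    and lim: "(u0 \<longlongrightarrow> 0) at_bot" "(u0 \<longlongrightarrow> 1) at_top" and e: "0 < e"
  obtains T R where "0 < T" "0 < R" "\<And>x. u (x, T) \<le> 1 + 2 * e"
    "\<And>x t. 0 \<le> t \<Longrightarrow> t \<le> T \<Longrightarrow> x \<le> - R \<Longrightarrow> u (x, t) \<le> 2 * e"
    "\<And>x t. 0 \<le> t \<Longrightarrow> t \<le> T \<Longrightarrow> R \<le> x \<Longrightarrow> u (x, t) \<le> 1 + 2 * e"
proof -
  have "eventually (\<lambda>x. u0 x < e) at_bot" using order_tendstoD(2)[OF lim(1) e] .
  then obtain R1 where R1: "\<And>x. x \<le> R1 \<Longrightarrow> u0 x < e" by (auto simp: eventually_at_bot_linorder)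
  have "eventually (\<lambda>x. u0 x < 1 + e) at_top" using order_tendstoD(2)[OF lim(2), of "1 + e"] e by simp
  then obtain R2 where R2: "\<And>x. R2 \<le> x \<Longrightarrow> u0 x < 1 + e" by (auto simp: eventually_at_top_linorder)
  define R0 where "R0 = max 1 (max (- R1) R2)"
  have R0: "0 < R0" "- R1 \<le> R0" "R2 \<le> R0" by (auto simp: R0_def)
  have left: "u (x, 0) \<le> e" if "x \<le> - R0" for x
    using init[of x] R1[of x] that R0 by linarith
  have right: "u (x, 0) \<le> 1 + e" if "R0 \<le> x" for x
    using init[of x] R2[of x] that R0 by linarith
  obtain b where b: "\<forall>p\<in>closed_half. \<bar>u p\<bar> \<le> b" using u by (auto simp: subsol_def bounded_iff)
  define B where "B = \<bar>b\<bar> + 1"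
  have B: "0 < B" by (simp add: B_def)
  have ub: "u (x, 0) \<le> B" for x using b[rule_format, of "(x, 0)"] by (simp add: B_def)
  obtain T where T: "0 < T" "\<And>x. u (x, T) \<le> 1 + e + e"
  proof (rule subsol_collapse[OF \<alpha> u B R0(1) e, of "1 + e"])
    show "u (x, 0) \<le> 1 + e + B" for x using ub[of x] e by simp
    show "u (x, 0) \<le> 1 + e" if "R0 \<le> \<bar>x\<bar>" for x
      using that left[of x] right[of x] by (cases "0 \<le> x") auto
  qed (rule that)
  have "eventually (\<lambda>z. step_profile z < e / B) at_bot"
    using order_tendstoD(2)[OF step_profile_at_bot, of "e / B"] e B by simp
  then obtain z0 where z0: "\<And>z. z \<le> z0 \<Longrightarrow> step_profile z < e / B" by (auto simp: eventually_at_bot_linorder)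
  hence z0': "B * step_profile z \<le> e" if "z \<le> z0" for z
    using B that by (simp add: pos_less_divide_eq mult.commute less_imp_le)
  obtain k1 where k1: "0 \<le> k1" "\<And>x t. 0 \<le> t \<Longrightarrow> u (x, t) \<le> e + B * step_profile (1 * x + (R0 + k1 * t))"
  proof (rule subsol_spread[OF \<alpha> u, of 1 B e R0])
    show "u (x, 0) \<le> e + B" for x using ub[of x] e by simp
    show "u (x, 0) \<le> e" if "1 * x < - R0" for x using left[of x] that by simp
  qed (use B in auto)
  obtain k2 where k2: "0 \<le> k2" "\<And>x t. 0 \<le> t \<Longrightarrow> u (x, t) \<le> 1 + e + B * step_profile (-1 * x + (R0 + k2 * t))"
  proof (rule subsol_spread[OF \<alpha> u, of "-1" B "1 + e" R0])
    show "u (x, 0) \<le> 1 + e + B" for x using ub[of x] e by simp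
    show "u (x, 0) \<le> 1 + e" if "-1 * x < - R0" for x using right[of x] that by simp
  qed (use B in auto)
  \<comment> \<open>Adds the original interval, the distance within which the tail of the step
    exceeds e / B, and the path covered by both waves up to T.\<close>
  define R where "R = \<bar>z0\<bar> + R0 + (k1 + k2) * T"
  have "0 \<le> (k1 + k2) * T" using T k1 k2 by simp
  hence R: "0 < R" unfolding R_def using R0(1) by linarith
  have le: "k1 * t \<le> (k1 + k2) * T" "k2 * t \<le> (k1 + k2) * T" if "0 \<le> t" "t \<le> T" for t
    using that k1 k2 by (auto intro!: mult_mono)
  show ?thesis
  proof (rule that[OF T(1) R])
    show "u (x, T) \<le> 1 + 2 * e" for x using T(2)[of x] by simp
    show "u (x, t) \<le> 2 * e" if "0 \<le> t" "t \<le> T" "x \<le> - R" for x t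
    proof -
      have "1 * x + (R0 + k1 * t) \<le> z0" using le[OF that(1,2)] that(3) unfolding R_def by linarith
      from z0'[OF this] k1(2)[OF that(1), of x] show ?thesis by linarith
    qed
    show "u (x, t) \<le> 1 + 2 * e" if "0 \<le> t" "t \<le> T" "R \<le> x" for x t
    proof -
      have "-1 * x + (R0 + k2 * t) \<le> z0" using le[OF that(1,2)] that(3) unfolding R_def by linarith
      from z0'[OF this] k2(2)[OF that(1), of x] show ?thesis by linarith
    qed
  qed
qed

text \<open>K avoids the origin, so its points with small t have |x| bounded below; there the limit
  is 0 or 1 and the far-field bounds suffice. For t bounded below, the profile is Lipschitz in x /
  t^p and a shift of A / l is negligible.\<close>

lemma rescaled_subsol_le:
  assumes \<alpha>: "0 < \<alpha>" "\<alpha> < 2" and u: "subsol \<alpha> u" and init: "\<And>x. u (x, 0) \<le> u0 x"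
    and lim: "(u0 \<longlongrightarrow> 0) at_bot" "(u0 \<longlongrightarrow> 1) at_top"
    and K: "compact K" "K \<subseteq> closed_half - {(0, 0)}" and \<epsilon>: "0 < \<epsilon>"
  shows "eventually (\<lambda>l. \<forall>p\<in>K. rescale \<alpha> l u p \<le> self_similar \<alpha> p + \<epsilon>) at_top"
proof -
  \<comment> \<open>Of the four parts, two are the level left by the initial control, one goes to
    the smoothing shift \<eta> and one to the translation A / l.\<close>
  define e where "e = \<epsilon> / 4"
  have e: "0 < e" using \<epsilon> by (simp add: e_def)
  define p where "p = 1 / (\<alpha> + 1)"
  have p: "0 < p" "(\<alpha> + 1) * p = 1" using \<alpha> by (auto simp: p_def)
  let ?\<Phi> = "profile_Phi \<alpha>"
  define ya where "ya = profile_y \<alpha>"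
  have ya: "0 < ya" using profile_y_pos[OF \<alpha>(1)] by (simp add: ya_def)
  obtain T R where TR: "0 < T" "0 < R" "\<And>x. u (x, T) \<le> 1 + 2 * e"
    "\<And>x t. 0 \<le> t \<Longrightarrow> t \<le> T \<Longrightarrow> x \<le> - R \<Longrightarrow> u (x, t) \<le> 2 * e"
    "\<And>x t. 0 \<le> t \<Longrightarrow> t \<le> T \<Longrightarrow> R \<le> x \<Longrightarrow> u (x, t) \<le> 1 + 2 * e"
    using subsol_initial_control[OF \<alpha> u init lim e] by metis
  obtain L where L: "0 < L" "\<And>y z. \<bar>?\<Phi> y - ?\<Phi> z\<bar> \<le> L * \<bar>y - z\<bar>"
    using profile_Phi_lipschitz[OF \<alpha>(1)] by metis
  define \<eta> where "\<eta> = min 1 (e / L)"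
  have \<eta>: "0 < \<eta>" "\<eta> \<le> 1" "L * \<eta> \<le> e"
    using e L by (auto simp: \<eta>_def min_def field_simps)
  obtain A where A: "\<And>x t. T \<le> t \<Longrightarrow> u (x, t) \<le> 2 * e + ?\<Phi> ((x + A) / t powr p + \<eta>)"
  proof (rule subsol_self_similar[OF \<alpha> u TR(1) \<eta>(1), of "2 * e" R])
    show "u (x, T) \<le> 2 * e + 1" for x using TR(3)[of x] by simp
    show "u (x, T) \<le> 2 * e" if "x < - R" for x using TR(4)[of T x] TR(1) that by simp
  qed (auto simp: p_def)
  obtain r where r: "0 < r" "\<And>x t. (x, t) \<in> K \<Longrightarrow> r \<le> \<bar>x\<bar> + \<bar>t\<bar>"
  proof -
    have "open (- K)" using compact_imp_closed[OF K(1)] by (simp add: open_Compl)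
    moreover have "(0, 0) \<in> - K" using K(2) by auto
    ultimately obtain r where r: "0 < r" "ball (0, 0) r \<subseteq> - K" by (auto simp: open_contains_ball)
    have "r \<le> \<bar>x\<bar> + \<bar>t\<bar>" if "(x, t) \<in> K" for x t
    proof -
      have "(x, t) \<notin> ball (0, 0) r" using r that by auto
      hence "r \<le> norm (x, t)" using dist_0_norm[of "(x, t)"] by (simp add: zero_prod_def)
      also have "\<dots> \<le> \<bar>x\<bar> + \<bar>t\<bar>" using norm_Pair_le[of x t] by simp
      finally show ?thesis .
    qed
    thus ?thesis using that r by blast
  qed
  define d where "d = r / 2"
  have d: "0 < d" using r by (simp add: d_def)
  \<comment> \<open>The first bound forces |x| \<ge> d. The second makes |x| / t^p at least ya + 2:
    beyond the edge of the profile there remains one unit for the translation and one for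
    \<eta>.\<close>
  define t1 where "t1 = min (r / 2) ((d / (ya + 2)) powr (\<alpha> + 1))"
  have t1: "0 < t1" using r d ya by (simp add: t1_def)
  have t1p: "t powr p \<le> d / (ya + 2)" if "0 \<le> t" "t \<le> t1" for t
  proof -
    have "t powr p \<le> ((d / (ya + 2)) powr (\<alpha> + 1)) powr p"
      using that p by (intro powr_mono2) (auto simp: t1_def)
    also have "\<dots> = d / (ya + 2)" using p d ya by (simp add: powr_powr)
    finally show ?thesis .
  qed
  have xd: "d \<le> \<bar>x\<bar>" if "(x, t) \<in> K" "0 \<le> t" "t \<le> t1" for x t
    using r(2)[OF that(1)] that by (simp add: t1_def d_def)
  \<comment> \<open>In order: l is at least 1; distance d is scaled beyond R; the shift A / l is at
    most d / (ya + 2); times after t1 are scaled beyond T; after t1 the shift changes the profile by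
    at most e.\<close>
  define l0 where "l0 = Max {1, R / d, \<bar>A\<bar> * (ya + 2) / d, T / t1, L * \<bar>A\<bar> / (t1 powr p * e)}"
  have main: "u (l * x, l powr (\<alpha> + 1) * t) \<le> self_similar \<alpha> (x, t) + \<epsilon>"
    if l: "l0 \<le> l" and xt: "(x, t) \<in> K" for l x t
  proof -
    have l1: "1 \<le> l" "R \<le> l * d" "\<bar>A\<bar> / l * (ya + 2) \<le> d" "T \<le> l * t1" "L * (\<bar>A\<bar> / l) / t1 powr p \<le> e"
    proof -
      have *: "1 \<le> l \<and> R / d \<le> l \<and> \<bar>A\<bar> * (ya + 2) / d \<le> l \<and> T / t1 \<le> l \<and> L * \<bar>A\<bar> / (t1 powr p * e) \<le> l"
        using l unfolding l0_def by simp
      thus "1 \<le> l" "R \<le> l * d" "T \<le> l * t1" using d t1 by (simp_all add: pos_divide_le_eq)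
      have "\<bar>A\<bar> * (ya + 2) \<le> l * d" using * d by (simp add: pos_divide_le_eq)
      thus "\<bar>A\<bar> / l * (ya + 2) \<le> d" using * by (simp add: pos_divide_le_eq mult.commute)
      have "L * \<bar>A\<bar> \<le> l * (t1 powr p * e)" using * t1 e by (simp add: pos_divide_le_eq)
      thus "L * (\<bar>A\<bar> / l) / t1 powr p \<le> e" using * t1 by (simp add: pos_divide_le_eq mult_ac)
    qed
    have t0: "0 \<le> t" using xt K(2) by auto
    have s0: "0 \<le> l powr (\<alpha> + 1) * t" using t0 by simp
    have ss_nonneg: "0 \<le> self_similar \<alpha> (x, t)"
      using profile_Phi_bounds(1)[OF \<alpha>(1)] by (simp add: self_similar_def)
    have late: "u (l * x, l powr (\<alpha> + 1) * t) \<le> 2 * e + ?\<Phi> ((x + A / l) / t powr p + \<eta>)"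
      if "T \<le> l powr (\<alpha> + 1) * t"
    proof -
      have "(l powr (\<alpha> + 1) * t) powr p = l * t powr p"
        using l1(1) t0 p(2) by (simp add: powr_mult powr_powr)
      moreover have "(l * x + A) / (l * t powr p) = (x + A / l) / t powr p"
        using l1(1) by (simp add: divide_simps algebra_simps)
      ultimately show ?thesis using A[OF that, of "l * x"] by simp
    qed
    show ?thesis
    proof (cases "t \<le> t1")
      case True
      note dx = xd[OF xt t0 True]
      have tp: "t powr p \<le> d / (ya + 2)" by (rule t1p[OF t0 True])
      show ?thesis
      proof (cases "0 \<le> x")
        case x0: True
        have one: "self_similar \<alpha> (x, t) = 1"
        proof (cases "t = 0")
          case False
          hence tpos: "0 < t powr p" using t0 by simp
          have "ya * t powr p \<le> (ya + 2) * (d / (ya + 2))" using tp ya tpos by (intro mult_mono) auto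
          also have "\<dots> \<le> x" using dx x0 ya by simp
          finally have "ya \<le> x / t powr p" using tpos by (simp add: pos_le_divide_eq)
          thus ?thesis using False by (simp add: self_similar_def profile_Phi_right[OF \<alpha>(1)] ya_def p_def)
        qed (use x0 in \<open>simp add: self_similar_def\<close>)
        \<comment> \<open>However large l is, a small t may still be scaled to a time before T, so
          both regimes occur here.\<close>
        have "u (l * x, l powr (\<alpha> + 1) * t) \<le> 1 + 2 * e"
        proof (cases "T \<le> l powr (\<alpha> + 1) * t")
          case True
          from late[OF True] profile_Phi_bounds(2)[OF \<alpha>(1)] show ?thesis by (smt (verit))
        next
          case False
          have "l * d \<le> l * x" using l1(1) dx x0 by (intro mult_left_mono) auto
          hence "R \<le> l * x" using l1(2) by linarith
          thus ?thesis using TR(5) s0 False by simp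
        qed
        thus ?thesis using one e by (simp add: e_def)
      next
        case x0: False
        have "u (l * x, l powr (\<alpha> + 1) * t) \<le> 2 * e"
        proof (cases "T \<le> l powr (\<alpha> + 1) * t")
          case True
          hence "t \<noteq> 0" using TR(1) by auto
          hence tpos: "0 < t powr p" using t0 by simp
          have "(ya + 1) * t powr p \<le> (ya + 1) * (d / (ya + 2))" using tp ya by (intro mult_left_mono) auto
          also have "\<dots> = d - d / (ya + 2)" using ya by (simp add: field_simps)
          also have "\<dots> \<le> d - \<bar>A\<bar> / l" using l1(3) ya by (simp add: pos_le_divide_eq)
          also have "\<dots> \<le> - (x + A / l)" using dx x0 l1(1) abs_ge_self[of A] divide_right_mono[of A "\<bar>A\<bar>" l] by simp
          finally have "x + A / l \<le> - (ya + 1) * t powr p" by linarith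
          hence "(x + A / l) / t powr p \<le> - (ya + 1)" by (simp only: pos_divide_le_eq[OF tpos])
          hence "(x + A / l) / t powr p + \<eta> \<le> - ya" using \<eta>(2) by simp
          hence "?\<Phi> ((x + A / l) / t powr p + \<eta>) = 0" by (intro profile_Phi_left[OF \<alpha>(1)]) (simp add: ya_def)
          with late[OF True] show ?thesis by simp
        next
          case False
          have "l * d \<le> l * - x" using l1(1) dx x0 by (intro mult_left_mono) auto
          hence "l * x \<le> - R" using l1(2) by simp
          thus ?thesis using TR(4) s0 False by simp
        qed
        thus ?thesis using ss_nonneg e by (simp add: e_def)
      qed
    next
      case False
      hence t: "t1 < t" by simp
      have tt: "0 < t" using t t1 by simp
      have "l powr 1 \<le> l powr (\<alpha> + 1)" using l1(1) \<alpha> by (intro powr_mono) auto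
      hence "l * t1 \<le> l powr (\<alpha> + 1) * t" using l1(1) t t1 by (intro mult_mono) auto
      hence "T \<le> l powr (\<alpha> + 1) * t" using l1(4) by simp
      note late[OF this]
      also have "?\<Phi> ((x + A / l) / t powr p + \<eta>) \<le> ?\<Phi> (x / t powr p) + L * \<bar>A / l / t powr p + \<eta>\<bar>"
      proof -
        have *: "(x + A / l) / t powr p + \<eta> - x / t powr p = A / l / t powr p + \<eta>"
          by (simp add: add_divide_distrib)
        show ?thesis using L(2)[of "(x + A / l) / t powr p + \<eta>" "x / t powr p"] unfolding * by linarith
      qed
      also have "L * \<bar>A / l / t powr p + \<eta>\<bar> \<le> e + e"
      proof -
        have tp: "t1 powr p \<le> t powr p" "0 < t1 powr p" using t t1 p by (auto intro: powr_mono2)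
        have "L * \<bar>A / l / t powr p\<bar> = L * (\<bar>A\<bar> / l) / t powr p" using l1(1) by (simp add: abs_divide)
        also have "\<dots> \<le> L * (\<bar>A\<bar> / l) / t1 powr p"
          using tp l1(1) L(1) by (intro divide_left_mono mult_pos_pos) auto
        finally have "L * \<bar>A / l / t powr p\<bar> \<le> e" using l1(5) by simp
        moreover have "L * \<bar>A / l / t powr p + \<eta>\<bar> \<le> L * (\<bar>A / l / t powr p\<bar> + \<eta>)"
          using L(1) \<eta> by (intro mult_left_mono order_trans[OF abs_triangle_ineq]) auto
        ultimately show ?thesis using \<eta>(3) by (simp add: distrib_left)
      qed
      finally show ?thesis using tt by (simp add: self_similar_def p_def e_def)
    qed
  qed
  show ?thesis
    using eventually_ge_at_top[of l0] by eventually_elim (use main in \<open>auto simp: rescale_def\<close>)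
qed

section \<open>Envelopes, reflection, and reduction of solutions to subsolutions\<close>

lemma nhds_within_tendsto:
  assumes "continuous_on S f" "p \<in> S"
  shows "(f \<longlongrightarrow> f p) (inf (nhds p) (principal S))"
proof (rule topological_tendstoI)
  fix U assume U: "open U" "f p \<in> U"
  have "(f \<longlongrightarrow> f p) (at p within S)" using assms by (simp add: continuous_on_def)
  hence "eventually (\<lambda>q. f q \<in> U) (at p within S)" using U by (rule topological_tendstoD)
  thus "eventually (\<lambda>q. f q \<in> U) (inf (nhds p) (principal S))"
    unfolding eventually_inf_principal eventually_at_filter
    by eventually_elim (use U in auto)
qed

lemma nhds_within_neq_bot: "p \<in> S \<Longrightarrow> inf (nhds p) (principal S) \<noteq> bot"
  unfolding trivial_limit_def eventually_inf_principal by (auto dest: eventually_nhds_x_imp_x)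

text \<open>The envelope filter includes the point itself and is therefore nontrivial, so the upper
  and lower limits equal the limit. For a continuous u both envelopes thus disappear on the closed
  half-plane.\<close>

lemma envelopes_continuous:
  assumes "continuous_on S f" "p \<in> S"
  shows "upper_env S f p = f p" "lower_env S f p = f p"
proof -
  have lim: "((\<lambda>q. ereal (f q)) \<longlongrightarrow> ereal (f p)) (inf (nhds p) (principal S))"
    using nhds_within_tendsto[OF assms] by simp
  note nb = nhds_within_neq_bot[OF assms(2)]
  show "upper_env S f p = f p" "lower_env S f p = f p"
    unfolding upper_env_def lower_env_def lim_imp_Limsup[OF nb lim] lim_imp_Liminf[OF nb lim] by simp_all
qed

text \<open>Substitute -z. The derivative changes sign twice, so the compensator is carried along
  correctly.\<close>

lemma levy_integral_reflect:
  assumes "w differentiable (at x)"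
  shows "levy_integral \<alpha> (\<lambda>y. 1 - w (- y)) (- x) = - levy_integral \<alpha> w x"
proof -
  let ?g = "\<lambda>z. (w (x + z) - w x - z * deriv w x * indicator {-1..1} z) / \<bar>z\<bar> powr (1 + \<alpha>)"
  have "(w has_real_derivative deriv w x) (at (- (- x)))"
    using assms by (simp add: DERIV_deriv_iff_real_differentiable)
  moreover have "((\<lambda>y::real. - y) has_real_derivative - 1) (at (- x))" by (auto intro!: derivative_eq_intros)
  ultimately have "((\<lambda>y. w (- y)) has_real_derivative deriv w x * - 1) (at (- x))" by (rule DERIV_chain2)
  hence "((\<lambda>y. 1 - w (- y)) has_real_derivative 0 - deriv w x * - 1) (at (- x))"
    by (intro DERIV_diff DERIV_const)
  hence d: "deriv (\<lambda>y. 1 - w (- y)) (- x) = deriv w x" by (simp add: DERIV_imp_deriv)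
  have "levy_integral \<alpha> (\<lambda>y. 1 - w (- y)) (- x) = (\<integral>z. - ?g (0 + (-1) * z) \<partial>lborel)"
    unfolding levy_integral_def d
    by (intro Bochner_Integration.integral_cong refl)
       (auto simp: minus_divide_left[symmetric] diff_divide_distrib add_divide_distrib split: split_indicator)
  also have "\<dots> = - (\<integral>z. ?g (0 + (-1) * z) \<partial>lborel)" by simp
  also have "(\<integral>z. ?g (0 + (-1) * z) \<partial>lborel) = (\<integral>z. ?g z \<partial>lborel)"
    using lborel_integral_real_affine[of "-1" ?g 0] by simp
  finally show ?thesis by (simp add: levy_integral_def)
qed

text \<open>Replacing \<phi> (x, t) by 1 - \<phi> (-x, t) keeps the slope and reverses the sign of
  both the time derivative and the fractional Laplacian. Supersolutions thus become
  subsolutions.\<close>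

lemma visc_lhs_reflect:
  assumes "C2_on open_half \<phi>" "0 < t"
  shows "visc_lhs \<alpha> (\<lambda>p. 1 - \<phi> (- fst p, snd p)) (- x) t = - visc_lhs \<alpha> \<phi> x t"
proof -
  have "((\<lambda>t. \<phi> (x, t)) has_real_derivative deriv (\<lambda>t. \<phi> (x, t)) t) (at t)"
    using C2_on_partial_t[OF assms] by (simp add: DERIV_deriv_iff_real_differentiable)
  hence "((\<lambda>t. 1 - \<phi> (x, t)) has_real_derivative 0 - deriv (\<lambda>t. \<phi> (x, t)) t) (at t)"
    by (intro DERIV_diff DERIV_const)
  hence 1: "deriv (\<lambda>t. 1 - \<phi> (x, t)) t = - deriv (\<lambda>t. \<phi> (x, t)) t" by (simp add: DERIV_imp_deriv)
  have dx: "(\<lambda>x. \<phi> (x, t)) differentiable (at x)" by (rule C2_on_partial_x[OF assms])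
  hence "((\<lambda>y. \<phi> (y, t)) has_real_derivative deriv (\<lambda>y. \<phi> (y, t)) x) (at (- (- x)))"
    by (simp add: DERIV_deriv_iff_real_differentiable)
  moreover have "((\<lambda>y::real. - y) has_real_derivative - 1) (at (- x))" by (auto intro!: derivative_eq_intros)
  ultimately have "((\<lambda>y. \<phi> (- y, t)) has_real_derivative deriv (\<lambda>y. \<phi> (y, t)) x * - 1) (at (- x))" by (rule DERIV_chain2)
  hence "((\<lambda>y. 1 - \<phi> (- y, t)) has_real_derivative 0 - deriv (\<lambda>y. \<phi> (y, t)) x * - 1) (at (- x))"
    by (intro DERIV_diff DERIV_const)
  hence 2: "deriv (\<lambda>y. 1 - \<phi> (- y, t)) (- x) = deriv (\<lambda>y. \<phi> (y, t)) x" by (simp add: DERIV_imp_deriv)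
  have 3: "frac_lap \<alpha> (\<lambda>y. 1 - \<phi> (- y, t)) (- x) = - frac_lap \<alpha> (\<lambda>y. \<phi> (y, t)) x"
    unfolding frac_lap_def using levy_integral_reflect[OF dx, of \<alpha>] by simp
  show ?thesis unfolding visc_lhs_def fst_conv snd_conv minus_minus 1 2 3 by simp
qed

text \<open>Turns both halves of the solution concept into the one-sided setting: the supersolution
  half becomes the subsolution property of the reflected function, tested with reflected test
  functions.\<close>

lemma ivp_solution_subsol:
  assumes u: "bounded (u ` closed_half)" "continuous_on closed_half u" "ivp_solution \<alpha> u0 u"
    and u0: "continuous_on UNIV u0"
  shows "subsol \<alpha> u" "u (x, 0) \<le> u0 x"
    and "subsol \<alpha> (\<lambda>p. 1 - u (- fst p, snd p))" "u0 x \<le> u (x, 0)"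
proof -
  have env: "upper_env closed_half u (x, t) = u (x, t)" "lower_env closed_half u (x, t) = u (x, t)" if "0 \<le> t" for x t
    using envelopes_continuous[OF u(2), of "(x, t)"] that by auto
  have env0: "upper_env UNIV u0 x = u0 x" "lower_env UNIV u0 x = u0 x" for x
    using envelopes_continuous[OF u0] by auto
  have sub: "viscosity_subsolution \<alpha> (upper_env closed_half u)"
    and super: "viscosity_supersolution \<alpha> (lower_env closed_half u)"
    and i: "upper_env closed_half u (x, 0) \<le> upper_env UNIV u0 x" "lower_env UNIV u0 x \<le> lower_env closed_half u (x, 0)" for x
    using u(3) by (auto simp: ivp_solution_def ivp_subsolution_def ivp_supersolution_def)
  show "u (x, 0) \<le> u0 x" "u0 x \<le> u (x, 0)" using i by (simp_all add: env env0)
  have "test_sub \<alpha> u"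
    unfolding test_sub_def
  proof (intro allI impI)
    fix x0 t0 \<tau> :: real and \<phi>
    assume a: "0 < t0" "0 < \<tau>" "\<tau> < t0" "C2_on open_half \<phi>" "bounded (\<phi> ` open_half)"
      and m: "\<forall>x. \<forall>t\<in>{t0 - \<tau><..<t0 + \<tau>}. u (x, t) - \<phi> (x, t) \<le> u (x0, t0) - \<phi> (x0, t0)"
    have "\<forall>x. \<forall>t\<in>{t0 - \<tau><..<t0 + \<tau>}. upper_env closed_half u (x, t) - \<phi> (x, t)
        \<le> upper_env closed_half u (x0, t0) - \<phi> (x0, t0)"
      using m a by (simp add: env)
    thus "visc_lhs \<alpha> \<phi> x0 t0 \<le> 0" using sub a unfolding viscosity_subsolution_def by blast
  qed
  thus "subsol \<alpha> u" using u by (simp add: subsol_def)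
  have "test_sub \<alpha> (\<lambda>p. 1 - u (- fst p, snd p))"
    unfolding test_sub_def fst_conv snd_conv
  proof (intro allI impI)
    fix x0 t0 \<tau> :: real and \<phi>
    assume a: "0 < t0" "0 < \<tau>" "\<tau> < t0" "C2_on open_half \<phi>" "bounded (\<phi> ` open_half)"
      and m: "\<forall>x. \<forall>t\<in>{t0 - \<tau><..<t0 + \<tau>}. 1 - u (- x, t) - \<phi> (x, t) \<le> 1 - u (- x0, t0) - \<phi> (x0, t0)"
    let ?\<psi> = "\<lambda>p. 1 - \<phi> (- fst p, snd p)"
    have lin: "bounded_linear (\<lambda>p::real \<times> real. (- fst p, snd p))"
      by (intro bounded_linear_Pair bounded_linear_minus bounded_linear_fst bounded_linear_snd)
    have "C2_on open_half (\<lambda>p. 1 + (-1) * \<phi> (- fst p, snd p))"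
      by (intro C2_on_add C2_on_const C2_on_cmult C2_on_compose_linear[OF a(4) lin]) auto
    hence c: "C2_on open_half ?\<psi>" by simp
    obtain b where "\<forall>p\<in>open_half. \<bar>\<phi> p\<bar> \<le> b" using a(5) by (auto simp: bounded_iff)
    hence b: "\<bar>\<phi> (- x, t)\<bar> \<le> b" if "0 < t" for x t using that by auto
    have "\<bar>1 - \<phi> (- x, t)\<bar> \<le> 1 + b" if "0 < t" for x t using b[OF that, of x] by linarith
    hence "\<forall>p\<in>open_half. \<bar>?\<psi> p\<bar> \<le> 1 + b" by auto
    hence bd: "bounded (?\<psi> ` open_half)" by (auto simp: bounded_iff)
    have "\<forall>x. \<forall>t\<in>{t0 - \<tau><..<t0 + \<tau>}. lower_env closed_half u (x, t) - ?\<psi> (x, t)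
        \<ge> lower_env closed_half u (- x0, t0) - ?\<psi> (- x0, t0)"
    proof (intro allI ballI)
      fix x t assume t: "t \<in> {t0 - \<tau><..<t0 + \<tau>}"
      have "1 - u (- (- x), t) - \<phi> (- x, t) \<le> 1 - u (- x0, t0) - \<phi> (x0, t0)" using m t by blast
      thus "lower_env closed_half u (x, t) - ?\<psi> (x, t) \<ge> lower_env closed_half u (- x0, t0) - ?\<psi> (- x0, t0)"
        using t a by (simp add: env)
    qed
    hence "0 \<le> visc_lhs \<alpha> ?\<psi> (- x0) t0" using super a c bd unfolding viscosity_supersolution_def by blast
    thus "visc_lhs \<alpha> \<phi> x0 t0 \<le> 0" using visc_lhs_reflect[OF a(4,1), of \<alpha> x0] by simp
  qed
  moreover have "continuous_on closed_half (\<lambda>p. 1 - u (- fst p, snd p))"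
    by (intro continuous_on_diff continuous_on_const continuous_on_compose2[OF u(2)] continuous_intros) auto
  moreover have "bounded ((\<lambda>p. 1 - u (- fst p, snd p)) ` closed_half)"
  proof -
    obtain b where "\<forall>p\<in>closed_half. \<bar>u p\<bar> \<le> b" using u(1) by (auto simp: bounded_iff)
    hence b: "\<bar>u (- x, t)\<bar> \<le> b" if "0 \<le> t" for x t using that by auto
    have "\<bar>1 - u (- x, t)\<bar> \<le> 1 + b" if "0 \<le> t" for x t using b[OF that, of x] by linarith
    hence "\<forall>p\<in>closed_half. \<bar>1 - u (- fst p, snd p)\<bar> \<le> 1 + b" by auto
    thus ?thesis by (auto simp: bounded_iff)
  qed
  ultimately show "subsol \<alpha> (\<lambda>p. 1 - u (- fst p, snd p))" by (simp add: subsol_def)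
qed

theorem theorem1p5:
  fixes \<alpha> :: real and u0 :: "real \<Rightarrow> real" and u :: "real \<times> real \<Rightarrow> real"
    and K :: "(real \<times> real) set"
  assumes "0 < \<alpha>" and "\<alpha> < 2"
    and "u0 \<in> BUC"
    and "(u0 \<longlongrightarrow> 0) at_bot" and "(u0 \<longlongrightarrow> 1) at_top"
    and "bounded (u ` (UNIV \<times> {0..}))" and "continuous_on (UNIV \<times> {0..}) u"
    and "ivp_solution \<alpha> u0 u"
    and "compact K" and "K \<subseteq> (UNIV \<times> {0..}) - {(0, 0)}"
  shows "uniform_limit K (\<lambda>l. rescale \<alpha> l u) (self_similar \<alpha>) at_top"
proof (rule uniform_limitI)
  fix e :: real assume e: "0 < e"
  note \<alpha> = assms(1,2)
  have u0: "continuous_on UNIV u0"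
    using assms(3) by (auto simp: BUC_def intro: uniformly_continuous_imp_continuous)
  note sol = ivp_solution_subsol[OF assms(6-8) u0]
  define v where "v p = 1 - u (- fst p, snd p)" for p
  define K' where "K' = (\<lambda>p. (- fst p, snd p)) ` K"
  have "compact K'" unfolding K'_def
    by (intro compact_continuous_image assms(9) continuous_intros)
  moreover have "K' \<subseteq> closed_half - {(0, 0)}" using assms(10) by (auto simp: K'_def)
  \<comment> \<open>The reflection also exchanges the two limits of the data, so v meets the same
    assumptions as u, and an upper bound for v is a lower bound for u.\<close>
  moreover have "v (x, 0) \<le> 1 - u0 (- x)" for x using sol(4)[of "- x"] by (simp add: v_def)
  moreover have "((\<lambda>x. 1 - u0 (- x)) \<longlongrightarrow> 1 - 1) at_bot"
    by (intro tendsto_diff tendsto_const filterlim_compose[OF assms(5)] filterlim_uminus_at_top_at_bot)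
  moreover have "((\<lambda>x. 1 - u0 (- x)) \<longlongrightarrow> 1 - 0) at_top"
    by (intro tendsto_diff tendsto_const filterlim_compose[OF assms(4)] filterlim_uminus_at_bot_at_top)
  moreover have "subsol \<alpha> v" using sol(3) by (simp add: v_def[abs_def])
  ultimately have "eventually (\<lambda>l. \<forall>p\<in>K'. rescale \<alpha> l v p \<le> self_similar \<alpha> p + e / 2) at_top"
    using rescaled_subsol_le[OF \<alpha>, of v "\<lambda>x. 1 - u0 (- x)" K' "e / 2"] e by simp
  moreover have "eventually (\<lambda>l. \<forall>p\<in>K. rescale \<alpha> l u p \<le> self_similar \<alpha> p + e / 2) at_top"
    using rescaled_subsol_le[OF \<alpha> sol(1,2) assms(4,5,9,10), of "e / 2"] e by simp
  ultimately show "eventually (\<lambda>l. \<forall>p\<in>K. dist (rescale \<alpha> l u p) (self_similar \<alpha> p) < e) at_top"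
  proof eventually_elim
    case (elim l)
    show ?case
    proof
      fix p assume p: "p \<in> K"
      obtain x t where xt: "p = (x, t)" by (cases p)
      have "(- x, t) \<in> K'" using p unfolding K'_def xt by force
      with elim(1) have "rescale \<alpha> l v (- x, t) \<le> self_similar \<alpha> (- x, t) + e / 2" by blast
      moreover have "self_similar \<alpha> (- x, t) = 1 - self_similar \<alpha> (x, t)"
        using p assms(10) xt by (intro self_similar_reflect \<alpha>) auto
      moreover have "rescale \<alpha> l v (- x, t) = 1 - rescale \<alpha> l u (x, t)"
        by (simp add: rescale_def v_def)
      ultimately have "self_similar \<alpha> p - e / 2 \<le> rescale \<alpha> l u p" by (simp add: xt)
      with elim(2) p e show "dist (rescale \<alpha> l u p) (self_similar \<alpha> p) < e"
        by (force simp: dist_real_def abs_less_iff)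
    qed
  qed
qed

end
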